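(* Consider the random walk $\mathbf{X}$ in a Markovian environment on a Galton--Watson tree $\mathcal{G}$ with offspring mean $b>1$, as described in the context, with kernel $K$ on $\Sigma'=(0,\infty)\times\Sigma$. Suppose that $K$ satisfies Assumption 1 of the context. Then: (i) If Assumption 2 of the context holds, the condition $$\limsup_{\min\{-C,R\}\to\infty}\ \inf_{\lambda\in[0,1]}\Lambda^{(Q_{C,R})}(\lambda)\;>\;-\ln b-\ln(1-\eta)$$ implies transience of $\mathbf{X}$ on $\mathcal{G}$, where $\eta$ is the constant introduced in Assumption 2. (ii) The condition $$\inf_{\lambda\in[0,1]}\Lambda^{(K_{\ln})}(\lambda)\;<\;-\ln b$$ implies positive recurrence of $\mathbf{X}$ on $\mathcal{G}$.
   Context: Tree and walk: $\mathcal{G}$ is a Galton--Watson tree with root $\varrho$ and offspring mean $b>1$, augmented by a vertex $\varrho^{-1}$ adjoined as parent of $\varrho$. A vertex $\nu\neq\varrho^{-1}$ has $b(\nu)$ offspring $\nu1,\dots,\nu b(\nu)$ and parent $\nu^{-1}$. Given positive finite weights $A_{\nu}$ (the weight of an edge is indexed by its endpoint farther from $\varrho$), the environment is $$\omega(\nu,\nu i)=\frac{A_{\nu i}}{1+\sum_{j\le b(\nu)}A_{\nu j}},\qquad \omega(\nu,\nu^{-1})=\frac{1}{1+\sum_{j\le b(\nu)}A_{\nu j}},$$ and, given $\omega$, $\mathbf{X}$ is the Markov chain started at $\varrho$ with these transition probabilities, $\varrho^{-1}$ being absorbing (law $\mathbf{P}_\omega$). $\mathbb{P}$ is the law of the environment,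 $\mathbf{P}=\mathbb{P}\times\mathbf{P}_\omega$ the annealed measure. Transience means that with positive $\mathbf{P}$-probability $\mathbf{X}$ never hits $\varrho^{-1}$. Positive recurrence means that for $\mathbb{P}$-almost every environment the $\mathbf{P}_\omega$-expected time for $\mathbf{X}$ to hit $\varrho^{-1}$ is finite (equivalently, the chain in which $\varrho^{-1}$ is made reflecting is positive recurrent). Markovian environment: $\Sigma$ is a Polish space, $\Sigma'=(0,\infty)\times\Sigma$ with Borel sets $\mathcal{B}=\mathcal{B}(\Sigma')$. Each vertex $\nu$ carries $\Gamma_\nu=(A_\nu,M_\nu)\in\Sigma'$. Along every infinite line of descent $\sigma=(\sigma_0=\varrho,\sigma_1,\dots)$, $(\Gamma_{\sigma_i})_{i\ge0}$ is a Markov chain with transition kernel $K$. The environment is constructed sequentially along the tree from any initial condition $\Gamma_\varrho\in\Sigma'$: for each $\nu$, $(\Gamma_{\nu i})_i$ are generated from some joint distribution whose marginals, conditionally on $\Gamma_\nu$ and the further past, equal $K(\Gamma_\nu,\cdot)$ (independence among the $\Gamma_{\nu i}$, $i\ge1$, is not required). $K^{(m)}$ denotes the $m$-step iterate (convolution power) of $K$. Assumption 1: there exist integers $0<\ell\le N$ and a constant $\kappa\ge1$ such that for all $x,y\in\Sigma'$ and $B\in\mathcal{B}$, $K^{(\ell)}(x,B)\le\frac{\kappa}{N}\sum_{m=1}^N K^{(m)}(y,B)$. Assumption 2: with $\eta_{\varepsilon,r}=1-\inf_{y\in\Sigma'}\mathbb{P}(\varepsilon<A_{\sigma_1}\le r\mid\Gamma_{\sigma_0}=y)$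 and $\eta=\liminf_{\varepsilon\downarrow0,\,r\to\infty}\eta_{\varepsilon,r}$, one has $\eta<1$. Kernels: $K_{\ln}$ is the kernel on $\mathbb{R}\times\Sigma$ of the chain $(\ln A_{\sigma_i},M_{\sigma_i})$, i.e. $K_{\ln}((\tilde u,z),B)=K((e^{\tilde u},z),E(B))$ with $E(B)=\{(e^{\tilde u},z):(\tilde u,z)\in B\}$. For $R\in(0,\infty)$ and $C\in(-\infty,0)$, $Q_{C,R}$ is the probability kernel on $(C,R]\times\Sigma$ given by $$Q_{C,R}(\tilde y,(d\tilde u,dz))=\frac{K_{\ln}(\tilde y,(d\tilde u,dz))}{K_{\ln}(\tilde y,(C,R]\times\Sigma)}$$ (under Assumption 2 it is well defined for all large $-C$ and $R$). For a probability kernel $\widetilde K$ on a state space contained in $\mathbb{R}\times\Sigma$, governing a Markov chain $\widetilde\Gamma_i=(W_i,\widetilde M_i)$, $i\ge0$, define $$\Lambda^{(\widetilde K)}(\lambda)=\limsup_{n\to\infty}\ \sup_{\tilde y}\ \frac1n\ln\mathbb{E}\Bigl[e^{\lambda\sum_{i=1}^nW_i}\,\Big|\,\widetilde\Gamma_0=\tilde y\Bigr],$$ the supremum being over the state space of the chain. *)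

theory Defs
  imports "HOL-Probability.Probability"
begin

section \<open>Markov chains\<close>

text \<open>The path law, on \<open>\<nat> \<rightarrow> space S\<close>, of the Markov chain with kernel \<open>K\<close> started at \<open>y\<close>:
  the Ionescu-Tulcea measure in which coordinate 0 is \<open>y\<close> and coordinate \<open>i + 1\<close> is drawn from
  \<open>K\<close> applied to coordinate \<open>i\<close>.\<close>

definition chain_kernels ::
  "'a measure \<Rightarrow> ('a \<Rightarrow> 'a measure) \<Rightarrow> 'a \<Rightarrow> nat \<Rightarrow> (nat \<Rightarrow> 'a) \<Rightarrow> 'a measure" where
  "chain_kernels S K y i h = (if i = 0 then return S y else K (h (i - 1)))"

definition chain_law :: "'a measure \<Rightarrow> ('a \<Rightarrow> 'a measure) \<Rightarrow> 'a \<Rightarrow> (nat \<Rightarrow> 'a) measure" where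
  "chain_law S K y =
     projective_family.lim UNIV (Ionescu_Tulcea.CI (chain_kernels S K y) (\<lambda>_. S)) (\<lambda>_. S)"

lemma Ionescu_Tulcea_chain_kernels:
  assumes K: "K \<in> S \<rightarrow>\<^sub>M prob_algebra S" and y: "y \<in> space S"
  shows "Ionescu_Tulcea (chain_kernels S K y) (\<lambda>_. S)"
proof -
  have 1: "chain_kernels S K y i \<in> PiM {0..<i} (\<lambda>_. S) \<rightarrow>\<^sub>M prob_algebra S" for i
  proof (cases i)
    case 0
    have "return S y \<in> space (prob_algebra S)"
      using y by (simp add: space_prob_algebra prob_space_return)
    moreover have "chain_kernels S K y 0 = (\<lambda>_. return S y)"
      by (simp add: chain_kernels_def fun_eq_iff)
    ultimately show ?thesis using 0 by simp
  next
    case (Suc j)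
    have "(\<lambda>h. K (h j)) \<in> PiM {0..<i} (\<lambda>_. S) \<rightarrow>\<^sub>M prob_algebra S"
      using Suc by (intro measurable_compose[OF _ K] measurable_component_singleton) simp
    moreover have "chain_kernels S K y i = (\<lambda>h. K (h j))"
      using Suc by (simp add: chain_kernels_def fun_eq_iff)
    ultimately show ?thesis by simp
  qed
  have "chain_kernels S K y i \<in> PiM {0..<i} (\<lambda>_. S) \<rightarrow>\<^sub>M subprob_algebra S" for i
    using 1 by (rule measurable_prob_algebraD)
  moreover have "prob_space (chain_kernels S K y i x)"
    if "x \<in> space (PiM {0..<i} (\<lambda>_. S))" for i x
    using measurable_space[OF 1 that] by (simp add: space_prob_algebra)
  ultimately show ?thesis
    unfolding Ionescu_Tulcea_def by blast
qed

primrec iter_kernel :: "'a measure \<Rightarrow> ('a \<Rightarrow> 'a measure) \<Rightarrow> nat \<Rightarrow> 'a \<Rightarrow> 'a measure" where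
  "iter_kernel S K 0 x = return S x"
| "iter_kernel S K (Suc m) x = K x \<bind> iter_kernel S K m"

definition ln_ennreal :: "ennreal \<Rightarrow> ereal" where
  "ln_ennreal x = (if x = \<top> then \<infinity> else if x = 0 then -\<infinity> else ereal (ln (enn2real x)))"

text \<open>\<open>\<Lambda>\<close>, for a kernel \<open>K\<close> on a state space \<open>S\<close> contained in \<open>\<real> \<times> \<Sigma>\<close>; the expectation may be
  infinite, so values are extended reals. The term \<open>n = 0\<close> is irrelevant to the limsup.\<close>

definition Lambda ::
  "(real \<times> 's) measure \<Rightarrow> (real \<times> 's \<Rightarrow> (real \<times> 's) measure) \<Rightarrow> real \<Rightarrow> ereal" where
  "Lambda S K l = limsup (\<lambda>n. SUP y\<in>space S. ereal (1 / real n) *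
     ln_ennreal (\<integral>\<^sup>+ x. ennreal (exp (l * (\<Sum>i=1..n. fst (x i)))) \<partial>chain_law S K y))"


section \<open>Kernels and assumptions\<close>

text \<open>Throughout, \<open>\<Sigma>\<close> is the type \<open>'s::polish_space\<close>.\<close>

definition Sigma' :: "(real \<times> 's::polish_space) measure" where
  "Sigma' = restrict_space borel ({0<..} \<times> UNIV)"

definition assumption1 :: "(real \<times> 's::polish_space \<Rightarrow> (real \<times> 's) measure) \<Rightarrow> bool" where
  "assumption1 K \<longleftrightarrow> (\<exists>l N :: nat. \<exists>\<kappa> :: real. 0 < l \<and> l \<le> N \<and> 1 \<le> \<kappa> \<and>
     (\<forall>x\<in>space Sigma'. \<forall>y\<in>space Sigma'. \<forall>B\<in>sets Sigma'.
        measure (iter_kernel Sigma' K l x) B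
          \<le> \<kappa> / real N * (\<Sum>m=1..N. measure (iter_kernel Sigma' K m y) B)))"

definition eta_at ::
  "(real \<times> 's::polish_space \<Rightarrow> (real \<times> 's) measure) \<Rightarrow> real \<Rightarrow> real \<Rightarrow> real" where
  "eta_at K e r = 1 - (INF y\<in>space Sigma'. measure (K y) ({e<..r} \<times> UNIV))"

definition eta :: "(real \<times> 's::polish_space \<Rightarrow> (real \<times> 's) measure) \<Rightarrow> ereal" where
  "eta K = Liminf (at_right 0 \<times>\<^sub>F at_top) (\<lambda>(e, r). ereal (eta_at K e r))"

definition assumption2 :: "(real \<times> 's::polish_space \<Rightarrow> (real \<times> 's) measure) \<Rightarrow> bool" where
  "assumption2 K \<longleftrightarrow> eta K < 1"

text \<open>For a point \<open>(u, z)\<close> and a Borel set \<open>B\<close>, \<open>K_ln K (u, z) B\<close> is the \<open>K (exp u, z)\<close>-measure of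
  the preimage of \<open>B\<close> under \<open>(a, w) \<mapsto> (ln a, w)\<close>, which in \<open>(0, \<infinity>) \<times> \<Sigma>\<close> is the set
  \<open>{(exp u, w). (u, w) \<in> B}\<close>.\<close>

definition K_ln ::
  "(real \<times> 's::polish_space \<Rightarrow> (real \<times> 's) measure) \<Rightarrow> real \<times> 's \<Rightarrow> (real \<times> 's) measure" where
  "K_ln K y = distr (K (exp (fst y), snd y)) borel (\<lambda>(a, w). (ln a, w))"

definition strip :: "real \<Rightarrow> real \<Rightarrow> (real \<times> 's::polish_space) measure" where
  "strip C R = restrict_space borel ({C<..R} \<times> UNIV)"

text \<open>\<^const>\<open>uniform_measure\<close> conditions an arbitrary measure on an event; it is the null measure
  when the event has measure zero, which for large \<open>-C\<close> and \<open>R\<close> the second assumption excludes.\<close>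

definition Q ::
  "(real \<times> 's::polish_space \<Rightarrow> (real \<times> 's) measure) \<Rightarrow> real \<Rightarrow> real \<Rightarrow>
     real \<times> 's \<Rightarrow> (real \<times> 's) measure" where
  "Q K C R y =
     restrict_space (uniform_measure (K_ln K y) ({C<..R} \<times> UNIV)) ({C<..R} \<times> UNIV)"


section \<open>Galton--Watson trees and random walks on them\<close>

text \<open>Vertices are Ulam-Harris labels, written leaf first: the root is \<^term>\<open>[]\<close>, the children of
  \<open>\<nu>\<close> are \<open>i # \<nu>\<close> with \<open>i\<close> less than the number of offspring of \<open>\<nu>\<close>, and the generation of \<open>\<nu>\<close> is
  \<^term>\<open>length \<nu>\<close>. Offspring numbers \<open>d\<close> are attached to all labels; those of labels outside the
  tree have no effect on the tree.\<close>

primrec in_tree :: "(nat list \<Rightarrow> nat) \<Rightarrow> nat list \<Rightarrow> bool" where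
  "in_tree d [] \<longleftrightarrow> True"
| "in_tree d (i # \<nu>) \<longleftrightarrow> i < d \<nu> \<and> in_tree d \<nu>"

text \<open>The walk lives on \<^typ>\<open>nat list option\<close>: \<^term>\<open>Some \<nu>\<close> is the vertex \<open>\<nu>\<close> of the tree and
  \<^term>\<open>None\<close> is the absorbing parent of the root.\<close>

primrec parent :: "nat list \<Rightarrow> nat list option" where
  "parent [] = None"
| "parent (i # \<nu>) = Some \<nu>"

definition walk_prob ::
  "(nat list \<Rightarrow> nat) \<Rightarrow> (nat list \<Rightarrow> real) \<Rightarrow> nat list option \<Rightarrow> nat list option \<Rightarrow> real" where
  "walk_prob d A v w = (case v of
     None \<Rightarrow> (if w = None then 1 else 0)
   | Some \<nu> \<Rightarrow>
      (if w = parent \<nu> then 1 / (1 + (\<Sum>j<d \<nu>. A (j # \<nu>)))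
       else if \<exists>i<d \<nu>. w = Some (i # \<nu>) then A (the w) / (1 + (\<Sum>j<d \<nu>. A (j # \<nu>)))
       else 0))"

definition walk_step ::
  "(nat list \<Rightarrow> nat) \<Rightarrow> (nat list \<Rightarrow> real) \<Rightarrow> nat list option \<Rightarrow> nat list option pmf" where
  "walk_step d A v = embed_pmf (walk_prob d A v)"

lemma pmf_walk_step:
  assumes pos: "\<And>\<nu>. 0 < A \<nu>"
  shows "pmf (walk_step d A v) w = walk_prob d A v w"
  unfolding walk_step_def
proof (rule pmf_embed_pmf)
  show nonneg: "0 \<le> walk_prob d A v w" for w
    by (auto simp: walk_prob_def split: option.split
        intro!: divide_nonneg_nonneg add_nonneg_nonneg sum_nonneg less_imp_le[OF pos])
  show "(\<integral>\<^sup>+ w. ennreal (walk_prob d A v w) \<partial>count_space UNIV) = 1"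
  proof (cases v)
    case None
    have "(\<integral>\<^sup>+ w. ennreal (walk_prob d A v w) \<partial>count_space UNIV)
        = (\<integral>\<^sup>+ w. indicator {None :: nat list option} w \<partial>count_space UNIV)"
      by (intro nn_integral_cong) (simp add: None walk_prob_def)
    then show ?thesis by simp
  next
    case (Some \<nu>)
    define Z where "Z = 1 + (\<Sum>j<d \<nu>. A (j # \<nu>))"
    have Z: "Z > 0" unfolding Z_def
      by (intro add_pos_nonneg sum_nonneg less_imp_le[OF pos]) simp
    define ch where "ch = (\<lambda>i. Some (i # \<nu>)) ` {..<d \<nu>}"
    have neq: "Some (i # \<nu>) \<noteq> parent \<nu>" for i
      by (cases \<nu>) auto
    then have par: "parent \<nu> \<notin> ch"
      unfolding ch_def by force
    have "(\<integral>\<^sup>+ w. ennreal (walk_prob d A v w) \<partial>count_space UNIV)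
        = (\<Sum>w\<in>insert (parent \<nu>) ch. ennreal (walk_prob d A v w))"
      by (rule nn_integral_count_space') (auto simp: ch_def Some walk_prob_def)
    also have "\<dots> = ennreal (\<Sum>w\<in>insert (parent \<nu>) ch. walk_prob d A v w)"
      by (rule sum_ennreal) (rule nonneg)
    also have "(\<Sum>w\<in>insert (parent \<nu>) ch. walk_prob d A v w)
        = 1 / Z + (\<Sum>w\<in>ch. A (the w) / Z)"
    proof (subst sum.insert)
      show "finite ch" unfolding ch_def by simp
      have "(\<Sum>w\<in>ch. walk_prob d A v w) = (\<Sum>w\<in>ch. A (the w) / Z)"
        by (intro sum.cong refl) (auto simp: Some walk_prob_def ch_def Z_def neq)
      then show "walk_prob d A v (parent \<nu>) + (\<Sum>w\<in>ch. walk_prob d A v w)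
          = 1 / Z + (\<Sum>w\<in>ch. A (the w) / Z)"
        by (simp add: Some walk_prob_def Z_def)
    qed (rule par)
    also have "(\<Sum>w\<in>ch. A (the w) / Z) = (\<Sum>j<d \<nu>. A (j # \<nu>) / Z)"
      unfolding ch_def by (subst sum.reindex) (auto simp: inj_on_def)
    also have "1 / Z + (\<Sum>j<d \<nu>. A (j # \<nu>) / Z) = Z / Z"
      by (simp add: sum_divide_distrib[symmetric] add_divide_distrib[symmetric] Z_def)
    finally show ?thesis using Z by simp
  qed
qed

definition walk_law ::
  "(nat list \<Rightarrow> nat) \<Rightarrow> (nat list \<Rightarrow> real) \<Rightarrow> (nat \<Rightarrow> nat list option) measure" where
  "walk_law d A = chain_law (count_space UNIV) (\<lambda>v. measure_pmf (walk_step d A v)) (Some [])"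

text \<open>The time at which a path hits the parent of the root; the infimum of the empty set is \<open>\<infinity>\<close>.\<close>

definition hitting_time :: "(nat \<Rightarrow> nat list option) \<Rightarrow> ennreal" where
  "hitting_time x = (INF n\<in>{n. x n = None}. of_nat n)"


section \<open>Markovian environments\<close>

text \<open>The information available when the vertices of generation \<open>n + 1\<close> receive their values: the
  whole tree, and the values at its vertices of generation at most \<open>n\<close>. Values attached to labels
  outside the tree are ignored.\<close>

definition past ::
  "'w measure \<Rightarrow> (nat list \<Rightarrow> 'w \<Rightarrow> nat) \<Rightarrow> (nat list \<Rightarrow> 'w \<Rightarrow> real \<times> 's::polish_space) \<Rightarrow>
     nat \<Rightarrow> 'w measure" where
  "past M off \<Gamma> n = sigma (space M)
     ({{\<omega>\<in>space M. off \<nu> \<omega> = k} | \<nu> k. True} \<union>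
      {{\<omega>\<in>space M. in_tree (\<lambda>\<mu>. off \<mu> \<omega>) \<nu> \<and> \<Gamma> \<nu> \<omega> \<in> B} | \<nu> B. length \<nu> \<le> n \<and> B \<in> sets Sigma'})"

text \<open>\<open>M\<close> carries a Galton-Watson tree with offspring distribution \<open>p\<close> and values
  \<open>\<Gamma> \<nu> = (A\<^sub>\<nu>, M\<^sub>\<nu>)\<close> at its vertices. Given the past, each \<open>\<Gamma> (i # \<nu>)\<close> has law \<open>K (\<Gamma> \<nu>)\<close>, and
  the families of children of distinct vertices of the same generation are drawn independently;
  nothing is assumed on the joint law within a family.\<close>

locale markovian_environment = prob_space M for M :: "'w measure" +
  fixes p :: "nat pmf"
    and K :: "real \<times> 's::polish_space \<Rightarrow> (real \<times> 's) measure"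
    and x0 :: "real \<times> 's"
    and off :: "nat list \<Rightarrow> 'w \<Rightarrow> nat"
    and \<Gamma> :: "nat list \<Rightarrow> 'w \<Rightarrow> real \<times> 's"
  assumes offspring_indep: "indep_vars (\<lambda>_. count_space UNIV) off UNIV"
    and offspring_law: "\<And>\<nu>. distr M (count_space UNIV) (off \<nu>) = measure_pmf p"
    and env_measurable: "\<And>\<nu>. \<Gamma> \<nu> \<in> M \<rightarrow>\<^sub>M Sigma'"
    and initial: "AE \<omega> in M. \<Gamma> [] \<omega> = x0"
    and marginal: "\<And>\<nu> i B. B \<in> sets Sigma' \<Longrightarrow>
      AE \<omega> in M. in_tree (\<lambda>\<mu>. off \<mu> \<omega>) (i # \<nu>) \<longrightarrow>
        nn_cond_exp M (past M off \<Gamma> (length \<nu>))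
          (indicator {\<omega>\<in>space M. \<Gamma> (i # \<nu>) \<omega> \<in> B}) \<omega> = emeasure (K (\<Gamma> \<nu> \<omega>)) B"
    and families_indep: "\<And>n V B. finite V \<Longrightarrow> V \<subseteq> {\<nu>. length \<nu> = n} \<Longrightarrow>
      (\<And>\<nu>. B \<nu> \<in> sets Sigma') \<Longrightarrow>
      AE \<omega> in M. (\<forall>\<nu>\<in>V. in_tree (\<lambda>\<mu>. off \<mu> \<omega>) \<nu>) \<longrightarrow>
        nn_cond_exp M (past M off \<Gamma> n)
          (indicator {\<omega>\<in>space M. \<forall>\<nu>\<in>V. \<forall>i<off \<nu> \<omega>. \<Gamma> (i # \<nu>) \<omega> \<in> B (i # \<nu>)}) \<omega>
        = (\<Prod>\<nu>\<in>V. nn_cond_exp M (past M off \<Gamma> n)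
            (indicator {\<omega>\<in>space M. \<forall>i<off \<nu> \<omega>. \<Gamma> (i # \<nu>) \<omega> \<in> B (i # \<nu>)}) \<omega>)"

definition env_walk_law ::
  "(nat list \<Rightarrow> 'w \<Rightarrow> nat) \<Rightarrow> (nat list \<Rightarrow> 'w \<Rightarrow> real \<times> 's) \<Rightarrow> 'w \<Rightarrow>
     (nat \<Rightarrow> nat list option) measure" where
  "env_walk_law off \<Gamma> \<omega> = walk_law (\<lambda>\<nu>. off \<nu> \<omega>) (\<lambda>\<nu>. fst (\<Gamma> \<nu> \<omega>))"

text \<open>The integral is the probability of the event under the annealed measure.\<close>

definition transient ::
  "'w measure \<Rightarrow> (nat list \<Rightarrow> 'w \<Rightarrow> nat) \<Rightarrow> (nat list \<Rightarrow> 'w \<Rightarrow> real \<times> 's) \<Rightarrow> bool" where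
  "transient M off \<Gamma> \<longleftrightarrow>
     0 < (\<integral>\<^sup>+ \<omega>. emeasure (env_walk_law off \<Gamma> \<omega>) {x. \<forall>n. x n \<noteq> None} \<partial>M)"

definition positive_recurrent ::
  "'w measure \<Rightarrow> (nat list \<Rightarrow> 'w \<Rightarrow> nat) \<Rightarrow> (nat list \<Rightarrow> 'w \<Rightarrow> real \<times> 's) \<Rightarrow> bool" where
  "positive_recurrent M off \<Gamma> \<longleftrightarrow>
     (AE \<omega> in M. (\<integral>\<^sup>+ x. hitting_time x \<partial>env_walk_law off \<Gamma> \<omega>) < \<infinity>)"

end

theory Submission
  imports Defs
begin

text \<open>The chain is reversible, with conductance \<open>c \<nu>\<close>, the product of the weights along the path
  from the root to \<open>\<nu>\<close>, on the edge above \<open>\<nu>\<close>.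

  Positive recurrence: the expected hitting time is at most the total conductance up to a constant,
  and since \<open>l \<le> 1\<close> the sum of the \<open>c \<nu>\<close> is finite as soon as that of the \<open>c \<nu> powr l\<close> is. The
  expectation of the latter over generation \<open>n\<close> is \<open>b ^ n\<close> times an exponential moment of the chain
  along a line of descent, hence decays geometrically.

  Transience: the moment condition for all \<open>l\<close> in \<open>[0, 1]\<close> yields blocks of \<open>n\<close> generations in which,
  uniformly in the starting point, the logarithms of the weights stay in a bounded interval and add
  up to at least \<open>s\<close> with probability at least \<open>\<rho>\<close>, where \<open>\<rho> * b ^ n > 1\<close> and \<open>\<rho> * exp s * b ^ n > 1\<close>.
  The uniformity comes from the first assumption, the simultaneous inequalities from the additivity of
  the triples \<open>(ln \<rho>, s, n)\<close> under concatenation together with the connectedness of \<open>[0, 1]\<close>. On the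
  tree with offspring truncated at \<open>L\<close>, the descendants reached through successful blocks, weighted by
  the conditional probability of success of the current block, carry a flow from the root whose mean
  strength is \<open>b ^ r\<close> and whose second moment and mean energy are of the order \<open>b ^ (2 * r)\<close>;
  Thomson's principle then bounds the escape probability from below.\<close>

section \<open>Path laws of Markov chains and of the walk\<close>

text \<open>Two features of the model shape the transient part: siblings may depend on each other
  arbitrarily, and the offspring law has only a first moment. Lines of descent that part at
  generation \<open>k\<close> are conditionally independent from then on, so all that is lost is the
  size of one weight at the parting, at most of order \<open>a ^ k\<close> with
  \<open>a = (1 / \<rho>) powr (1 / n)\<close>. Relative to \<open>b ^ (2 * r)\<close> such pairs
  number \<open>b ^ (- k)\<close>, so \<open>a < b\<close> bounds the second moment; truncation at
  \<open>L\<close> bounds the number of sibling pairs. Along lines that carry flow the resistance at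
  generation \<open>k\<close> is at most of order \<open>z ^ k\<close> with
  \<open>z = exp (- s / n)\<close>, so this generation contributes the fraction
  \<open>(a * z / b) ^ k\<close> of the energy. The resulting condition \<open>a * z < b\<close> is
  the \<open>n\<close>-th root of \<open>\<rho> * exp s * b ^ n > 1\<close>.

  The term \<open>ln (1 - \<eta>)\<close> pays for the conditioning in \<open>Q\<close>: each step
  divides by a mass of at least \<open>q\<close>, with \<open>q\<close> slightly below
  \<open>1 - \<eta>\<close>. Undoing it, the chain killed outside the strip still has moments
  growing at a rate above \<open>- ln b\<close>, and only this chain occurs in the construction of
  blocks.\<close>

lemma measurable_PiM_component:
  "i \<in> I \<Longrightarrow> f \<in> S \<rightarrow>\<^sub>M N \<Longrightarrow> (\<lambda>x. f (x i)) \<in> PiM I (\<lambda>_. S) \<rightarrow>\<^sub>M N"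
  by (rule measurable_compose[where N=S]) (auto intro: measurable_component_singleton)

lemma sets_chain_law:
  assumes "K \<in> S \<rightarrow>\<^sub>M prob_algebra S" and "y \<in> space S"
  shows "sets (chain_law S K y) = sets (PiM UNIV (\<lambda>_. S))"
proof -
  interpret Ionescu_Tulcea "chain_kernels S K y" "\<lambda>_. S"
    by (rule Ionescu_Tulcea_chain_kernels[OF assms])
  show ?thesis by (simp add: chain_law_def)
qed

text \<open>The path law is a projective limit with finite-dimensional marginals \<open>CI\<close>.
  On an initial segment of the time axis \<open>CI\<close> is the iterated kernel \<open>C\<close>,
  which is open to induction over time.\<close>

lemma nn_integral_chain_law_restrict:
  assumes K: "K \<in> S \<rightarrow>\<^sub>M prob_algebra S" and y: "y \<in> space S"
    and F[measurable]: "F \<in> borel_measurable (PiM {0..<m} (\<lambda>_. S))"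
  shows "(\<integral>\<^sup>+ x. F (restrict x {0..<m}) \<partial>chain_law S K y) =
    (\<integral>\<^sup>+ x. F x \<partial>Ionescu_Tulcea.C (chain_kernels S K y) (\<lambda>_. S) 0 m (\<lambda>_. undefined))"
proof -
  interpret Ionescu_Tulcea "chain_kernels S K y" "\<lambda>_. S"
    by (rule Ionescu_Tulcea_chain_kernels[OF assms(1,2)])
  have u: "up_to {0..<m} = m"
    by (rule antisym) (auto simp: up_to_iff_Ico, metis finite_atLeastLessThan le_refl
        lessThan_atLeast0 lessThan_subset_iff up_to)
  have s: "(\<lambda>_. undefined) \<in> space (Pi\<^sub>M {0..<0::nat} (\<lambda>_. S))" by simp
  have "(\<integral>\<^sup>+ x. F (restrict x {0..<m}) \<partial>chain_law S K y)
      = (\<integral>\<^sup>+ x. F x \<partial>distr PF.lim (PiM {0..<m} (\<lambda>_. S)) (\<lambda>x. restrict x {0..<m}))"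
    unfolding chain_law_def by (subst nn_integral_distr) (auto intro!: measurable_restrict_subset
        simp: measurable_cong_sets[OF PF.sets_lim refl])
  also have "\<dots> = (\<integral>\<^sup>+ x. F x \<partial>CI {0..<m})" by (subst distr_lim) auto
  also have "\<dots> = (\<integral>\<^sup>+ x. F (restrict x {0..<m}) \<partial>C 0 m (\<lambda>_. undefined))"
    unfolding CI_def u
    by (subst nn_integral_distr) (auto intro!: measurable_restrict_subset
        simp: measurable_cong_sets[OF sets_C[OF s] refl])
  also have "\<dots> = (\<integral>\<^sup>+ x. F x \<partial>C 0 m (\<lambda>_. undefined))"
    using s by (intro nn_integral_cong) (simp add: space_C space_PiM)
  finally show ?thesis .
qed

lemma nn_integral_chain_law_0:
  assumes K: "K \<in> S \<rightarrow>\<^sub>M prob_algebra S" and y: "y \<in> space S"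
    and f[measurable]: "f \<in> borel_measurable S"
  shows "(\<integral>\<^sup>+ x. f (x 0) \<partial>chain_law S K y) = f y"
proof -
  interpret Ionescu_Tulcea "chain_kernels S K y" "\<lambda>_. S"
    by (rule Ionescu_Tulcea_chain_kernels[OF assms(1,2)])
  have s: "(\<lambda>_. undefined) \<in> space (Pi\<^sub>M {0..<0::nat} (\<lambda>_. S))" by simp
  have "(\<integral>\<^sup>+ x. f (x 0) \<partial>chain_law S K y) = (\<integral>\<^sup>+ x. f (restrict x {0..<1} 0) \<partial>chain_law S K y)" by simp
  also have "\<dots> = (\<integral>\<^sup>+ x. f (x 0) \<partial>C 0 1 (\<lambda>_. undefined))"
    by (rule nn_integral_chain_law_restrict[OF K y]) (auto intro!: measurable_PiM_component[OF _ f])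
  also have "\<dots> = (\<integral>\<^sup>+ x. f (x 0) \<partial>eP 0 (\<lambda>_. undefined))"
    unfolding One_nat_def C.simps add_0_left bind_return[OF measurable_eP s] ..
  also have "\<dots> = f y"
    by (subst nn_integral_eP[OF s]) (auto simp: chain_kernels_def nn_integral_return[OF y f]
       intro!: measurable_PiM_component[OF _ f])
  finally show ?thesis .
qed

text \<open>The Markov property at time \<open>n\<close>. Letting \<open>g\<close> see the path only
  through \<open>restrict\<close> expresses dependence on the past without a filtration on path
  space.\<close>

lemma nn_integral_chain_law_Suc:
  assumes K: "K \<in> S \<rightarrow>\<^sub>M prob_algebra S" and y: "y \<in> space S"
    and f[measurable]: "f \<in> borel_measurable S"
    and g[measurable]: "g \<in> borel_measurable (PiM {0..<Suc n} (\<lambda>_. S))"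
  shows "(\<integral>\<^sup>+ x. g (restrict x {0..<Suc n}) * f (x (Suc n)) \<partial>chain_law S K y) =
    (\<integral>\<^sup>+ x. g (restrict x {0..<Suc n}) * (\<integral>\<^sup>+ z. f z \<partial>K (x n)) \<partial>chain_law S K y)"
proof -
  interpret Ionescu_Tulcea "chain_kernels S K y" "\<lambda>_. S"
    by (rule Ionescu_Tulcea_chain_kernels[OF assms(1,2)])
  have s: "(\<lambda>_. undefined) \<in> space (Pi\<^sub>M {0..<0::nat} (\<lambda>_. S))" by simp
  have K': "K \<in> S \<rightarrow>\<^sub>M subprob_algebra S" using K by (rule measurable_prob_algebraD)
  have gm: "(\<lambda>x. g (restrict x {0..<Suc n})) \<in> borel_measurable (PiM {0..<Suc (Suc n)} (\<lambda>_. S))"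
    by (rule measurable_compose[OF measurable_restrict_subset g]) auto
  have fm: "(\<lambda>x. f (x (Suc n))) \<in> borel_measurable (PiM {0..<Suc (Suc n)} (\<lambda>_. S))"
    by (rule measurable_PiM_component[OF _ f]) auto
  have km: "(\<lambda>x. \<integral>\<^sup>+ z. f z \<partial>K (x n)) \<in> borel_measurable (PiM {0..<Suc n} (\<lambda>_. S))"
    by (rule measurable_PiM_component)
       (auto intro: measurable_compose[OF K' nn_integral_measurable_subprob_algebra[OF f]])
  have "(\<integral>\<^sup>+ x. g (restrict x {0..<Suc n}) * f (x (Suc n)) \<partial>chain_law S K y)
    = (\<integral>\<^sup>+ x. g (restrict (restrict x {0..<Suc (Suc n)}) {0..<Suc n}) * f (restrict x {0..<Suc (Suc n)}
        (Suc n)) \<partial>chain_law S K y)"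
    by (simp add: Int_absorb1)
  also have "\<dots> = (\<integral>\<^sup>+ x. g (restrict x {0..<Suc n}) * f (x (Suc n)) \<partial>C 0 (Suc (Suc n)) (\<lambda>_. undefined))"
    by (rule nn_integral_chain_law_restrict[OF K y, where F="\<lambda>x. g (restrict x {0..<Suc n})
        * f (x (Suc n))"])
       (rule borel_measurable_times_ennreal[OF gm fm])
  also have "\<dots> = (\<integral>\<^sup>+ x. (\<integral>\<^sup>+ x. g (restrict x {0..<Suc n}) * f (x (Suc n)) \<partial>eP (Suc n) x) \<partial>C 0 (Suc n)
      (\<lambda>_. undefined))"
    unfolding C.simps(2)[of 0 "Suc n"] add_0
  proof (rule nn_integral_bind[where B="PiM {0..<Suc (Suc n)} (\<lambda>_. S)",
      OF borel_measurable_times_ennreal[OF gm fm]])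
    show "eP (Suc n) \<in> C 0 (Suc n) (\<lambda>_. undefined) \<rightarrow>\<^sub>M subprob_algebra (PiM {0..<Suc (Suc n)} (\<lambda>_. S))"
      using measurable_eP[of "Suc n"]
        unfolding measurable_cong_sets[OF sets_C[OF s, of "Suc n", unfolded add_0] refl] .
  qed
  also have "\<dots> = (\<integral>\<^sup>+ x. g x * (\<integral>\<^sup>+ z. f z \<partial>K (x n)) \<partial>C 0 (Suc n) (\<lambda>_. undefined))"
  proof (rule nn_integral_cong)
    fix x assume "x \<in> space (C 0 (Suc n) (\<lambda>_. undefined))"
    then have x: "x \<in> space (PiM {0..<Suc n} (\<lambda>_. S))" unfolding space_C[OF s, of "Suc n"] add_0 .
    then have xe: "x \<in> extensional {0..<Suc n}" by (simp add: space_PiM PiE_def)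
    have xn: "x n \<in> space S" using x by (auto simp: space_PiM PiE_def)
    have r: "restrict (x(Suc n := z)) {0..<Suc n} = x" for z
      by (rule ext) (simp add: extensional_arb[OF xe])
    have fk: "f \<in> borel_measurable (K (x n))"
      unfolding measurable_cong_sets[OF sets_kernel[OF K' xn] refl] by (rule f)
    show "(\<integral>\<^sup>+ x. g (restrict x {0..<Suc n}) * f (x (Suc n)) \<partial>eP (Suc n) x)
        = g x * (\<integral>\<^sup>+ z. f z \<partial>K (x n))"
      unfolding nn_integral_eP[OF x borel_measurable_times_ennreal[OF gm fm]]
      by (simp add: r chain_kernels_def nn_integral_cmult fk del: restrict_apply)
  qed
  also have "\<dots> = (\<integral>\<^sup>+ x. g (restrict x {0..<Suc n}) * (\<integral>\<^sup>+ z. f z \<partial>K (restrict x {0..<Suc n} n))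
      \<partial>chain_law S K y)"
    by (rule nn_integral_chain_law_restrict[OF K y, symmetric])
        (rule borel_measurable_times_ennreal[OF g km])
  finally show ?thesis by simp
qed

lemma nn_integral_chain_law_Suc':
  assumes K: "K \<in> S \<rightarrow>\<^sub>M prob_algebra S" and y: "y \<in> space S"
    and f[measurable]: "f \<in> borel_measurable S"
  shows "(\<integral>\<^sup>+ x. f (x (Suc n)) \<partial>chain_law S K y) =
    (\<integral>\<^sup>+ x. (\<integral>\<^sup>+ z. f z \<partial>K (x n)) \<partial>chain_law S K y)"
  using nn_integral_chain_law_Suc[OF K y f, of "\<lambda>_. 1" n] by simp

text \<open>Exponential moments become powers of a tilted transition operator, so that
  \<open>Lambda\<close> is the growth rate of that operator.\<close>

lemma nn_integral_chain_law_exp: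
  assumes K: "K \<in> S \<rightarrow>\<^sub>M prob_algebra S" and y: "y \<in> space S"
    and fst: "fst \<in> borel_measurable S"
  shows "(\<integral>\<^sup>+ x. ennreal (exp (l * (\<Sum>i=1..n. fst (x i)))) \<partial>chain_law S K y) =
    ((\<lambda>f y. \<integral>\<^sup>+ z. ennreal (exp (l * fst z)) * f z \<partial>K y) ^^ n) (\<lambda>_. 1) y"
proof -
  note fst[measurable]
  have K': "K \<in> S \<rightarrow>\<^sub>M subprob_algebra S" using K by (rule measurable_prob_algebraD)
  define T where "T = (\<lambda>f y. \<integral>\<^sup>+ z. ennreal (exp (l * fst z)) * f z \<partial>K y)"
  have Tm[measurable]: "T f \<in> borel_measurable S" if [measurable]: "f \<in> borel_measurable S"
    for f :: "_ \<Rightarrow> ennreal"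
    unfolding T_def by (rule measurable_compose[OF K' nn_integral_measurable_subprob_algebra])
        measurable
  \<comment> \<open>The function \<open>f\<close> of the last state is what the induction needs:
    integrating out the last step replaces \<open>f\<close> by \<open>T f\<close>.\<close>
  have "(\<integral>\<^sup>+ x. ennreal (exp (l * (\<Sum>i=1..n. fst (x i)))) * f (x n) \<partial>chain_law S K y) = (T ^^ n) f y"
    if [measurable]: "f \<in> borel_measurable S" for f
    using that
  proof (induction n arbitrary: f)
    case 0
    then show ?case by (simp add: nn_integral_chain_law_0[OF K y])
  next
    case (Suc n)
    note Suc.prems[measurable]
    have [measurable]: "(\<lambda>x. \<Sum>i=1..n. fst (x i)) \<in> borel_measurable (PiM {0..<Suc n} (\<lambda>_. S))"
      by (intro borel_measurable_sum measurable_PiM_component[OF _ fst]) auto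
    have "(\<integral>\<^sup>+ x. ennreal (exp (l * (\<Sum>i=1..Suc n. fst (x i)))) * f (x (Suc n)) \<partial>chain_law S K y)
       = (\<integral>\<^sup>+ x. ennreal (exp (l * (\<Sum>i=1..n. fst (restrict x {0..<Suc n} i)))) *
            (ennreal (exp (l * fst (x (Suc n)))) * f (x (Suc n))) \<partial>chain_law S K y)"
      by (intro nn_integral_cong)
         (simp add: distrib_left exp_add ennreal_mult mult.assoc)
    also have "\<dots> = (\<integral>\<^sup>+ x. ennreal (exp (l * (\<Sum>i=1..n. fst (restrict x {0..<Suc n} i)))) * T f (x n)
        \<partial>chain_law S K y)"
      unfolding T_def
      by (rule nn_integral_chain_law_Suc[OF K y,
      where g="\<lambda>x. ennreal (exp (l * (\<Sum>i=1..n. fst (x i))))"]) measurable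
    also have "\<dots> = (\<integral>\<^sup>+ x. ennreal (exp (l * (\<Sum>i=1..n. fst (x i)))) * T f (x n) \<partial>chain_law S K y)"
      by (intro nn_integral_cong arg_cong2[where f="(*)"] refl arg_cong[where f=ennreal]
          arg_cong[where f=exp] sum.cong) auto
    also have "\<dots> = (T ^^ n) (T f) y" by (rule Suc.IH) (rule Tm, rule Suc.prems)
    finally show ?case by (simp add: funpow_swap1)
  qed
  from this[of "\<lambda>_. 1"] show ?thesis by (simp add: T_def)
qed

section \<open>The walk and its escape probability\<close>

lemma walk_kernel: "(\<lambda>v. measure_pmf (walk_step d A v)) \<in> count_space UNIV \<rightarrow>\<^sub>M prob_algebra
    (count_space UNIV)"
  by (auto simp: space_prob_algebra prob_space_measure_pmf)

lemma nn_integral_walk_step_None: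
  assumes pos: "\<And>\<nu>. 0 < A \<nu>"
  shows "(\<integral>\<^sup>+ w. f w \<partial>measure_pmf (walk_step d A None)) = f None"
proof -
  have "(\<integral>\<^sup>+ w. f w \<partial>measure_pmf (walk_step d A None))
      = (\<integral>\<^sup>+ w. f None * indicator {None :: nat list option} w \<partial>count_space UNIV)"
    unfolding nn_integral_measure_pmf
    by (rule nn_integral_cong) (auto simp: pmf_walk_step[OF pos] walk_prob_def split: split_indicator)
  then show ?thesis by (simp add: nn_integral_cmult_indicator)
qed

lemma nn_integral_walk_step_Some:
  assumes pos: "\<And>\<nu>. 0 < A \<nu>" and Z: "Z = 1 + (\<Sum>j<d \<nu>. A (j # \<nu>))"
  shows "(\<integral>\<^sup>+ w. f w \<partial>measure_pmf (walk_step d A (Some \<nu>))) =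
    ennreal (1 / Z) * f (parent \<nu>) + (\<Sum>i<d \<nu>. ennreal (A (i # \<nu>) / Z) * f (Some (i # \<nu>)))"
proof -
  define ch where "ch = (\<lambda>i. Some (i # \<nu>)) ` {..<d \<nu>}"
  have neq: "Some (i # \<nu>) \<noteq> parent \<nu>" for i by (cases \<nu>) auto
  then have par: "parent \<nu> \<notin> ch" unfolding ch_def by force
  have "(\<integral>\<^sup>+ w. f w \<partial>measure_pmf (walk_step d A (Some \<nu>))) =
     (\<integral>\<^sup>+ w. ennreal (walk_prob d A (Some \<nu>) w) * f w \<partial>count_space UNIV)"
    unfolding nn_integral_measure_pmf by (simp add: pmf_walk_step[OF pos])
  also have "\<dots> = (\<Sum>w\<in>insert (parent \<nu>) ch. ennreal (walk_prob d A (Some \<nu>) w) * f w)"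
    by (rule nn_integral_count_space') (auto simp: ch_def walk_prob_def)
  also have "\<dots> = ennreal (1 / Z) * f (parent \<nu>) + (\<Sum>w\<in>ch. ennreal (walk_prob d A (Some \<nu>) w) * f w)"
    using par by (subst sum.insert) (auto simp: ch_def walk_prob_def Z)
  also have "(\<Sum>w\<in>ch. ennreal (walk_prob d A (Some \<nu>) w) * f w) =
      (\<Sum>i<d \<nu>. ennreal (A (i # \<nu>) / Z) * f (Some (i # \<nu>)))"
    unfolding ch_def by (subst sum.reindex) (auto simp: inj_on_def walk_prob_def Z neq intro!: sum.cong)
  finally show ?thesis .
qed

text \<open>If \<open>\<beta> \<nu>\<close> is the probability that the walk from
  \<open>\<nu>\<close> never visits the parent of \<open>\<nu>\<close>, this is the probability of
  hitting \<open>None\<close> from \<open>\<nu>\<close>: the walk has to climb past every ancestor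
  in turn.\<close>

primrec escape_bound :: "(nat list \<Rightarrow> real) \<Rightarrow> nat list \<Rightarrow> real" where
  "escape_bound \<beta> [] = 1 - \<beta> []"
| "escape_bound \<beta> (i # \<nu>) = escape_bound \<beta> \<nu> * (1 - \<beta> (i # \<nu>))"

text \<open>A subsolution of the escape recursion lies below the true escape probability. Extended
  by 1 to \<open>None\<close>, \<open>escape_bound \<beta>\<close> is superharmonic, so its mean
  along the walk never exceeds its value \<open>1 - \<beta> []\<close> at the root, and this mean
  dominates the probability of sitting at \<open>None\<close>.\<close>

lemma emeasure_walk_law_escape:
  fixes \<beta> :: "nat list \<Rightarrow> real"
  assumes pos: "\<And>\<nu>. 0 < A \<nu>" and \<beta>0: "\<And>\<nu>. 0 \<le> \<beta> \<nu>" and \<beta>1: "\<And>\<nu>. \<beta> \<nu> \<le> 1"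
    and sub: "\<And>\<nu>. \<beta> \<nu> * (1 + (\<Sum>i<d \<nu>. A (i # \<nu>) * \<beta> (i # \<nu>))) \<le> (\<Sum>i<d \<nu>. A (i # \<nu>) * \<beta> (i # \<nu>))"
  shows "ennreal (\<beta> []) \<le> emeasure (walk_law d A) {x. \<forall>n. x n \<noteq> None}"
proof -
  let ?S = "count_space (UNIV :: nat list option set)"
  note K = walk_kernel[of d A]
  have yS: "Some [] \<in> space ?S" by simp
  let ?L = "walk_law d A"
  interpret L: prob_space ?L
    using nn_integral_chain_law_0[OF K yS, of "\<lambda>_. 1"] unfolding walk_law_def
    by (intro prob_spaceI) simp
  have sL: "sets ?L = sets (PiM UNIV (\<lambda>_. ?S))"
    unfolding walk_law_def by (rule sets_chain_law[OF K yS])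
  have spL: "space ?L = UNIV" using sets_eq_imp_space_eq[OF sL] by (simp add: space_PiM)
  have meas[measurable]: "(\<lambda>x. x n) \<in> ?L \<rightarrow>\<^sub>M ?S" for n
    unfolding measurable_cong_sets[OF sL refl] by (rule measurable_component_singleton) simp
  define u :: "nat list option \<Rightarrow> real" where "u v = (case v of None \<Rightarrow> 1 | Some \<nu> \<Rightarrow> escape_bound \<beta> \<nu>)"
    for v
  have e0: "0 \<le> escape_bound \<beta> \<nu>" for \<nu>
    by (induction \<nu>) (auto simp: \<beta>1)
  have u0: "0 \<le> u v" for v by (cases v) (auto simp: u_def e0)
  have step: "(\<integral>\<^sup>+ w. ennreal (u w) \<partial>measure_pmf (walk_step d A v)) \<le> ennreal (u v)" for v
  proof (cases v)
    case None then show ?thesis by (simp add: nn_integral_walk_step_None[OF pos])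
  next
    case (Some \<nu>)
    define Z where "Z = 1 + (\<Sum>j<d \<nu>. A (j # \<nu>))"
    have Z: "Z > 0" unfolding Z_def by (intro add_pos_nonneg sum_nonneg less_imp_le[OF pos]) simp
    define B where "B = (\<Sum>i<d \<nu>. A (i # \<nu>) * \<beta> (i # \<nu>))"
    have B0: "0 \<le> B" unfolding B_def by (intro sum_nonneg mult_nonneg_nonneg \<beta>0 less_imp_le[OF pos])
    define p where "p = u (parent \<nu>)"
    have p0: "0 \<le> p" unfolding p_def by (rule u0)
    have up: "escape_bound \<beta> \<nu> = p * (1 - \<beta> \<nu>)" by (cases \<nu>) (auto simp: p_def u_def)
    have "(\<integral>\<^sup>+ w. ennreal (u w) \<partial>measure_pmf (walk_step d A v)) =
      ennreal (1 / Z) * ennreal (u (parent \<nu>)) + (\<Sum>i<d \<nu>. ennreal (A (i # \<nu>) / Z) * ennreal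
          (u (Some (i # \<nu>))))"
      unfolding Some by (rule nn_integral_walk_step_Some) (use pos Z_def in auto)
    also have "\<dots> = ennreal (1 / Z * p + (\<Sum>i<d \<nu>. A (i # \<nu>) / Z * (escape_bound \<beta> \<nu> * (1 - \<beta> (i # \<nu>)))))"
      using Z p0 by (subst ennreal_plus)
         (auto simp: ennreal_mult[symmetric] u0 p_def u_def \<beta>1 e0 sum_ennreal less_imp_le[OF pos]
             intro!: sum_nonneg)
    also have "1 / Z * p + (\<Sum>i<d \<nu>. A (i # \<nu>) / Z * (escape_bound \<beta> \<nu> * (1 - \<beta> (i # \<nu>))))
        = (p + escape_bound \<beta> \<nu> * (Z - 1 - B)) / Z"
      by (simp add: Z_def B_def sum_distrib_left sum_divide_distrib sum_subtractf[symmetric]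
          add_divide_distrib algebra_simps diff_divide_distrib)
    also have "\<dots> \<le> escape_bound \<beta> \<nu>"
    proof -
      \<comment> \<open>Superharmonicity at \<open>\<nu>\<close> reads \<open>p + escape_bound
        \<beta> \<nu> * (Z - 1 - B) \<le> Z * escape_bound \<beta> \<nu>\<close>. With
        \<open>escape_bound \<beta> \<nu> = p * (1 - \<beta> \<nu>)\<close> it reduces to this
        inequality, a rearrangement of \<open>sub\<close>.\<close>
      have "(1 - \<beta> \<nu>) * (1 + B) \<ge> 1" using sub[of \<nu>] by (simp add: B_def[symmetric] algebra_simps)
      then have "p * 1 \<le> p * ((1 - \<beta> \<nu>) * (1 + B))" by (intro mult_left_mono p0)
      then have "p \<le> escape_bound \<beta> \<nu> * (1 + B)" by (simp add: up mult.assoc)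
      then show ?thesis using Z by (simp add: divide_le_eq algebra_simps)
    qed
    finally show ?thesis by (simp add: Some u_def ennreal_leI)
  qed
  have E: "(\<integral>\<^sup>+ x. ennreal (u (x n)) \<partial>?L) \<le> ennreal (1 - \<beta> [])" for n
  proof (induction n)
    case 0 then show ?case unfolding walk_law_def by (subst nn_integral_chain_law_0[OF K yS]) (auto
        simp: u_def)
  next
    case (Suc n)
    have "(\<integral>\<^sup>+ x. ennreal (u (x (Suc n))) \<partial>?L)
        = (\<integral>\<^sup>+ x. (\<integral>\<^sup>+ w. ennreal (u w) \<partial>measure_pmf (walk_step d A (x n))) \<partial>?L)"
      unfolding walk_law_def by (rule nn_integral_chain_law_Suc'[OF K yS]) simp
    also have "\<dots> \<le> (\<integral>\<^sup>+ x. ennreal (u (x n)) \<partial>?L)" by (intro nn_integral_mono step)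
    finally show ?case using Suc.IH by order
  qed
  define N where "N n = {x \<in> space ?L. x n = None}" for n
  have N[measurable]: "N n \<in> sets ?L" for n unfolding N_def by measurable
  have EN: "emeasure ?L (N n) \<le> ennreal (1 - \<beta> [])" for n
  proof -
    have "emeasure ?L (N n) = (\<integral>\<^sup>+ x. indicator (N n) x \<partial>?L)" by simp
    also have "\<dots> \<le> (\<integral>\<^sup>+ x. ennreal (u (x n)) \<partial>?L)"
      by (intro nn_integral_mono) (auto simp: N_def u_def split: split_indicator)
    finally show ?thesis using E[of n] by order
  qed
  have "AE x in ?L. x n = None \<longrightarrow> x (Suc n) = None" for n
  proof -
    have "(\<integral>\<^sup>+ x. indicator {None} (restrict x {0..<Suc n} n) * indicator (-{None}) (x (Suc n)) \<partial>?L) =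
        (\<integral>\<^sup>+ x. indicator {None} (restrict x {0..<Suc n} n) * (\<integral>\<^sup>+ z. indicator (-{None}) z \<partial>measure_pmf
            (walk_step d A (x n))) \<partial>?L)"
      unfolding walk_law_def
      by (rule nn_integral_chain_law_Suc[OF K yS, where g="\<lambda>x. indicator {None} (x n)"])
         (auto intro!: measurable_PiM_component)
    also have "\<dots> = (\<integral>\<^sup>+ x. 0 \<partial>?L)"
    proof (intro nn_integral_cong)
      fix x :: "nat \<Rightarrow> nat list option"
      show "indicator {None} (restrict x {0..<Suc n} n) * (\<integral>\<^sup>+ z. indicator (-{None}) z \<partial>measure_pmf
          (walk_step d A (x n))) = (0::ennreal)"
      proof (cases "x n")
        case None
        then show ?thesis by (subst None) (subst nn_integral_walk_step_None[OF pos], simp)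
      qed simp
    qed
    finally have "(\<integral>\<^sup>+ x. indicator {None} (x n) * indicator (-{None}) (x (Suc n)) \<partial>?L) = 0" by simp
    then have "AE x in ?L. indicator {None} (x n) * indicator (-{None}) (x (Suc n)) = (0::ennreal)"
      by (subst (asm) nn_integral_0_iff_AE) measurable
    then show ?thesis by eventually_elim (auto split: split_indicator_asm)
  qed
  then have "AE x in ?L. \<forall>n. x n = None \<longrightarrow> x (Suc n) = None" by (simp add: AE_all_countable)
  then have abs: "AE x in ?L. \<forall>n m. n \<le> m \<longrightarrow> x n = None \<longrightarrow> x m = None"
  proof eventually_elim
    case (elim x)
    show ?case
    proof (intro allI impI)
      fix n m :: nat assume "n \<le> m" "x n = None"
      then show "x m = None" using elim by (induction rule: dec_induct) auto
    qed
  qed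
  \<comment> \<open>Absorption makes "hit by time \<open>n\<close>" and "absorbed at time
    \<open>n\<close>" the same event up to a null set, so the bound \<open>EN\<close> for fixed
    times passes to the probability of ever hitting.\<close>
  have fin: "emeasure ?L (\<Union>m\<le>n. N m) = emeasure ?L (N n)" for n
    by (rule emeasure_eq_AE) (use abs in \<open>auto simp: N_def elim: eventually_mono\<close>)
  have "emeasure ?L (\<Union>n. \<Union>m\<le>n. N m) = (SUP n. emeasure ?L (\<Union>m\<le>n. N m))"
    by (intro SUP_emeasure_incseq[symmetric]) (fastforce simp: incseq_def intro: order_trans)+
  also have "\<dots> \<le> ennreal (1 - \<beta> [])" unfolding fin by (intro SUP_least EN)
  also have "(\<Union>n. \<Union>m\<le>n. N m) = (\<Union>n. N n)" by auto
  finally have le: "emeasure ?L (\<Union>n. N n) \<le> ennreal (1 - \<beta> [])" .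
  have eq: "{x. \<forall>n. x n \<noteq> None} = space ?L - (\<Union>n. N n)" by (auto simp: N_def spL simp del: not_None_eq)
  have "ennreal (\<beta> []) = 1 - ennreal (1 - \<beta> [])"
    using \<beta>0[of "[]"] \<beta>1[of "[]"] ennreal_minus[of "1 - \<beta> []" 1] by simp
  also have "\<dots> \<le> 1 - emeasure ?L (\<Union>n. N n)" using le by (intro ennreal_minus_mono) auto
  also have "\<dots> = emeasure ?L {x. \<forall>n. x n \<noteq> None}"
    unfolding eq by (subst emeasure_compl) (auto simp: L.emeasure_space_1)
  finally show ?thesis .
qed

section \<open>Sums over the tree and the expected hitting time\<close>

lemma nn_integral_count_space_list:
  fixes G :: "'a::countable list \<Rightarrow> ennreal"
  shows "(\<integral>\<^sup>+ \<nu>. G \<nu> \<partial>count_space UNIV)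
      = G [] + (\<integral>\<^sup>+ \<nu>. (\<integral>\<^sup>+ i. G (i # \<nu>) \<partial>count_space UNIV) \<partial>count_space UNIV)"
proof -
  have "(\<integral>\<^sup>+ \<nu>. (\<integral>\<^sup>+ i. G (i # \<nu>) \<partial>count_space UNIV) \<partial>count_space UNIV)
      = (\<integral>\<^sup>+ p. G (snd p # fst p) \<partial>count_space UNIV)"
    using nn_integral_fst_count_space[of "\<lambda>p. G (snd p # fst p)"] by simp
  also have "\<dots> = (\<integral>\<^sup>+ \<nu>. G \<nu> \<partial>count_space (UNIV - {[]}))"
    by (rule nn_integral_bij_count_space)
       (auto simp: bij_betw_def inj_on_def image_def, metis fst_conv snd_conv neq_Nil_conv)
  finally have 1: "(\<integral>\<^sup>+ \<nu>. (\<integral>\<^sup>+ i. G (i # \<nu>) \<partial>count_space UNIV) \<partial>count_space UNIV)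
      = (\<integral>\<^sup>+ \<nu>. G \<nu> \<partial>count_space (UNIV - {[]}))" .
  have "(\<integral>\<^sup>+ \<nu>. G \<nu> \<partial>count_space UNIV) = (\<integral>\<^sup>+ \<nu>. G \<nu> * indicator {[]} \<nu> + G \<nu> * indicator (UNIV - {[]})
      \<nu> \<partial>count_space UNIV)"
    by (intro nn_integral_cong) (auto split: split_indicator)
  also have "\<dots> = (\<integral>\<^sup>+ \<nu>. G \<nu> * indicator {[]} \<nu> \<partial>count_space UNIV)
      + (\<integral>\<^sup>+ \<nu>. G \<nu> * indicator (UNIV - {[]}) \<nu> \<partial>count_space UNIV)"
    by (rule nn_integral_add) auto
  also have "(\<integral>\<^sup>+ \<nu>. G \<nu> * indicator {[]} \<nu> \<partial>count_space UNIV) = G []"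
    by (subst nn_integral_count_space'[of "{[]}"]) (auto split: split_indicator)
  also have "(\<integral>\<^sup>+ \<nu>. G \<nu> * indicator (UNIV - {[]}) \<nu> \<partial>count_space UNIV)
      = (\<integral>\<^sup>+ \<nu>. G \<nu> \<partial>count_space (UNIV - {[]}))"
    by (subst nn_integral_restrict_space[symmetric]) (auto simp: restrict_count_space)
  finally show ?thesis using 1 by simp
qed

text \<open>Every vertex but the root is the child of exactly one vertex. In the invariance
  computation this moves the flux through an edge from one endpoint to the other.\<close>

lemma nn_integral_in_tree:
  "(\<integral>\<^sup>+ \<nu>. indicator {\<nu>. in_tree d \<nu>} \<nu> * F \<nu> \<partial>count_space UNIV) =
   F [] + (\<integral>\<^sup>+ \<nu>. indicator {\<nu>. in_tree d \<nu>} \<nu> * (\<Sum>i<d \<nu>. F (i # \<nu>)) \<partial>count_space UNIV)"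
proof -
  have "(\<integral>\<^sup>+ i. indicator {\<nu>. in_tree d \<nu>} (i # \<nu>) * F (i # \<nu>) \<partial>count_space UNIV) =
     indicator {\<nu>. in_tree d \<nu>} \<nu> * (\<Sum>i<d \<nu>. F (i # \<nu>))" for \<nu>
    by (subst nn_integral_count_space'[of "{..<d \<nu>}"]) (auto split: split_indicator intro!: sum.cong)
  then show ?thesis by (subst nn_integral_count_space_list) simp
qed

text \<open>The conductance of the edge from \<open>\<nu>\<close> to its parent.\<close>
primrec conductance :: "(nat list \<Rightarrow> real) \<Rightarrow> nat list \<Rightarrow> real" where
  "conductance A [] = 1"
| "conductance A (i # \<nu>) = conductance A \<nu> * A (i # \<nu>)"

lemma conductance_pos: "(\<And>\<nu>. 0 < A \<nu>) \<Longrightarrow> 0 < conductance A \<nu>"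
  by (induction \<nu>) auto

text \<open>The measure giving \<open>\<nu>\<close> the total conductance of its edges is invariant for the walk, up to the
  mass that leaks out of the root.\<close>
lemma nn_integral_hitting_time_le:
  assumes pos: "\<And>\<nu>. 0 < A \<nu>"
  shows "(\<integral>\<^sup>+ x. hitting_time x \<partial>walk_law d A) \<le>
    2 * (\<integral>\<^sup>+ \<nu>. indicator {\<nu>. in_tree d \<nu>} \<nu> * ennreal (conductance A \<nu>) \<partial>count_space UNIV)"
proof -
  let ?S = "count_space (UNIV :: nat list option set)"
  note K = walk_kernel[of d A]
  have yS: "Some [] \<in> space ?S" by simp
  let ?L = "walk_law d A"
  let ?I = "indicator {\<nu>. in_tree d \<nu>} :: nat list \<Rightarrow> ennreal"
  have sL: "sets ?L = sets (PiM UNIV (\<lambda>_. ?S))"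
    unfolding walk_law_def by (rule sets_chain_law[OF K yS])
  have meas[measurable]: "(\<lambda>x. x n) \<in> ?L \<rightarrow>\<^sub>M ?S" for n
    unfolding measurable_cong_sets[OF sL refl] by (rule measurable_component_singleton) simp
  have c0: "0 \<le> conductance A \<nu>" for \<nu> using conductance_pos[of A \<nu>] pos by (simp add: less_imp_le)
  define Z where "Z \<nu> = 1 + (\<Sum>j<d \<nu>. A (j # \<nu>))" for \<nu>
  have Z: "Z \<nu> > 0" for \<nu> unfolding Z_def by (intro add_pos_nonneg sum_nonneg less_imp_le[OF pos]) simp
  define \<pi> where "\<pi> \<nu> = ennreal (conductance A \<nu>) + (\<Sum>i<d \<nu>. ennreal (conductance A (i # \<nu>)))" for \<nu>
  have \<pi>: "\<pi> \<nu> = ennreal (conductance A \<nu> * Z \<nu>)" for \<nu>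
    unfolding \<pi>_def Z_def
    by (simp add: distrib_left ennreal_plus c0 less_imp_le[OF pos] sum_nonneg sum_distrib_left
        sum_ennreal)
  define f1 :: "nat list option \<Rightarrow> ennreal" where "f1 v = (if v = None then 0 else 1)" for v
  \<comment> \<open>Occupation up to time \<open>n\<close> is dominated by \<open>\<pi>\<close>.
    Shifting time by one replaces \<open>f\<close> by \<open>?K\<close>, and \<open>\<pi>\<close> is
    invariant except for the edge above the root: as \<open>f None = 0\<close>, the loss there is
    exactly the term \<open>f (Some [])\<close> of time 0, because this edge has conductance
    1.\<close>
  have main: "(\<Sum>k<n. \<integral>\<^sup>+ x. f (x k) \<partial>?L) \<le> (\<integral>\<^sup>+ \<nu>. ?I \<nu> * (\<pi> \<nu> * f (Some \<nu>)) \<partial>count_space UNIV)"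
    if "f None = 0" for f n
    using that
  proof (induction n arbitrary: f)
    case (Suc n)
    let ?K = "\<lambda>v. \<integral>\<^sup>+ w. f w \<partial>measure_pmf (walk_step d A v)"
    have K0: "?K None = 0" using Suc.prems by (simp add: nn_integral_walk_step_None[OF pos])
    have eqK: "\<pi> \<nu> * ?K (Some \<nu>) = ennreal (conductance A \<nu>) * f (parent \<nu>)
        + (\<Sum>i<d \<nu>. ennreal (conductance A (i # \<nu>)) * f (Some (i # \<nu>)))" for \<nu>
    proof -
      have a: "\<pi> \<nu> * ennreal (r / Z \<nu>) = ennreal (conductance A \<nu> * r)" if "0 \<le> r" for r
        using Z[of \<nu>] c0[of \<nu>] that unfolding \<pi> by (subst ennreal_mult[symmetric]) auto
      show "\<pi> \<nu> * ?K (Some \<nu>) = ennreal (conductance A \<nu>) * f (parent \<nu>)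
          + (\<Sum>i<d \<nu>. ennreal (conductance A (i # \<nu>)) * f (Some (i # \<nu>)))"
        unfolding nn_integral_walk_step_Some[where A=A and Z="Z \<nu>" and d=d and \<nu>=\<nu>
          and f=f, OF pos Z_def]
        by (simp add: distrib_left sum_distrib_left mult.assoc[symmetric] a less_imp_le[OF pos])
    qed
    have "(\<Sum>k<Suc n. \<integral>\<^sup>+ x. f (x k) \<partial>?L) = (\<integral>\<^sup>+ x. f (x 0) \<partial>?L) + (\<Sum>k<n. \<integral>\<^sup>+ x. f (x (Suc k)) \<partial>?L)"
      by (simp only: sum.lessThan_Suc_shift)
    also have "(\<integral>\<^sup>+ x. f (x 0) \<partial>?L) = f (Some [])"
      unfolding walk_law_def by (rule nn_integral_chain_law_0[OF K yS]) simp
    also have "(\<Sum>k<n. \<integral>\<^sup>+ x. f (x (Suc k)) \<partial>?L) = (\<Sum>k<n. \<integral>\<^sup>+ x. ?K (x k) \<partial>?L)"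
      unfolding walk_law_def by (intro sum.cong refl nn_integral_chain_law_Suc'[OF K yS]) simp
    also have "\<dots> \<le> (\<integral>\<^sup>+ \<nu>. ?I \<nu> * (\<pi> \<nu> * ?K (Some \<nu>)) \<partial>count_space UNIV)"
      by (rule Suc.IH[where f="?K"]) (rule K0)
    also have "\<dots> = (\<integral>\<^sup>+ \<nu>. ?I \<nu> * (ennreal (conductance A \<nu>) * f (parent \<nu>)
        + (\<Sum>i<d \<nu>. ennreal (conductance A (i # \<nu>)) * f (Some (i # \<nu>)))) \<partial>count_space UNIV)"
      unfolding eqK ..
    also have "f (Some []) + (\<integral>\<^sup>+ \<nu>. ?I \<nu> * (ennreal (conductance A \<nu>) * f (parent \<nu>)
        + (\<Sum>i<d \<nu>. ennreal (conductance A (i # \<nu>)) * f (Some (i # \<nu>)))) \<partial>count_space UNIV)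
        = (\<integral>\<^sup>+ \<nu>. ?I \<nu> * (ennreal (conductance A \<nu>) * f (parent \<nu>)) \<partial>count_space UNIV) +
          (f (Some []) + (\<integral>\<^sup>+ \<nu>. ?I \<nu> * (\<Sum>i<d \<nu>. ennreal (conductance A (i # \<nu>)) * f (Some (i # \<nu>)))
              \<partial>count_space UNIV))"
      by (simp add: distrib_left nn_integral_add ac_simps)
    also have "(\<integral>\<^sup>+ \<nu>. ?I \<nu> * (ennreal (conductance A \<nu>) * f (parent \<nu>)) \<partial>count_space UNIV)
       = (\<integral>\<^sup>+ \<nu>. ?I \<nu> * (\<Sum>i<d \<nu>. ennreal (conductance A (i # \<nu>)) * f (Some \<nu>)) \<partial>count_space UNIV)"
      by (subst nn_integral_in_tree) (simp add: Suc.prems del: conductance.simps)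
    also have "f (Some []) + (\<integral>\<^sup>+ \<nu>. ?I \<nu> * (\<Sum>i<d \<nu>. ennreal (conductance A (i # \<nu>)) * f (Some (i # \<nu>)))
        \<partial>count_space UNIV)
       = (\<integral>\<^sup>+ \<nu>. ?I \<nu> * (ennreal (conductance A \<nu>) * f (Some \<nu>)) \<partial>count_space UNIV)"
      by (subst (2) nn_integral_in_tree) simp
    also have "(\<integral>\<^sup>+ \<nu>. ?I \<nu> * (\<Sum>i<d \<nu>. ennreal (conductance A (i # \<nu>)) * f (Some \<nu>)) \<partial>count_space UNIV)
        + \<dots>
       = (\<integral>\<^sup>+ \<nu>. ?I \<nu> * (\<pi> \<nu> * f (Some \<nu>)) \<partial>count_space UNIV)"
      by (subst nn_integral_add[symmetric])
         (auto simp: \<pi>_def distrib_left distrib_right sum_distrib_right add.commute simp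
             del: conductance.simps)
    finally show ?case by - (auto intro: add_left_mono)
  qed simp
  \<comment> \<open>The time to hit \<open>None\<close> is at most the total time spent in the tree,
    whose mean \<open>main\<close> bounds by the mass of \<open>\<pi>\<close>.\<close>
  have "hitting_time x \<le> (\<Sum>k. f1 (x k))" for x
  proof (cases "\<exists>n. x n = None")
    case True
    define n where "n = (LEAST n. x n = None)"
    have n: "x n = None" unfolding n_def by (rule LeastI_ex[OF True])
    have "hitting_time x \<le> of_nat n" unfolding hitting_time_def using n by (intro INF_lower) auto
    also have "\<dots> = (\<Sum>k<n. f1 (x k))"
    proof -
      have "f1 (x k) = 1" if "k < n" for k
        using not_less_Least[of k "\<lambda>n. x n = None"] that unfolding n_def[symmetric] f1_def by simp
      then show ?thesis by simp
    qed
    also have "\<dots> \<le> (\<Sum>k. f1 (x k))" by (rule sum_le_suminf) auto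
    finally show ?thesis .
  next
    case False
    then have "(\<Sum>k. f1 (x k)) = (\<Sum>k. 1)" by (simp add: f1_def del: not_None_eq)
    also have "\<dots> = (\<infinity>::ennreal)" by (simp add: suminf_eq_SUP ennreal_SUP_of_nat_eq_top)
    finally show ?thesis by simp
  qed
  then have "(\<integral>\<^sup>+ x. hitting_time x \<partial>?L) \<le> (\<integral>\<^sup>+ x. (\<Sum>k. f1 (x k)) \<partial>?L)" by (intro nn_integral_mono)
  also have "\<dots> = (\<Sum>k. \<integral>\<^sup>+ x. f1 (x k) \<partial>?L)"
    by (intro nn_integral_suminf) (rule measurable_compose[OF meas], simp)
  also have "\<dots> \<le> (\<integral>\<^sup>+ \<nu>. ?I \<nu> * (\<pi> \<nu> * f1 (Some \<nu>)) \<partial>count_space UNIV)"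
    unfolding suminf_eq_SUP by (intro SUP_least main) (simp add: f1_def)
  also have "\<dots> = (\<integral>\<^sup>+ \<nu>. ?I \<nu> * ennreal (conductance A \<nu>) \<partial>count_space UNIV) +
     (\<integral>\<^sup>+ \<nu>. ?I \<nu> * (\<Sum>i<d \<nu>. ennreal (conductance A (i # \<nu>))) \<partial>count_space UNIV)"
    by (subst nn_integral_add[symmetric]) (auto simp: \<pi>_def f1_def distrib_left simp
        del: conductance.simps)
  \<comment> \<open>An edge is counted at no more than its two endpoints, whence the factor
    2.\<close>
  also have "\<dots> \<le> 2 * (\<integral>\<^sup>+ \<nu>. ?I \<nu> * ennreal (conductance A \<nu>) \<partial>count_space UNIV)"
  proof -
    have "(\<integral>\<^sup>+ \<nu>. ?I \<nu> * (\<Sum>i<d \<nu>. ennreal (conductance A (i # \<nu>))) \<partial>count_space UNIV) \<le>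
      (\<integral>\<^sup>+ \<nu>. ?I \<nu> * ennreal (conductance A \<nu>) \<partial>count_space UNIV)"
      by (subst (2) nn_integral_in_tree) simp
    then show ?thesis unfolding mult_2 by (intro add_left_mono)
  qed
  finally show ?thesis .
qed

section \<open>The environment along the tree\<close>

lemma measure_eqI_pair:
  assumes s1: "sets \<mu> = sets (M1 \<Otimes>\<^sub>M M2)" and s2: "sets \<mu>' = sets (M1 \<Otimes>\<^sub>M M2)"
    and fin: "emeasure \<mu> (space M1 \<times> space M2) \<noteq> \<infinity>"
    and eq: "\<And>A B. A \<in> sets M1 \<Longrightarrow> B \<in> sets M2 \<Longrightarrow> emeasure \<mu> (A \<times> B) = emeasure \<mu>' (A \<times> B)"
  shows "\<mu> = \<mu>'"
  by (rule measure_eqI_generator_eq[OF Int_stable_pair_measure_generator pair_measure_closed,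
        where A="\<lambda>_. space M1 \<times> space M2"])
     (use s1 s2 fin eq in \<open>auto simp: sets_pair_measure\<close>)

text \<open>For fixed \<open>E\<close> both sides are integrals of \<open>H\<close> against finite
  measures on the product of the past \<open>F\<close> with the space of values. The hypothesis says
  that these agree on rectangles, hence they agree. The indicator of \<open>E\<close> stays
  throughout since conditional laws of the environment are known only where the vertices concerned
  belong to the tree.\<close>

lemma (in prob_space) nn_integral_disintegration:
  assumes F: "subalgebra M F" and X[measurable]: "X \<in> M \<rightarrow>\<^sub>M N"
    and k[measurable]: "\<kappa> \<in> M \<rightarrow>\<^sub>M prob_algebra N"
    and E[measurable]: "E \<in> sets M"
    and eq: "\<And>A b. A \<in> sets F \<Longrightarrow> b \<in> sets N \<Longrightarrow>
       (\<integral>\<^sup>+ \<omega>. indicator E \<omega> * (indicator A \<omega> * indicator b (X \<omega>)) \<partial>M) = (\<integral>\<^sup>+ \<omega>. indicator E \<omega> *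
           (indicator A \<omega> * emeasure (\<kappa> \<omega>) b) \<partial>M)"
    and H[measurable]: "H \<in> borel_measurable (F \<Otimes>\<^sub>M N)"
  shows "(\<integral>\<^sup>+ \<omega>. indicator E \<omega> * H (\<omega>, X \<omega>) \<partial>M) = (\<integral>\<^sup>+ \<omega>. indicator E \<omega> * (\<integral>\<^sup>+ z. H (\<omega>, z) \<partial>\<kappa> \<omega>) \<partial>M)"
proof -
  have k'[measurable]: "\<kappa> \<in> M \<rightarrow>\<^sub>M subprob_algebra N" using k by (rule measurable_prob_algebraD)
  have id[measurable]: "(\<lambda>\<omega>. \<omega>) \<in> M \<rightarrow>\<^sub>M F"
    by (rule measurable_from_subalg[OF F]) simp
  have spF: "space F = space M" using F by (simp add: subalgebra_def)
  define D where "D = density M (indicator E)"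
  have sD[measurable_cong, simp]: "sets D = sets M" and spD: "space D = space M" by (auto simp: D_def)
  define \<mu> where "\<mu> = distr D (F \<Otimes>\<^sub>M N) (\<lambda>\<omega>. (\<omega>, X \<omega>))"
  define \<kappa>' where "\<kappa>' = (\<lambda>\<omega>. distr (\<kappa> \<omega>) (F \<Otimes>\<^sub>M N) (\<lambda>z. (\<omega>, z)))"
  have k2[measurable]: "\<kappa>' \<in> D \<rightarrow>\<^sub>M subprob_algebra (F \<Otimes>\<^sub>M N)"
    unfolding \<kappa>'_def measurable_cong_sets[OF sD refl]
  proof (rule measurable_distr2[where M=N, OF _ k'])
    have "(\<lambda>p. (fst p, snd p)) \<in> M \<Otimes>\<^sub>M N \<rightarrow>\<^sub>M F \<Otimes>\<^sub>M N"
      by (intro measurable_Pair measurable_compose[OF measurable_fst id] measurable_snd)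
    then show "(\<lambda>(\<omega>, z). (\<omega>, z)) \<in> M \<Otimes>\<^sub>M N \<rightarrow>\<^sub>M F \<Otimes>\<^sub>M N"
      unfolding case_prod_unfold .
  qed
  define \<mu>' where "\<mu>' = D \<bind> \<kappa>'"
  have sk: "sets (\<kappa> \<omega>) = sets N" if "\<omega> \<in> space M" for \<omega> using sets_kernel[OF k' that] .
  have "space D \<noteq> {}" using not_empty by (simp add: spD)
  then have s2: "sets \<mu>' = sets (F \<Otimes>\<^sub>M N)" unfolding \<mu>'_def
    by (intro sets_bind[of _ _ "F \<Otimes>\<^sub>M N"]) (auto simp: \<kappa>'_def)
  have i2: "(\<integral>\<^sup>+ z. G z \<partial>\<mu>') = (\<integral>\<^sup>+ \<omega>. indicator E \<omega> * (\<integral>\<^sup>+ z. G (\<omega>, z) \<partial>\<kappa> \<omega>) \<partial>M)"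
    if G[measurable]: "G \<in> borel_measurable (F \<Otimes>\<^sub>M N)" for G
  proof -
    have "(\<integral>\<^sup>+ z. G z \<partial>\<mu>') = (\<integral>\<^sup>+ \<omega>. (\<integral>\<^sup>+ z. G z \<partial>\<kappa>' \<omega>) \<partial>D)"
      unfolding \<mu>'_def by (rule nn_integral_bind[OF G k2])
    also have "\<dots> = (\<integral>\<^sup>+ \<omega>. indicator E \<omega> * (\<integral>\<^sup>+ z. G z \<partial>\<kappa>' \<omega>) \<partial>M)"
      unfolding D_def using measurable_compose[OF k2 nn_integral_measurable_subprob_algebra[OF G]]
      by (intro nn_integral_density) auto
    also have "\<dots> = (\<integral>\<^sup>+ \<omega>. indicator E \<omega> * (\<integral>\<^sup>+ z. G (\<omega>, z) \<partial>\<kappa> \<omega>) \<partial>M)"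
    proof (intro nn_integral_cong arg_cong2[where f="(*)"] refl)
      fix \<omega> assume w: "\<omega> \<in> space M"
      have "(\<lambda>z. (\<omega>, z)) \<in> \<kappa> \<omega> \<rightarrow>\<^sub>M F \<Otimes>\<^sub>M N"
        unfolding measurable_cong_sets[OF sk[OF w] refl] using w
        by (intro measurable_Pair1') (simp add: spF)
      then show "(\<integral>\<^sup>+ z. G z \<partial>\<kappa>' \<omega>) = (\<integral>\<^sup>+ z. G (\<omega>, z) \<partial>\<kappa> \<omega>)"
        unfolding \<kappa>'_def by (intro nn_integral_distr) auto
    qed
    finally show ?thesis .
  qed
  have i1: "(\<integral>\<^sup>+ z. G z \<partial>\<mu>) = (\<integral>\<^sup>+ \<omega>. indicator E \<omega> * G (\<omega>, X \<omega>) \<partial>M)"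
    if G[measurable]: "G \<in> borel_measurable (F \<Otimes>\<^sub>M N)" for G
    unfolding \<mu>_def D_def by (subst nn_integral_distr) (auto simp: nn_integral_density)
  have "\<mu> = \<mu>'"
  proof (rule measure_eqI_pair)
    show "sets \<mu> = sets (F \<Otimes>\<^sub>M N)" by (simp add: \<mu>_def)
    have e1: "emeasure \<mu> (A \<times> B) = (\<integral>\<^sup>+ \<omega>. indicator E \<omega> * (indicator A \<omega> * indicator B (X \<omega>)) \<partial>M)"
      if [measurable]: "A \<in> sets F" "B \<in> sets N" for A B
    proof -
      have "emeasure \<mu> (A \<times> B) = (\<integral>\<^sup>+ z. indicator (A \<times> B) z \<partial>\<mu>)" by (simp add: \<mu>_def)
      also have "\<dots> = (\<integral>\<^sup>+ \<omega>. indicator E \<omega> * indicator (A \<times> B) (\<omega>, X \<omega>) \<partial>M)"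
        by (rule i1) simp
      finally show ?thesis by (simp add: indicator_times)
    qed
    show "emeasure \<mu> (A \<times> B) = emeasure \<mu>' (A \<times> B)" if [measurable]: "A \<in> sets F" "B \<in> sets N" for A B
    proof -
      have "emeasure \<mu>' (A \<times> B) = (\<integral>\<^sup>+ z. indicator (A \<times> B) z \<partial>\<mu>')" by (simp add: s2)
      also have "\<dots> = (\<integral>\<^sup>+ \<omega>. indicator E \<omega> * (\<integral>\<^sup>+ z. indicator (A \<times> B) (\<omega>, z) \<partial>\<kappa> \<omega>) \<partial>M)"
        by (rule i2) simp
      also have "\<dots> = (\<integral>\<^sup>+ \<omega>. indicator E \<omega> * (indicator A \<omega> * emeasure (\<kappa> \<omega>) B) \<partial>M)"
        by (intro nn_integral_cong) (simp add: indicator_times nn_integral_cmult sk)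
      finally show ?thesis using e1[OF that] eq[OF that] by simp
    qed
    have "emeasure \<mu> (space F \<times> space N) \<le> (\<integral>\<^sup>+ \<omega>. 1 \<partial>M)"
      unfolding e1[OF sets.top sets.top] by (intro nn_integral_mono) (auto split: split_indicator)
    then show "emeasure \<mu> (space F \<times> space N) \<noteq> \<infinity>" by (auto simp: emeasure_space_1 top_unique)
  qed (fact s2)
  with i1[OF H] i2[OF H] show ?thesis by simp
qed

text \<open>Membership in the tree depends on the offspring of the proper ancestors alone, so it is
  a cylinder event on generations before \<open>n\<close> and independent of the offspring of
  \<open>\<nu>\<close> and \<open>\<nu>'\<close> themselves. The version with two vertices serves
  the second moment.\<close>

lemma in_tree_cylinder:
  assumes "length \<nu> = n" "length \<nu>' = n"
  shows "\<exists>J B. finite J \<and> J \<subseteq> {\<mu>. length \<mu> < n} \<and>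
    (\<forall>d. in_tree d \<nu> \<and> in_tree d \<nu>' \<longleftrightarrow> (\<forall>\<mu>\<in>J. d \<mu> \<in> B \<mu>))"
  using assms
proof (induction n arbitrary: \<nu> \<nu>')
  case 0
  then show ?case by (intro exI[of _ "{}"]) auto
next
  case (Suc n)
  obtain i \<mu> where \<nu>: "\<nu> = i # \<mu>" "length \<mu> = n" using Suc.prems(1) by (cases \<nu>) auto
  obtain j \<mu>' where \<nu>': "\<nu>' = j # \<mu>'" "length \<mu>' = n" using Suc.prems(2) by (cases \<nu>') auto
  obtain J B where J: "finite J" "J \<subseteq> {\<mu>. length \<mu> < n}"
    "\<And>d. in_tree d \<mu> \<and> in_tree d \<mu>' \<longleftrightarrow> (\<forall>\<mu>\<in>J. d \<mu> \<in> B \<mu>)"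
    using Suc.IH[OF \<nu>(2) \<nu>'(2)] by blast
  \<comment> \<open>If the parents coincide, one offspring number has to meet both
    constraints.\<close>
  let ?B = "\<lambda>\<eta>. if \<eta> = \<mu> \<and> \<eta> = \<mu>' then {i<..} \<inter> {j<..} else if \<eta> = \<mu> then {i<..} else if \<eta>
      = \<mu>' then {j<..} else B \<eta>"
  have "\<mu> \<notin> J" "\<mu>' \<notin> J" using J(2) \<nu>(2) \<nu>'(2) by auto
  then have "in_tree d \<nu> \<and> in_tree d \<nu>' \<longleftrightarrow> (\<forall>\<eta>\<in>insert \<mu> (insert \<mu>' J). d \<eta> \<in> ?B \<eta>)" for d
  proof -
    have "(\<forall>\<eta>\<in>J. d \<eta> \<in> ?B \<eta>) \<longleftrightarrow> (\<forall>\<eta>\<in>J. d \<eta> \<in> B \<eta>)"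
      using \<open>\<mu> \<notin> J\<close> \<open>\<mu>' \<notin> J\<close> by (intro ball_cong refl) auto
    then show ?thesis unfolding ball_simps J(3)[symmetric] by (auto simp: \<nu> \<nu>')
  qed
  moreover have "insert \<mu> (insert \<mu>' J) \<subseteq> {\<mu>. length \<mu> < Suc n}" using J(2) \<nu>(2) \<nu>'(2) by auto
  ultimately show ?case using J(1) by (intro exI[of _ "insert \<mu> (insert \<mu>' J)"] exI[of _ ?B]) simp
qed

context markovian_environment
begin

section \<open>Offspring numbers and tree events\<close>

lemma off_measurable[measurable]: "off \<nu> \<in> M \<rightarrow>\<^sub>M count_space UNIV"
  using offspring_indep by (auto simp: indep_vars_def)

lemma prob_off_gt:
  "prob {\<omega>\<in>space M. off \<nu> \<omega> \<in> B} = measure_pmf.prob p B"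
proof -
  have "measure (distr M (count_space UNIV) (off \<nu>)) B = prob {\<omega>\<in>space M. off \<nu> \<omega> \<in> B}"
    by (subst measure_distr) (auto simp: vimage_def Int_def conj_commute intro!: arg_cong[where f=prob])
  then show ?thesis by (simp add: offspring_law)
qed

lemma prob_off_cylinder:
  assumes "finite J"
  shows "prob {\<omega>\<in>space M. \<forall>\<mu>\<in>J. off \<mu> \<omega> \<in> B \<mu>} = (\<Prod>\<mu>\<in>J. measure_pmf.prob p (B \<mu>))"
proof (cases "J = {}")
  case False
  have "prob (\<Inter>\<mu>\<in>J. off \<mu> -` B \<mu> \<inter> space M) = (\<Prod>\<mu>\<in>J. prob (off \<mu> -` B \<mu> \<inter> space M))"
    by (rule indep_varsD[OF offspring_indep]) (use assms False in auto)
  also have "(\<Inter>\<mu>\<in>J. off \<mu> -` B \<mu> \<inter> space M) = {\<omega>\<in>space M. \<forall>\<mu>\<in>J. off \<mu> \<omega> \<in> B \<mu>}" using False by auto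
  also have "(\<Prod>\<mu>\<in>J. prob (off \<mu> -` B \<mu> \<inter> space M)) = (\<Prod>\<mu>\<in>J. measure_pmf.prob p (B \<mu>))"
    by (simp add: prob_off_gt vimage_def Int_def conj_commute)
  finally show ?thesis .
qed (simp add: prob_space)

text \<open>One notion for two trees: \<open>g\<close> is the identity for the tree itself and
  \<open>\<lambda>k. min k L\<close> for the truncated one.\<close>

definition thinned :: "(nat \<Rightarrow> nat) \<Rightarrow> 'w \<Rightarrow> nat list \<Rightarrow> nat" where
  "thinned g \<omega> \<mu> = g (off \<mu> \<omega>)"

definition tree_event :: "(nat \<Rightarrow> nat) \<Rightarrow> nat list \<Rightarrow> 'w set" where
  "tree_event g \<nu> = {\<omega>\<in>space M. in_tree (thinned g \<omega>) \<nu>}"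

text \<open>Distinct vertices of one generation have independent offspring numbers, also independent
  of their ancestry. For siblings the last two factors would not separate, which is why diagonal
  pairs are treated apart in the second moment.\<close>

lemma prob_tree_event_pair_Cons:
  assumes l: "length \<nu> = length \<nu>'" and ne: "\<nu> \<noteq> \<nu>'"
  shows "prob (tree_event g (i # \<nu>) \<inter> tree_event g (j # \<nu>')) =
    prob (tree_event g \<nu> \<inter> tree_event g \<nu>') * measure_pmf.prob p {k. i < g k} * measure_pmf.prob p
        {k. j < g k}"
proof -
  obtain J B where J: "finite J" "J \<subseteq> {\<mu>. length \<mu> < length \<nu>}"
    "\<And>d. in_tree d \<nu> \<and> in_tree d \<nu>' \<longleftrightarrow> (\<forall>\<mu>\<in>J. d \<mu> \<in> B \<mu>)"
    using in_tree_cylinder[OF refl, of \<nu>' \<nu>] l by auto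
  have nJ: "\<nu> \<notin> J" "\<nu>' \<notin> J" using J(2) l by auto
  let ?B = "\<lambda>\<mu>. if \<mu> = \<nu> then {k. i < g k} else if \<mu> = \<nu>' then {k. j < g k} else {k. g k \<in> B \<mu>}"
  have "tree_event g (i # \<nu>) \<inter> tree_event g (j # \<nu>')
      = {\<omega>\<in>space M. \<forall>\<mu>\<in>insert \<nu> (insert \<nu>' J). off \<mu> \<omega> \<in> ?B \<mu>}"
  proof -
    have "(\<forall>\<mu>\<in>J. off \<mu> \<omega> \<in> ?B \<mu>) \<longleftrightarrow> in_tree (thinned g \<omega>) \<nu> \<and> in_tree (thinned g \<omega>) \<nu>'" for \<omega>
      unfolding J(3) using nJ by (intro ball_cong refl) (auto simp: thinned_def)
    then show ?thesis unfolding ball_simps using ne by (auto simp: tree_event_def thinned_def)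
  qed
  then have "prob (tree_event g (i # \<nu>) \<inter> tree_event g (j # \<nu>'))
      = (\<Prod>\<mu>\<in>insert \<nu> (insert \<nu>' J). measure_pmf.prob p (?B \<mu>))"
    using J(1) by (simp only: prob_off_cylinder finite_insert)
  also have "\<dots> = measure_pmf.prob p {k. i < g k} * (measure_pmf.prob p {k. j < g k}
      * (\<Prod>\<mu>\<in>J. measure_pmf.prob p (?B \<mu>)))"
    using J(1) nJ ne by simp
  also have "(\<Prod>\<mu>\<in>J. measure_pmf.prob p (?B \<mu>)) = (\<Prod>\<mu>\<in>J. measure_pmf.prob p {k. g k \<in> B \<mu>})"
    using nJ by (intro prod.cong) auto
  also have "\<dots> = prob {\<omega>\<in>space M. \<forall>\<mu>\<in>J. off \<mu> \<omega> \<in> {k. g k \<in> B \<mu>}}"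
    by (rule prob_off_cylinder[symmetric]) (rule J(1))
  also have "{\<omega>\<in>space M. \<forall>\<mu>\<in>J. off \<mu> \<omega> \<in> {k. g k \<in> B \<mu>}} = tree_event g \<nu> \<inter> tree_event g \<nu>'"
    using J(3)[of "thinned g \<omega>" for \<omega>] unfolding tree_event_def by (auto simp: thinned_def)
  finally show ?thesis by (simp add: mult_ac)
qed

lemma prob_tree_event_Cons:
  "prob (tree_event g (i # \<nu>)) = prob (tree_event g \<nu>) * measure_pmf.prob p {k. i < g k}"
proof -
  obtain J B where J: "finite J" "J \<subseteq> {\<mu>. length \<mu> < length \<nu>}"
    "\<And>d. in_tree d \<nu> \<longleftrightarrow> (\<forall>\<mu>\<in>J. d \<mu> \<in> B \<mu>)"
    using in_tree_cylinder[OF refl refl, of \<nu>] by auto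
  have nJ: "\<nu> \<notin> J" using J(2) by auto
  let ?B = "\<lambda>\<mu>. if \<mu> = \<nu> then {k. i < g k} else {k. g k \<in> B \<mu>}"
  have "tree_event g (i # \<nu>) = {\<omega>\<in>space M. \<forall>\<mu>\<in>insert \<nu> J. off \<mu> \<omega> \<in> ?B \<mu>}"
  proof -
    have "(\<forall>\<mu>\<in>J. off \<mu> \<omega> \<in> ?B \<mu>) \<longleftrightarrow> in_tree (thinned g \<omega>) \<nu>" for \<omega>
      unfolding J(3) using nJ by (intro ball_cong refl) (auto simp: thinned_def)
    then show ?thesis unfolding ball_simps by (auto simp: tree_event_def thinned_def)
  qed
  then have "prob (tree_event g (i # \<nu>)) = (\<Prod>\<mu>\<in>insert \<nu> J. measure_pmf.prob p (?B \<mu>))"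
    using J(1) by (simp only: prob_off_cylinder finite_insert)
  also have "\<dots> = measure_pmf.prob p {k. i < g k} * (\<Prod>\<mu>\<in>J. measure_pmf.prob p (?B \<mu>))"
    using J(1) nJ by simp
  also have "(\<Prod>\<mu>\<in>J. measure_pmf.prob p (?B \<mu>)) = (\<Prod>\<mu>\<in>J. measure_pmf.prob p {k. g k \<in> B \<mu>})"
    using nJ by (intro prod.cong) auto
  also have "\<dots> = prob {\<omega>\<in>space M. \<forall>\<mu>\<in>J. off \<mu> \<omega> \<in> {k. g k \<in> B \<mu>}}"
    by (rule prob_off_cylinder[symmetric]) (rule J(1))
  also have "{\<omega>\<in>space M. \<forall>\<mu>\<in>J. off \<mu> \<omega> \<in> {k. g k \<in> B \<mu>}} = tree_event g \<nu>"
    using J(3) by (auto simp: tree_event_def thinned_def)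
  finally show ?thesis by (simp add: mult_ac)
qed

section \<open>The past and the adapted environment\<close>

abbreviation "F \<equiv> past M off \<Gamma>"

lemma space_past: "space (F n) = space M"
  by (simp add: past_def space_measure_of_conv)

lemma off_past: "off \<nu> \<in> F n \<rightarrow>\<^sub>M count_space UNIV"
proof (subst measurable_count_space_eq_countable, safe)
  fix k
  have "{\<omega>\<in>space M. off \<nu> \<omega> = k} \<in> sets (F n)" unfolding past_def
    by (subst sets_measure_of) (auto intro!: sigma_sets.Basic)
  then show "off \<nu> -` {k} \<inter> space (F n) \<in> sets (F n)"
    by (simp add: space_past vimage_def Int_def conj_commute)
qed (auto intro: countable_subset)

lemma in_tree_measurable:
  assumes "\<And>\<mu>. off \<mu> \<in> N \<rightarrow>\<^sub>M count_space UNIV"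
  shows "Measurable.pred N (\<lambda>\<omega>. in_tree (thinned g \<omega>) \<nu>)"
proof (induction \<nu>)
  case (Cons i \<nu>)
  note Cons[measurable] assms[measurable]
  have "Measurable.pred N (\<lambda>\<omega>. i < g (off \<nu> \<omega>))"
    by (rule measurable_compose[OF assms]) simp
  then show ?case using Cons by (simp add: thinned_def)
qed simp

lemma tree_event_past: "tree_event g \<nu> \<in> sets (F n)"
  using in_tree_measurable[OF off_past, of g \<nu> n] unfolding pred_def
  by (simp add: tree_event_def space_past)

lemma tree_event_sets[measurable]: "tree_event g \<nu> \<in> sets M"
  using in_tree_measurable[OF off_measurable, of g \<nu>] unfolding pred_def by (simp add: tree_event_def)

lemma off_in_tree: "in_tree (\<lambda>\<mu>. off \<mu> \<omega>) = in_tree (thinned (\<lambda>k. k) \<omega>)"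
  by (simp add: thinned_def[abs_def])

lemma subalgebra_past: "subalgebra M (F n)"
  unfolding subalgebra_def space_past
proof
  have 1: "{\<omega>\<in>space M. off \<nu> \<omega> = k} \<in> sets M" for \<nu> k by measurable
  have 2: "{\<omega>\<in>space M. in_tree (\<lambda>\<mu>. off \<mu> \<omega>) \<nu> \<and> \<Gamma> \<nu> \<omega> \<in> B} \<in> sets M" if "B \<in> sets Sigma'" for \<nu> B
  proof -
    have "{\<omega>\<in>space M. in_tree (\<lambda>\<mu>. off \<mu> \<omega>) \<nu> \<and> \<Gamma> \<nu> \<omega> \<in> B}
        = tree_event (\<lambda>k. k) \<nu> \<inter> (\<Gamma> \<nu> -` B \<inter> space M)"
      by (auto simp: tree_event_def off_in_tree)
    then show ?thesis using measurable_sets[OF env_measurable that] by simp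
  qed
  have "sets (F n) = sigma_sets (space M) ({{\<omega>\<in>space M. off \<nu> \<omega> = k} | \<nu> k. True} \<union>
      {{\<omega>\<in>space M. in_tree (\<lambda>\<mu>. off \<mu> \<omega>) \<nu> \<and> \<Gamma> \<nu> \<omega> \<in> B} | \<nu> B. length \<nu> \<le> n \<and> B \<in> sets Sigma'})"
    unfolding past_def by (rule sets_measure_of) auto
  also have "\<dots> \<subseteq> sets M" using 1 2 by (intro sets.sigma_sets_subset) auto
  finally show "sets (F n) \<subseteq> sets M" .
qed simp

sublocale sub: finite_measure_subalgebra M "F n" for n
  by unfold_locales (rule subalgebra_past)

text \<open>The sigma-algebra \<open>past\<close> records a value only on the event that its vertex
  is in the tree, so \<open>\<Gamma> \<nu>\<close> need not be adapted. Replacing it off the tree by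
  a fixed point of \<open>Sigma'\<close> makes it so.\<close>

definition env :: "nat list \<Rightarrow> 'w \<Rightarrow> real \<times> 's" where
  "env \<nu> \<omega> = (if in_tree (thinned (\<lambda>k. k) \<omega>) \<nu> then \<Gamma> \<nu> \<omega> else (1, undefined))"

lemma default_in_Sigma': "(1, undefined) \<in> space (Sigma' :: (real \<times> 's) measure)"
  by (simp add: Sigma'_def space_restrict_space)

lemma env_past:
  assumes "length \<nu> \<le> n"
  shows "env \<nu> \<in> F n \<rightarrow>\<^sub>M Sigma'"
proof (rule measurableI)
  fix \<omega> assume "\<omega> \<in> space (F n)"
  then show "env \<nu> \<omega> \<in> space Sigma'"
    using measurable_space[OF env_measurable] default_in_Sigma' by (auto simp: env_def space_past)
next
  fix B :: "(real \<times> 's) set" assume B: "B \<in> sets Sigma'"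
  have "{\<omega>\<in>space M. in_tree (\<lambda>\<mu>. off \<mu> \<omega>) \<nu> \<and> \<Gamma> \<nu> \<omega> \<in> B} \<in> sets (F n)"
    unfolding past_def using assms B by (subst sets_measure_of) (auto intro!: sigma_sets.Basic)
  moreover have "env \<nu> -` B \<inter> space (F n) = {\<omega>\<in>space M. in_tree (\<lambda>\<mu>. off \<mu> \<omega>) \<nu> \<and> \<Gamma> \<nu> \<omega> \<in> B} \<union>
      (if (1, undefined) \<in> B then space (F n) - tree_event (\<lambda>k. k) \<nu> else {})"
    by (auto simp: env_def space_past tree_event_def off_in_tree split: if_splits)
  ultimately show "env \<nu> -` B \<inter> space (F n) \<in> sets (F n)"
    using tree_event_past by auto
qed

end

locale markov_tree = markovian_environment M p K x0 off \<Gamma>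
  for M :: "'w measure" and p and K :: "real \<times> 's::polish_space \<Rightarrow> (real \<times> 's) measure"
    and x0 off \<Gamma> +
  assumes kernel: "K \<in> Sigma' \<rightarrow>\<^sub>M prob_algebra Sigma'"
begin

lemma kernel_env: "(\<lambda>\<omega>. K (\<Gamma> \<nu> \<omega>)) \<in> M \<rightarrow>\<^sub>M prob_algebra Sigma'"
  by (rule measurable_compose[OF env_measurable kernel])

text \<open>The conditional law in \<open>marginal\<close>, extended from sets to functions that
  depend jointly on the past and on the value of the child.\<close>

lemma nn_integral_child:
  assumes E: "E \<in> sets (F (length \<nu>))" and sub: "E \<subseteq> tree_event (\<lambda>k. k) (i # \<nu>)"
    and H: "H \<in> borel_measurable (F (length \<nu>) \<Otimes>\<^sub>M Sigma')"
  shows "(\<integral>\<^sup>+ \<omega>. indicator E \<omega> * H (\<omega>, \<Gamma> (i # \<nu>) \<omega>) \<partial>M) =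
    (\<integral>\<^sup>+ \<omega>. indicator E \<omega> * (\<integral>\<^sup>+ z. H (\<omega>, z) \<partial>K (\<Gamma> \<nu> \<omega>)) \<partial>M)"
proof (rule nn_integral_disintegration[OF subalgebra_past env_measurable kernel_env _ _ H])
  show EM: "E \<in> sets M" using E subalgebra_past by (auto simp: subalgebra_def)
  fix A b assume A: "A \<in> sets (F (length \<nu>))" and b: "b \<in> sets (Sigma' :: (real \<times> 's) measure)"
  let ?C = "{\<omega>\<in>space M. \<Gamma> (i # \<nu>) \<omega> \<in> b}"
  have C: "?C \<in> sets M" using measurable_sets[OF env_measurable b]
    by (simp add: vimage_def Int_def conj_commute)
  have EA: "(\<lambda>\<omega>. indicator (E \<inter> A) \<omega> :: ennreal) \<in> borel_measurable (F (length \<nu>))" using E A by simp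
  have "(\<integral>\<^sup>+ \<omega>. indicator E \<omega> * (indicator A \<omega> * indicator b (\<Gamma> (i # \<nu>) \<omega>)) \<partial>M)
      = (\<integral>\<^sup>+ \<omega>. indicator (E \<inter> A) \<omega> * indicator ?C \<omega> \<partial>M)"
    by (intro nn_integral_cong) (auto split: split_indicator)
  also have "\<dots> = (\<integral>\<^sup>+ \<omega>. indicator (E \<inter> A) \<omega> * nn_cond_exp M (F (length \<nu>)) (indicator ?C) \<omega> \<partial>M)"
    using C EA by (intro sub.nn_cond_exp_intg[symmetric]) auto
  also have "\<dots> = (\<integral>\<^sup>+ \<omega>. indicator E \<omega> * (indicator A \<omega> * emeasure (K (\<Gamma> \<nu> \<omega>)) b) \<partial>M)"
  proof (intro nn_integral_cong_AE)
    show "AE \<omega> in M. indicator (E \<inter> A) \<omega> * nn_cond_exp M (F (length \<nu>)) (indicator ?C) \<omega> =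
        indicator E \<omega> * (indicator A \<omega> * emeasure (K (\<Gamma> \<nu> \<omega>)) b)"
      using marginal[OF b, of i \<nu>]
      by eventually_elim (use sub in \<open>auto simp: tree_event_def off_in_tree split: split_indicator\<close>)
  qed
  finally show "(\<integral>\<^sup>+ \<omega>. indicator E \<omega> * (indicator A \<omega> * indicator b (\<Gamma> (i # \<nu>) \<omega>)) \<partial>M) =
    (\<integral>\<^sup>+ \<omega>. indicator E \<omega> * (indicator A \<omega> * emeasure (K (\<Gamma> \<nu> \<omega>)) b) \<partial>M)" .
qed

text \<open>The independence hypothesis concerns whole families, the marginal hypothesis single
  children. Leaving all siblings unconstrained turns a family event into an event for child
  \<open>i\<close>, provided that child exists.\<close>

lemma nn_cond_exp_family:
  assumes B: "\<And>\<mu>. B \<mu> \<in> sets Sigma'" and B': "\<And>k. k \<noteq> i \<Longrightarrow> B (k # \<nu>) = space Sigma'"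
  shows "AE \<omega> in M. \<omega> \<in> tree_event (\<lambda>k. k) (i # \<nu>) \<longrightarrow>
    nn_cond_exp M (F (length \<nu>)) (indicator {\<omega>\<in>space M. \<forall>k<off \<nu> \<omega>. \<Gamma> (k # \<nu>) \<omega> \<in> B (k # \<nu>)}) \<omega>
     = emeasure (K (\<Gamma> \<nu> \<omega>)) (B (i # \<nu>))"
proof -
  let ?T = "tree_event (\<lambda>k. k) (i # \<nu>)"
  let ?G = "F (length \<nu>)"
  let ?C = "{\<omega>\<in>space M. \<forall>k<off \<nu> \<omega>. \<Gamma> (k # \<nu>) \<omega> \<in> B (k # \<nu>)}"
  let ?D = "{\<omega>\<in>space M. \<Gamma> (i # \<nu>) \<omega> \<in> B (i # \<nu>)}"
  have D: "{\<omega>\<in>space M. \<Gamma> (k # \<nu>) \<omega> \<in> B (k # \<nu>)} \<in> sets M" for k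
    using measurable_sets[OF env_measurable B] by (simp add: vimage_def Int_def conj_commute)
  have C: "?C \<in> sets M"
    using D by (intro sets.sets_Collect_countable_All sets.sets_Collect_imp) auto
  have T: "indicator ?T \<in> borel_measurable ?G" using tree_event_past by simp
  have eq: "(indicator ?T \<omega> * indicator ?C \<omega> :: ennreal) = indicator ?T \<omega> * indicator ?D \<omega>" for \<omega>
  proof -
    have "\<omega> \<in> ?C \<longleftrightarrow> \<omega> \<in> ?D" if w: "\<omega> \<in> ?T"
    proof
      assume "\<omega> \<in> ?D"
      moreover have "\<Gamma> (k # \<nu>) \<omega> \<in> B (k # \<nu>)" if "k \<noteq> i" for k
        using B'[OF that] measurable_space[OF env_measurable, of \<omega> "k # \<nu>"] w
        by (auto simp: tree_event_def)
      ultimately have "\<Gamma> (k # \<nu>) \<omega> \<in> B (k # \<nu>)" for k by (cases "k = i") auto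
      then show "\<omega> \<in> ?C" using w by (auto simp: tree_event_def)
    qed (use w in \<open>auto simp: tree_event_def thinned_def\<close>)
    then show ?thesis by (auto split: split_indicator)
  qed
  have "AE \<omega> in M. indicator ?T \<omega> * nn_cond_exp M ?G (indicator ?C) \<omega>
      = nn_cond_exp M ?G (\<lambda>\<omega>. indicator ?T \<omega> * indicator ?C \<omega>) \<omega>"
    using C T by (intro sub.nn_cond_exp_prod) auto
  moreover have "AE \<omega> in M. indicator ?T \<omega> * nn_cond_exp M ?G (indicator ?D) \<omega>
      = nn_cond_exp M ?G (\<lambda>\<omega>. indicator ?T \<omega> * indicator ?D \<omega>) \<omega>"
    using D T by (intro sub.nn_cond_exp_prod) auto
  moreover note marginal[OF B, of i \<nu> "i # \<nu>"]
  ultimately show ?thesis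
    unfolding eq by eventually_elim (auto simp: tree_event_def off_in_tree split: split_indicator_asm)
qed

text \<open>Only one child from each of two distinct families is observed, so the unknown law inside
  a family does not enter and the joint conditional law is the product of two marginals.\<close>

lemma nn_integral_children_pair:
  assumes ne: "\<nu> \<noteq> \<nu>'" and l: "length \<nu> = n" and l': "length \<nu>' = n"
    and E: "E \<in> sets (F n)" and sub: "E \<subseteq> tree_event (\<lambda>k. k) (i # \<nu>)" "E \<subseteq> tree_event (\<lambda>k. k) (j # \<nu>')"
    and H: "H \<in> borel_measurable (F n \<Otimes>\<^sub>M (Sigma' \<Otimes>\<^sub>M Sigma'))"
  shows "(\<integral>\<^sup>+ \<omega>. indicator E \<omega> * H (\<omega>, \<Gamma> (i # \<nu>) \<omega>, \<Gamma> (j # \<nu>') \<omega>) \<partial>M) =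
    (\<integral>\<^sup>+ \<omega>. indicator E \<omega> * (\<integral>\<^sup>+ z. H (\<omega>, z) \<partial>(K (\<Gamma> \<nu> \<omega>) \<Otimes>\<^sub>M K (\<Gamma> \<nu>' \<omega>))) \<partial>M)"
proof (rule nn_integral_disintegration[OF subalgebra_past _ _ _ _ H,
where X="\<lambda>\<omega>. (\<Gamma> (i # \<nu>) \<omega>, \<Gamma> (j # \<nu>') \<omega>)"])
  note env_measurable[measurable]
  let ?S = "Sigma' :: (real \<times> 's) measure"
  show EM: "E \<in> sets M" using E subalgebra_past by (auto simp: subalgebra_def)
  show Xm[measurable]: "(\<lambda>\<omega>. (\<Gamma> (i # \<nu>) \<omega>, \<Gamma> (j # \<nu>') \<omega>)) \<in> M \<rightarrow>\<^sub>M ?S \<Otimes>\<^sub>M ?S" by measurable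
  show km: "(\<lambda>\<omega>. K (\<Gamma> \<nu> \<omega>) \<Otimes>\<^sub>M K (\<Gamma> \<nu>' \<omega>)) \<in> M \<rightarrow>\<^sub>M prob_algebra (?S \<Otimes>\<^sub>M ?S)"
  proof (rule measurable_prob_algebraI)
    show "(\<lambda>\<omega>. K (\<Gamma> \<nu> \<omega>) \<Otimes>\<^sub>M K (\<Gamma> \<nu>' \<omega>)) \<in> M \<rightarrow>\<^sub>M subprob_algebra (?S \<Otimes>\<^sub>M ?S)"
      by (rule measurable_pair_measure[OF measurable_prob_algebraD[OF kernel_env]
          measurable_prob_algebraD[OF kernel_env]])
    fix \<omega> assume "\<omega> \<in> space M"
    then have "prob_space (K (\<Gamma> \<nu> \<omega>))" "prob_space (K (\<Gamma> \<nu>' \<omega>))"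
      using measurable_space[OF kernel_env[of \<nu>]] measurable_space[OF kernel_env[of \<nu>']]
      by (simp_all add: space_prob_algebra)
    then interpret pair_prob_space "K (\<Gamma> \<nu> \<omega>)" "K (\<Gamma> \<nu>' \<omega>)"
      by (intro pair_prob_space.intro pair_sigma_finite.intro prob_space_imp_sigma_finite)
    show "prob_space (K (\<Gamma> \<nu> \<omega>) \<Otimes>\<^sub>M K (\<Gamma> \<nu>' \<omega>))" by unfold_locales
  qed
  fix A b assume A: "A \<in> sets (F n)" and b: "b \<in> sets (?S \<Otimes>\<^sub>M ?S)"
  have AM: "A \<in> sets M" using A subalgebra_past by (auto simp: subalgebra_def)
  have EA: "(\<lambda>\<omega>. indicator (E \<inter> A) \<omega> :: ennreal) \<in> borel_measurable (F n)" using E A by simp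
  define D where "D = density M (indicator (E \<inter> A))"
  have sD[measurable_cong, simp]: "sets D = sets M" by (simp add: D_def)
  have km': "(\<lambda>\<omega>. K (\<Gamma> \<nu> \<omega>) \<Otimes>\<^sub>M K (\<Gamma> \<nu>' \<omega>)) \<in> D \<rightarrow>\<^sub>M subprob_algebra (?S \<Otimes>\<^sub>M ?S)"
    using measurable_prob_algebraD[OF km] unfolding measurable_cong_sets[OF sD refl] .
  define \<mu> where "\<mu> = distr D (?S \<Otimes>\<^sub>M ?S) (\<lambda>\<omega>. (\<Gamma> (i # \<nu>) \<omega>, \<Gamma> (j # \<nu>') \<omega>))"
  define \<mu>' where "\<mu>' = D \<bind> (\<lambda>\<omega>. K (\<Gamma> \<nu> \<omega>) \<Otimes>\<^sub>M K (\<Gamma> \<nu>' \<omega>))"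
  have neD: "space D \<noteq> {}" using not_empty by (simp add: D_def)
  have s2: "sets \<mu>' = sets (?S \<Otimes>\<^sub>M ?S)"
    unfolding \<mu>'_def by (rule sets_bind[OF _ neD]) (rule sets_kernel[OF km'])
  have e1: "emeasure \<mu> b = (\<integral>\<^sup>+ \<omega>. indicator (E \<inter> A) \<omega> * indicator b (\<Gamma> (i # \<nu>) \<omega>, \<Gamma> (j # \<nu>') \<omega>) \<partial>M)"
    if b[measurable]: "b \<in> sets (?S \<Otimes>\<^sub>M ?S)" for b
  proof -
    have "emeasure \<mu> b = (\<integral>\<^sup>+ z. indicator b z \<partial>\<mu>)" using b by (simp add: \<mu>_def)
    also have "\<dots> = (\<integral>\<^sup>+ \<omega>. indicator b (\<Gamma> (i # \<nu>) \<omega>, \<Gamma> (j # \<nu>') \<omega>) \<partial>D)"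
      unfolding \<mu>_def by (rule nn_integral_distr) measurable
    also have "\<dots> = (\<integral>\<^sup>+ \<omega>. indicator (E \<inter> A) \<omega> * indicator b (\<Gamma> (i # \<nu>) \<omega>, \<Gamma> (j # \<nu>') \<omega>) \<partial>M)"
      unfolding D_def using EM AM measurable_compose[OF Xm borel_measurable_indicator[OF b]]
      by (intro nn_integral_density) auto
    finally show ?thesis .
  qed
  have e2: "emeasure \<mu>' b = (\<integral>\<^sup>+ \<omega>. indicator (E \<inter> A) \<omega> * emeasure (K (\<Gamma> \<nu> \<omega>) \<Otimes>\<^sub>M K (\<Gamma> \<nu>' \<omega>)) b \<partial>M)"
    if b: "b \<in> sets (?S \<Otimes>\<^sub>M ?S)" for b
    unfolding \<mu>'_def emeasure_bind[OF neD km' b] unfolding D_def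
    using EM AM by (intro nn_integral_density measurable_compose[OF measurable_prob_algebraD[OF km]
        measurable_emeasure_subprob_algebra[OF b]]) auto
  \<comment> \<open>The disintegration asks for every \<open>b\<close> of the product sigma-algebra.
    For fixed \<open>A\<close> both sides are finite measures in \<open>b\<close>, so rectangles
    suffice.\<close>
  have "\<mu> = \<mu>'"
  proof (rule measure_eqI_pair[OF _ s2])
    show "sets \<mu> = sets (?S \<Otimes>\<^sub>M ?S)" by (simp add: \<mu>_def)
    have "emeasure \<mu> (space ?S \<times> space ?S) \<le> (\<integral>\<^sup>+ \<omega>. 1 \<partial>M)"
      unfolding e1[OF pair_measureI[OF sets.top sets.top]]
      by (intro nn_integral_mono) (auto split: split_indicator)
    then show "emeasure \<mu> (space ?S \<times> space ?S) \<noteq> \<infinity>" by (auto simp: emeasure_space_1 top_unique)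
    fix B B' assume B: "B \<in> sets ?S" and B': "B' \<in> sets ?S"
    \<comment> \<open>One constraint in each family and none elsewhere; in this form
      \<open>families_indep\<close> applies to the two families and
      \<open>nn_cond_exp_family\<close> to each of them.\<close>
    define Bf where "Bf \<mu> = (if \<mu> = i # \<nu> then B else if \<mu> = j # \<nu>' then B' else space ?S)" for \<mu>
    have Bf: "Bf \<mu> \<in> sets ?S" for \<mu> using B B' by (auto simp: Bf_def)
    let ?C = "\<lambda>\<nu>. {\<omega>\<in>space M. \<forall>k<off \<nu> \<omega>. \<Gamma> (k # \<nu>) \<omega> \<in> Bf (k # \<nu>)}"
    let ?CC = "{\<omega>\<in>space M. \<forall>\<nu>\<in>{\<nu>, \<nu>'}. \<forall>k<off \<nu> \<omega>. \<Gamma> (k # \<nu>) \<omega> \<in> Bf (k # \<nu>)}"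
    have Cm: "?C \<nu> \<in> sets M" for \<nu>
    proof -
      have "{\<omega>\<in>space M. \<Gamma> (k # \<nu>) \<omega> \<in> Bf (k # \<nu>)} \<in> sets M" for k
        using measurable_sets[OF env_measurable Bf] by (simp add: vimage_def Int_def conj_commute)
      then show ?thesis by (intro sets.sets_Collect_countable_All sets.sets_Collect_imp) auto
    qed
    have CC: "?CC = ?C \<nu> \<inter> ?C \<nu>'" by auto
    have "emeasure \<mu> (B \<times> B') = (\<integral>\<^sup>+ \<omega>. indicator (E \<inter> A) \<omega> * indicator ?CC \<omega> \<partial>M)"
    proof (subst e1, use B B' in simp, intro nn_integral_cong)
      fix \<omega> assume w: "\<omega> \<in> space M"
      have s: "\<Gamma> \<mu> \<omega> \<in> space ?S" for \<mu> using measurable_space[OF env_measurable w] .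
      have "\<omega> \<in> ?CC \<longleftrightarrow> \<Gamma> (i # \<nu>) \<omega> \<in> B \<and> \<Gamma> (j # \<nu>') \<omega> \<in> B'" if "\<omega> \<in> E"
      proof -
        have "i < off \<nu> \<omega>" "j < off \<nu>' \<omega>" using that sub by (auto simp: tree_event_def thinned_def)
        then show ?thesis using ne w s by (auto simp: Bf_def)
      qed
      then show "indicator (E \<inter> A) \<omega> * indicator (B \<times> B') (\<Gamma> (i # \<nu>) \<omega>, \<Gamma> (j # \<nu>') \<omega>)
          = (indicator (E \<inter> A) \<omega> * indicator ?CC \<omega> :: ennreal)"
        by (auto simp: indicator_times split: split_indicator)
    qed
    also have "\<dots> = (\<integral>\<^sup>+ \<omega>. indicator (E \<inter> A) \<omega> * nn_cond_exp M (F n) (indicator ?CC) \<omega> \<partial>M)"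
      using Cm EA unfolding CC by (intro sub.nn_cond_exp_intg[symmetric]) auto
    also have "\<dots> = (\<integral>\<^sup>+ \<omega>. indicator (E \<inter> A) \<omega> * (emeasure (K (\<Gamma> \<nu> \<omega>)) B * emeasure (K (\<Gamma> \<nu>' \<omega>)) B')
        \<partial>M)"
    proof (rule nn_integral_cong_AE)
      have "AE \<omega> in M. (\<forall>\<nu>\<in>{\<nu>, \<nu>'}. in_tree (\<lambda>\<mu>. off \<mu> \<omega>) \<nu>) \<longrightarrow>
        nn_cond_exp M (F n) (indicator ?CC) \<omega> = (\<Prod>\<nu>\<in>{\<nu>, \<nu>'}. nn_cond_exp M (F n) (indicator (?C \<nu>)) \<omega>)"
        using l l' Bf by (intro families_indep) auto
      moreover have "AE \<omega> in M. \<omega> \<in> tree_event (\<lambda>k. k) (i # \<nu>) \<longrightarrow>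
          nn_cond_exp M (F n) (indicator (?C \<nu>)) \<omega> = emeasure (K (\<Gamma> \<nu> \<omega>)) (Bf (i # \<nu>))"
        using l by (subst l[symmetric], intro nn_cond_exp_family Bf) (use ne in \<open>auto simp: Bf_def\<close>)
      moreover have "AE \<omega> in M. \<omega> \<in> tree_event (\<lambda>k. k) (j # \<nu>') \<longrightarrow>
          nn_cond_exp M (F n) (indicator (?C \<nu>')) \<omega> = emeasure (K (\<Gamma> \<nu>' \<omega>)) (Bf (j # \<nu>'))"
        using l' by (subst l'[symmetric], intro nn_cond_exp_family Bf) (use ne in \<open>auto simp: Bf_def\<close>)
      ultimately show "AE \<omega> in M. indicator (E \<inter> A) \<omega> * nn_cond_exp M (F n) (indicator ?CC) \<omega> =
          indicator (E \<inter> A) \<omega> * (emeasure (K (\<Gamma> \<nu> \<omega>)) B * emeasure (K (\<Gamma> \<nu>' \<omega>)) B')"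
      proof eventually_elim
        case (elim \<omega>)
        show ?case
        proof (cases "\<omega> \<in> E")
          case True
          then have t: "\<omega> \<in> tree_event (\<lambda>k. k) (i # \<nu>)" "\<omega> \<in> tree_event (\<lambda>k. k) (j # \<nu>')" using sub
            by auto
          then have "\<forall>\<nu>\<in>{\<nu>, \<nu>'}. in_tree (\<lambda>\<mu>. off \<mu> \<omega>) \<nu>" by (auto simp: tree_event_def off_in_tree)
          with elim t ne show ?thesis by (simp add: Bf_def)
        qed simp
      qed
    qed
    also have "\<dots> = emeasure \<mu>' (B \<times> B')"
    proof (subst e2, use B B' in simp, intro nn_integral_cong)
      fix \<omega> assume w: "\<omega> \<in> space M"
      then have p: "prob_space (K (\<Gamma> \<nu>' \<omega>))"
        using measurable_space[OF kernel_env] by (auto simp: space_prob_algebra)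
      have s: "sets (K (\<Gamma> \<nu> \<omega>)) = sets ?S" for \<nu>
        using sets_kernel[OF measurable_prob_algebraD[OF kernel_env] w] .
      show "indicator (E \<inter> A) \<omega> * (emeasure (K (\<Gamma> \<nu> \<omega>)) B * emeasure (K (\<Gamma> \<nu>' \<omega>)) B') =
         indicator (E \<inter> A) \<omega> * emeasure (K (\<Gamma> \<nu> \<omega>) \<Otimes>\<^sub>M K (\<Gamma> \<nu>' \<omega>)) (B \<times> B')"
        using B B'
        by (subst sigma_finite_measure.emeasure_pair_measure_Times[OF prob_space_imp_sigma_finite[OF
        p]]) (auto simp: s)
    qed
    finally show "emeasure \<mu> (B \<times> B') = emeasure \<mu>' (B \<times> B')" .
  qed
  then have "emeasure \<mu> b = emeasure \<mu>' b" by simp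
  then show "(\<integral>\<^sup>+ \<omega>. indicator E \<omega> * (indicator A \<omega> * indicator b (\<Gamma> (i # \<nu>) \<omega>, \<Gamma> (j # \<nu>') \<omega>)) \<partial>M) =
       (\<integral>\<^sup>+ \<omega>. indicator E \<omega> * (indicator A \<omega> * emeasure (K (\<Gamma> \<nu> \<omega>) \<Otimes>\<^sub>M K (\<Gamma> \<nu>' \<omega>)) b) \<partial>M)"
    unfolding e1[OF b] e2[OF b] by (simp add: indicator_inter_arith mult.assoc)
qed

end

section \<open>Positive recurrence\<close>

lemma finite_tree_levels: "finite {\<nu>. in_tree d \<nu> \<and> length \<nu> < n}"
proof (induction n)
  case (Suc n)
  have "{\<nu>. in_tree d \<nu> \<and> length \<nu> < Suc n} \<subseteq>
     insert [] (\<Union>\<mu>\<in>{\<nu>. in_tree d \<nu> \<and> length \<nu> < n}. (\<lambda>i. i # \<mu>) ` {..<d \<mu>})"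
  proof
    fix \<nu> assume "\<nu> \<in> {\<nu>. in_tree d \<nu> \<and> length \<nu> < Suc n}"
    then show "\<nu> \<in> insert [] (\<Union>\<mu>\<in>{\<nu>. in_tree d \<nu> \<and> length \<nu> < n}. (\<lambda>i. i # \<mu>) ` {..<d \<mu>})"
      by (cases \<nu>) auto
  qed
  then show ?case by (rule finite_subset) (auto intro!: Suc)
qed simp

text \<open>The tail formula for the mean; the \<open>i\<close>-th tail is the probability that the
  child with label \<open>i\<close> exists.\<close>

lemma nn_integral_tail_pmf:
  fixes p :: "nat pmf"
  shows "(\<integral>\<^sup>+ i. ennreal (measure_pmf.prob p {k. i < g k}) \<partial>count_space UNIV)
      = (\<integral>\<^sup>+ k. of_nat (g k) \<partial>measure_pmf p)"
  by (subst nn_integral_nat_function) (simp_all add: nn_integral_count_space_nat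
      measure_pmf.emeasure_eq_measure)

text \<open>The tilted operator of \<open>nn_integral_chain_law_exp\<close> for \<open>K_ln\<close>,
  carried back to \<open>Sigma'\<close>: \<open>exp (l * u)\<close> becomes
  \<open>a powr l\<close>.\<close>

definition moment_op :: "(real \<times> 's \<Rightarrow> (real \<times> 's) measure) \<Rightarrow> real \<Rightarrow> (real \<times> 's \<Rightarrow> ennreal) \<Rightarrow> real \<times> 's \<Rightarrow>
    ennreal" where
  "moment_op K l f y = (\<integral>\<^sup>+ z. ennreal (fst z powr l) * f z \<partial>K y)"

lemma fst_Sigma'[measurable]: "fst \<in> borel_measurable Sigma'"
  unfolding Sigma'_def by (rule measurable_restrict_space1) (simp add: borel_prod[symmetric])

lemma moment_op_measurable:
  assumes "K \<in> Sigma' \<rightarrow>\<^sub>M prob_algebra Sigma'" and [measurable]: "f \<in> borel_measurable Sigma'"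
  shows "moment_op K l f \<in> borel_measurable Sigma'"
  unfolding moment_op_def
  by (rule measurable_compose[OF measurable_prob_algebraD[OF assms(1)]
      nn_integral_measurable_subprob_algebra]) measurable

lemma moment_op_funpow_measurable:
  assumes "K \<in> Sigma' \<rightarrow>\<^sub>M prob_algebra Sigma'" and "f \<in> borel_measurable Sigma'"
  shows "(moment_op K l ^^ n) f \<in> borel_measurable Sigma'"
  by (induction n) (auto simp: assms intro: moment_op_measurable[OF assms(1)])

context markovian_environment begin

text \<open>Built from \<open>env\<close> rather than \<open>\<Gamma>\<close> in order to be
  measurable with respect to the past; on the tree the choice makes no difference.\<close>

definition cond :: "nat list \<Rightarrow> 'w \<Rightarrow> real" where
  "cond \<nu> \<omega> = conductance (\<lambda>\<mu>. fst (env \<mu> \<omega>)) \<nu>"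

lemma cond_Nil[simp]: "cond [] \<omega> = 1" by (simp add: cond_def)

lemma cond_Cons: "cond (i # \<nu>) \<omega> = cond \<nu> \<omega> * fst (env (i # \<nu>) \<omega>)" by (simp add: cond_def)

lemma env_space: "\<omega> \<in> space M \<Longrightarrow> env \<nu> \<omega> \<in> space Sigma'"
  using measurable_space[OF env_past[OF order_refl]] by (simp add: space_past)

lemma env_eq: "\<omega> \<in> tree_event (\<lambda>k. k) \<nu> \<Longrightarrow> env \<nu> \<omega> = \<Gamma> \<nu> \<omega>"
  by (simp add: env_def tree_event_def)

lemma cond_pos: "\<omega> \<in> space M \<Longrightarrow> 0 < cond \<nu> \<omega>"
proof (induction \<nu>)
  case (Cons i \<nu>)
  then show ?case using env_space[of \<omega> "i # \<nu>"]
    by (auto simp: cond_Cons Sigma'_def space_restrict_space)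
qed simp

lemma cond_eq: "in_tree (\<lambda>\<mu>. off \<mu> \<omega>) \<nu> \<Longrightarrow> cond \<nu> \<omega> = conductance (\<lambda>\<mu>. fst (\<Gamma> \<mu> \<omega>)) \<nu>"
  by (induction \<nu>) (auto simp: cond_Cons env_def off_in_tree)

lemma cond_past: "length \<nu> \<le> n \<Longrightarrow> cond \<nu> \<in> borel_measurable (F n)"
proof (induction \<nu>)
  case (Cons i \<nu>)
  have "(\<lambda>\<omega>. fst (env (i # \<nu>) \<omega>)) \<in> borel_measurable (F n)"
    by (rule measurable_compose[OF env_past[OF Cons.prems] fst_Sigma'])
  then show ?case using Cons by (simp add: cond_Cons[abs_def] borel_measurable_times)
qed (simp add: cond_Nil[abs_def])

lemma nn_integral_tree_event_level:
  assumes b: "(\<integral>\<^sup>+ k. of_nat (g k) \<partial>measure_pmf p) = ennreal b" and b0: "0 \<le> b"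
  shows "(\<integral>\<^sup>+ \<nu>. indicator {\<nu>. length \<nu> = n} \<nu> * ennreal (prob (tree_event g \<nu>)) \<partial>count_space UNIV)
      = ennreal (b ^ n)"
proof (induction n)
  case 0
  have "(\<integral>\<^sup>+ \<nu>. indicator {\<nu>. length \<nu> = 0} \<nu> * ennreal (prob (tree_event g \<nu>)) \<partial>count_space UNIV)
      = ennreal (prob (tree_event g []))"
    by (subst nn_integral_count_space_list) simp
  also have "tree_event g [] = space M" by (simp add: tree_event_def)
  finally show ?case by (simp add: prob_space)
next
  case (Suc n)
  have "(\<integral>\<^sup>+ \<nu>. indicator {\<nu>. length \<nu> = Suc n} \<nu> * ennreal (prob (tree_event g \<nu>)) \<partial>count_space UNIV)
     = (\<integral>\<^sup>+ \<nu>. (\<integral>\<^sup>+ i. indicator {\<nu>. length \<nu> = n} \<nu> * ennreal (prob (tree_event g \<nu>)) * ennreal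
         (measure_pmf.prob p {k. i < g k}) \<partial>count_space UNIV) \<partial>count_space UNIV)"
    by (subst nn_integral_count_space_list)
       (auto simp: prob_tree_event_Cons ennreal_mult mult.assoc
           intro!: nn_integral_cong split: split_indicator)
  also have "\<dots> = (\<integral>\<^sup>+ \<nu>. indicator {\<nu>. length \<nu> = n} \<nu> * ennreal (prob (tree_event g \<nu>)) * ennreal b
      \<partial>count_space UNIV)"
    by (simp add: nn_integral_cmult nn_integral_tail_pmf b)
  also have "\<dots> = ennreal (b ^ n) * ennreal b"
    by (simp add: nn_integral_multc Suc.IH)
  finally show ?case by (simp add: ennreal_mult[symmetric] b0 mult.commute)
qed

end

context markov_tree begin

text \<open>As the past contains the whole tree, the environment along one line of descent is a
  Markov chain even when the offspring numbers are given. The event \<open>E\<close>, in use a tree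
  event, belongs to every past and survives each conditioning while the generations are integrated
  out from the leaf upwards.\<close>

lemma nn_integral_cond_powr:
  assumes E: "\<And>n. E \<in> sets (F n)" and sub: "E \<subseteq> tree_event (\<lambda>k. k) \<nu>"
    and f: "f \<in> borel_measurable Sigma'"
  shows "(\<integral>\<^sup>+ \<omega>. indicator E \<omega> * (ennreal (cond \<nu> \<omega> powr l) * f (\<Gamma> \<nu> \<omega>)) \<partial>M) =
    (\<integral>\<^sup>+ \<omega>. indicator E \<omega> * (moment_op K l ^^ length \<nu>) f (\<Gamma> [] \<omega>) \<partial>M)"
  using sub f
proof (induction \<nu> arbitrary: f)
  case (Cons i \<nu>)
  note f = Cons.prems(2)
  have sub': "E \<subseteq> tree_event (\<lambda>k. k) \<nu>" using Cons.prems(1) by (auto simp: tree_event_def)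
  let ?H = "\<lambda>(\<omega>, z). ennreal (cond \<nu> \<omega> powr l) * (ennreal (fst z powr l) * f z)"
  have "(\<integral>\<^sup>+ \<omega>. indicator E \<omega> * (ennreal (cond (i # \<nu>) \<omega> powr l) * f (\<Gamma> (i # \<nu>) \<omega>)) \<partial>M)
     = (\<integral>\<^sup>+ \<omega>. indicator E \<omega> * ?H (\<omega>, \<Gamma> (i # \<nu>) \<omega>) \<partial>M)"
  proof (intro nn_integral_cong)
    fix \<omega> assume w: "\<omega> \<in> space M"
    have "cond (i # \<nu>) \<omega> powr l = cond \<nu> \<omega> powr l * fst (\<Gamma> (i # \<nu>) \<omega>) powr l" if "\<omega> \<in> E"
      using env_eq[of \<omega> "i # \<nu>"] that Cons.prems(1) env_space[OF w, of "i # \<nu>"] cond_pos[OF w, of \<nu>]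
      by (auto simp: cond_Cons powr_mult Sigma'_def space_restrict_space)
    then show "indicator E \<omega> * (ennreal (cond (i # \<nu>) \<omega> powr l) * f (\<Gamma> (i # \<nu>) \<omega>))
        = indicator E \<omega> * ?H (\<omega>, \<Gamma> (i # \<nu>) \<omega>)"
      by (auto simp: ennreal_mult mult.assoc split: split_indicator)
  qed
  also have "\<dots> = (\<integral>\<^sup>+ \<omega>. indicator E \<omega> * (\<integral>\<^sup>+ z. ?H (\<omega>, z) \<partial>K (\<Gamma> \<nu> \<omega>)) \<partial>M)"
  proof (rule nn_integral_child[OF E Cons.prems(1)])
    note cond_past[OF order_refl, of \<nu>, measurable] f[measurable]
    show "?H \<in> borel_measurable (F (length \<nu>) \<Otimes>\<^sub>M Sigma')" by measurable
  qed
  also have "\<dots> = (\<integral>\<^sup>+ \<omega>. indicator E \<omega> * (ennreal (cond \<nu> \<omega> powr l) * moment_op K l f (\<Gamma> \<nu> \<omega>)) \<partial>M)"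
  proof (intro nn_integral_cong)
    fix \<omega> assume w: "\<omega> \<in> space M"
    have s: "sets (K (\<Gamma> \<nu> \<omega>)) = sets Sigma'"
      using sets_kernel[OF measurable_prob_algebraD[OF kernel_env] w] .
    have "(\<lambda>z. ennreal (fst z powr l) * f z) \<in> borel_measurable (K (\<Gamma> \<nu> \<omega>))"
      unfolding measurable_cong_sets[OF s refl] using f by measurable
    then show "indicator E \<omega> * (\<integral>\<^sup>+ z. ?H (\<omega>, z) \<partial>K (\<Gamma> \<nu> \<omega>))
        = indicator E \<omega> * (ennreal (cond \<nu> \<omega> powr l) * moment_op K l f (\<Gamma> \<nu> \<omega>))"
      by (simp add: moment_op_def nn_integral_cmult)
  qed
  also have "\<dots> = (\<integral>\<^sup>+ \<omega>. indicator E \<omega> * (moment_op K l ^^ length \<nu>) (moment_op K l f) (\<Gamma> [] \<omega>) \<partial>M)"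
    by (rule Cons.IH[OF sub' moment_op_measurable[OF kernel f]])
  finally show ?case by (simp add: funpow_swap1)
qed simp

lemma positive_recurrentI:
  assumes l: "0 < l" "l \<le> 1" and b: "(\<integral>\<^sup>+ k. of_nat k \<partial>measure_pmf p) = ennreal b" and b0: "0 \<le> b"
    and a: "0 \<le> a" "a * b < 1"
    and bound: "\<And>n y. n \<ge> n0 \<Longrightarrow> y \<in> space Sigma' \<Longrightarrow> (moment_op K l ^^ n) (\<lambda>_. 1) y \<le> ennreal (a ^ n)"
  shows "positive_recurrent M off \<Gamma>"
proof -
  let ?T = "tree_event (\<lambda>k. k)"
  let ?f = "\<lambda>\<omega> \<nu>. indicator {\<nu>. n0 \<le> length \<nu>} \<nu> * (indicator (?T \<nu>) \<omega> * ennreal (cond \<nu> \<omega> powr l))"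
  have fm[measurable]: "(\<lambda>\<omega>. ?f \<omega> \<nu>) \<in> borel_measurable M" for \<nu>
    using measurable_from_subalg[OF subalgebra_past cond_past[OF order_refl, of \<nu>]] by measurable
  have one: "(\<integral>\<^sup>+ \<omega>. indicator (?T \<nu>) \<omega> * ennreal (cond \<nu> \<omega> powr l) \<partial>M)
      \<le> ennreal (a ^ length \<nu>) * ennreal (prob (?T \<nu>))"
    if n: "n0 \<le> length \<nu>" for \<nu>
  proof -
    have "(\<integral>\<^sup>+ \<omega>. indicator (?T \<nu>) \<omega> * ennreal (cond \<nu> \<omega> powr l) \<partial>M) =
      (\<integral>\<^sup>+ \<omega>. indicator (?T \<nu>) \<omega> * (moment_op K l ^^ length \<nu>) (\<lambda>_. 1) (\<Gamma> [] \<omega>) \<partial>M)"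
      using nn_integral_cond_powr[OF tree_event_past order_refl, of "\<lambda>_. 1" \<nu> l] by simp
    also have "\<dots> \<le> (\<integral>\<^sup>+ \<omega>. ennreal (a ^ length \<nu>) * indicator (?T \<nu>) \<omega> \<partial>M)"
      using bound[OF n] measurable_space[OF env_measurable]
      by (intro nn_integral_mono) (auto split: split_indicator)
    also have "\<dots> = ennreal (a ^ length \<nu>) * ennreal (prob (?T \<nu>))"
      by (simp add: nn_integral_cmult_indicator emeasure_eq_measure)
    finally show ?thesis .
  qed
  have pm: "case_prod ?f \<in> borel_measurable (M \<Otimes>\<^sub>M count_space UNIV)"
    unfolding case_prod_unfold
  proof (rule measurable_compose_countable[where f="\<lambda>\<nu> x. ?f (fst x) \<nu>" and g=snd])
    show "(\<lambda>x. ?f (fst x) \<nu>) \<in> borel_measurable (M \<Otimes>\<^sub>M count_space UNIV)" for \<nu>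
      by (rule measurable_compose[OF measurable_fst fm])
    show "snd \<in> M \<Otimes>\<^sub>M count_space UNIV \<rightarrow>\<^sub>M count_space (UNIV :: nat list set)"
      by (rule measurable_snd)
  qed
  interpret C: sigma_finite_measure "count_space (UNIV :: nat list set)"
    by (rule sigma_finite_measure_count_space_countable) simp
  interpret P: pair_sigma_finite M "count_space (UNIV :: nat list set)" by unfold_locales
  have "(\<integral>\<^sup>+ \<omega>. (\<integral>\<^sup>+ \<nu>. ?f \<omega> \<nu> \<partial>count_space UNIV) \<partial>M) = (\<integral>\<^sup>+ \<nu>. (\<integral>\<^sup>+ \<omega>. ?f \<omega> \<nu> \<partial>M) \<partial>count_space UNIV)"
    by (rule P.Fubini'[OF pm, symmetric])
  also have "\<dots> \<le> (\<integral>\<^sup>+ \<nu>. ennreal (a ^ length \<nu>) * ennreal (prob (?T \<nu>)) \<partial>count_space UNIV)"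
    using one by (intro nn_integral_mono) (auto split: split_indicator)
  also have "\<dots> = (\<integral>\<^sup>+ \<nu>. (\<Sum>n. indicator {\<nu>. length \<nu> = n} \<nu> * (ennreal (a ^ n) * ennreal (prob (?T \<nu>))))
      \<partial>count_space UNIV)"
  proof (intro nn_integral_cong)
    fix \<nu> :: "nat list"
    have "(\<Sum>n. indicator {\<nu>. length \<nu> = n} \<nu> * (ennreal (a ^ n) * ennreal (prob (?T \<nu>)))) =
      (\<Sum>n\<in>{length \<nu>}. indicator {\<nu>. length \<nu> = n} \<nu> * (ennreal (a ^ n) * ennreal (prob (?T \<nu>))))"
      by (rule suminf_finite) auto
    then show "ennreal (a ^ length \<nu>) * ennreal (prob (?T \<nu>))
        = (\<Sum>n. indicator {\<nu>. length \<nu> = n} \<nu> * (ennreal (a ^ n) * ennreal (prob (?T \<nu>))))" by simp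
  qed
  also have "\<dots> = (\<Sum>n. \<integral>\<^sup>+ \<nu>. indicator {\<nu>. length \<nu> = n} \<nu> * (ennreal (a ^ n) * ennreal (prob (?T \<nu>)))
      \<partial>count_space UNIV)"
    by (rule nn_integral_suminf) simp
  also have "\<dots> = (\<Sum>n. ennreal ((a * b) ^ n))"
  proof (rule suminf_cong)
    fix n
    have "(\<integral>\<^sup>+ \<nu>. indicator {\<nu>. length \<nu> = n} \<nu> * (ennreal (a ^ n) * ennreal (prob (?T \<nu>))) \<partial>count_space
        UNIV)
       = ennreal (a ^ n) * (\<integral>\<^sup>+ \<nu>. indicator {\<nu>. length \<nu> = n} \<nu> * ennreal (prob (?T \<nu>)) \<partial>count_space
           UNIV)"
      by (subst nn_integral_cmult[symmetric]) (auto simp: mult_ac)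
    then show "(\<integral>\<^sup>+ \<nu>. indicator {\<nu>. length \<nu> = n} \<nu> * (ennreal (a ^ n) * ennreal (prob (?T \<nu>)))
        \<partial>count_space UNIV) = ennreal ((a * b) ^ n)"
      using a b0 by (simp add: nn_integral_tree_event_level[OF b b0] ennreal_mult[symmetric]
          power_mult_distrib)
  qed
  also have "\<dots> = ennreal (1 / (1 - a * b))"
    using a b0 by (intro suminf_ennreal_eq geometric_sums) auto
  finally have "(\<integral>\<^sup>+ \<omega>. (\<integral>\<^sup>+ \<nu>. ?f \<omega> \<nu> \<partial>count_space UNIV) \<partial>M) < \<infinity>"
    by (rule order.strict_trans1) simp
  moreover have "(\<lambda>\<omega>. \<integral>\<^sup>+ \<nu>. ?f \<omega> \<nu> \<partial>count_space UNIV) \<in> borel_measurable M"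
    by (rule C.borel_measurable_nn_integral[OF pm])
  ultimately have "AE \<omega> in M. (\<integral>\<^sup>+ \<nu>. ?f \<omega> \<nu> \<partial>count_space UNIV) \<noteq> \<infinity>"
    by (intro nn_integral_PInf_AE) auto
  then show ?thesis unfolding positive_recurrent_def
  proof (rule AE_mp, intro AE_I2 impI)
    fix \<omega> assume w: "\<omega> \<in> space M" and fin: "(\<integral>\<^sup>+ \<nu>. ?f \<omega> \<nu> \<partial>count_space UNIV) \<noteq> \<infinity>"
    let ?d = "\<lambda>\<mu>. off \<mu> \<omega>"
    define S where "S = enn2real (\<integral>\<^sup>+ \<nu>. ?f \<omega> \<nu> \<partial>count_space UNIV)"
    have S: "(\<integral>\<^sup>+ \<nu>. ?f \<omega> \<nu> \<partial>count_space UNIV) = ennreal S"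
      using fin by (simp add: S_def top.not_eq_extremum)
    have S0: "0 \<le> S" by (simp add: S_def)
    \<comment> \<open>Each term \<open>c powr l\<close> is at most the whole sum \<open>S\<close>,
      so \<open>c = (c powr l) powr ((1 - l) / l) * c powr l\<close> is at most
      \<open>D * c powr l\<close>. The exponent is nonnegative because
      \<open>l \<le> 1\<close>.\<close>
    define D where "D = max 1 S powr ((1 - l) / l)"
    have D0: "0 \<le> D" by (simp add: D_def)
    have t: "in_tree ?d \<nu> \<longleftrightarrow> \<omega> \<in> ?T \<nu>" for \<nu> using w by (simp add: tree_event_def off_in_tree)
    have le: "cond \<nu> \<omega> \<le> D * cond \<nu> \<omega> powr l" if n: "n0 \<le> length \<nu>" and T: "\<omega> \<in> ?T \<nu>" for \<nu>
    proof -
      let ?c = "cond \<nu> \<omega>"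
      have c: "0 < ?c" by (rule cond_pos[OF w])
      have "ennreal (?c powr l) = (\<integral>\<^sup>+ \<mu>. ?f \<omega> \<mu> * indicator {\<nu>} \<mu> \<partial>count_space UNIV)"
        using n T by simp
      also have "\<dots> \<le> ennreal S" unfolding S[symmetric]
        by (intro nn_integral_mono) (auto split: split_indicator)
      finally have "?c powr l \<le> max 1 S" using S0 by (simp add: max_def)
      then have "(?c powr l) powr ((1 - l) / l) \<le> max 1 S powr ((1 - l) / l)"
        using l by (intro powr_mono2) auto
      then have "?c powr (1 - l) \<le> D" using l by (simp add: D_def powr_powr)
      then have "?c powr (1 - l) * ?c powr l \<le> D * ?c powr l" by (intro mult_right_mono) auto
      also have "?c powr (1 - l) * ?c powr l = ?c" using c by (simp add: powr_add[symmetric])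
      finally show ?thesis .
    qed
    let ?I = "indicator {\<nu>. in_tree ?d \<nu>} :: nat list \<Rightarrow> ennreal"
    \<comment> \<open>The moment bound is asymptotic and says nothing about generations before
      \<open>n0\<close>, but in each environment these contain finitely many vertices.\<close>
    let ?J = "{\<nu>. in_tree ?d \<nu> \<and> length \<nu> < n0}"
    have pos: "0 < fst (\<Gamma> \<nu> \<omega>)" for \<nu>
      using measurable_space[OF env_measurable w, of \<nu>] by (auto simp: Sigma'_def space_restrict_space)
    have "(\<integral>\<^sup>+ \<nu>. ?I \<nu> * ennreal (conductance (\<lambda>\<nu>. fst (\<Gamma> \<nu> \<omega>)) \<nu>) \<partial>count_space UNIV)
       \<le> (\<integral>\<^sup>+ \<nu>. indicator ?J \<nu> * ennreal (cond \<nu> \<omega>) + ennreal D * ?f \<omega> \<nu> \<partial>count_space UNIV)"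
    proof (intro nn_integral_mono)
      fix \<nu>
      show "?I \<nu> * ennreal (conductance (\<lambda>\<nu>. fst (\<Gamma> \<nu> \<omega>)) \<nu>) \<le> indicator ?J \<nu> * ennreal (cond \<nu> \<omega>)
          + ennreal D * ?f \<omega> \<nu>"
      proof (cases "in_tree ?d \<nu>")
        case True
        show ?thesis
        proof (cases "length \<nu> < n0")
          case False
          then have "ennreal (cond \<nu> \<omega>) \<le> ennreal D * ennreal (cond \<nu> \<omega> powr l)"
            using le[of \<nu>] True D0 by (simp add: t ennreal_mult[symmetric] ennreal_leI)
          then show ?thesis using True False by (simp add: cond_eq[symmetric] t[symmetric])
        qed (use True in \<open>simp add: cond_eq[symmetric]\<close>)
      qed simp
    qed
    also have "\<dots> = (\<integral>\<^sup>+ \<nu>. indicator ?J \<nu> * ennreal (cond \<nu> \<omega>) \<partial>count_space UNIV) + ennreal D * ennreal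
        S"
      unfolding S[symmetric] by (subst nn_integral_add) (auto simp: nn_integral_cmult)
    also have "(\<integral>\<^sup>+ \<nu>. indicator ?J \<nu> * ennreal (cond \<nu> \<omega>) \<partial>count_space UNIV)
        = (\<Sum>\<nu>\<in>?J. ennreal (cond \<nu> \<omega>))"
      by (subst nn_integral_count_space'[of ?J]) (auto simp: finite_tree_levels)
    also have "\<dots> = ennreal (\<Sum>\<nu>\<in>?J. cond \<nu> \<omega>)"
      by (rule sum_ennreal) (simp add: cond_pos[OF w] less_imp_le)
    finally have "(\<integral>\<^sup>+ \<nu>. ?I \<nu> * ennreal (conductance (\<lambda>\<nu>. fst (\<Gamma> \<nu> \<omega>)) \<nu>) \<partial>count_space UNIV) < \<infinity>"
      by (rule order.strict_trans1) (simp add: ennreal_mult_less_top)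
    then show "(\<integral>\<^sup>+ x. hitting_time x \<partial>env_walk_law off \<Gamma> \<omega>) < \<infinity>"
      unfolding env_walk_law_def
      by (intro order.strict_trans1[OF nn_integral_hitting_time_le[OF pos]])
          (simp add: ennreal_mult_less_top)
  qed
qed

end

section \<open>Escape probabilities, flows and energy\<close>

text \<open>\<open>escape A d r \<nu>\<close> is the probability that the walk started at \<open>\<nu>\<close> gets \<open>r\<close> generations below \<open>\<nu>\<close>
  before hitting the parent of \<open>\<nu>\<close>.\<close>
primrec escape :: "(nat list \<Rightarrow> real) \<Rightarrow> (nat list \<Rightarrow> nat) \<Rightarrow> nat \<Rightarrow> nat list \<Rightarrow> real" where
  "escape A d 0 \<nu> = 1"
| "escape A d (Suc r) \<nu> = (let S = \<Sum>i<d \<nu>. A (i # \<nu>) * escape A d r (i # \<nu>) in S / (1 + S))"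

lemma escape_bounds:
  assumes pos: "\<And>\<nu>. 0 < A \<nu>"
  shows "0 \<le> escape A d r \<nu>" "escape A d r \<nu> \<le> 1"
proof -
  have "0 \<le> escape A d r \<nu> \<and> escape A d r \<nu> \<le> 1"
  proof (induction r arbitrary: \<nu>)
    case (Suc r)
    then have "0 \<le> (\<Sum>i<d \<nu>. A (i # \<nu>) * escape A d r (i # \<nu>))"
      by (intro sum_nonneg mult_nonneg_nonneg less_imp_le[OF pos]) auto
    then show ?case by (simp add: Let_def divide_le_eq_1)
  qed simp
  then show "0 \<le> escape A d r \<nu>" "escape A d r \<nu> \<le> 1" by auto
qed

lemma frac_mono: "0 \<le> x \<Longrightarrow> x \<le> y \<Longrightarrow> x / (1 + x) \<le> y / (1 + (y::real))"
  by (simp add: pos_divide_le_eq pos_le_divide_eq algebra_simps)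

text \<open>The recursion is monotone and starts from the largest possible value.\<close>

lemma escape_decreasing:
  assumes pos: "\<And>\<nu>. 0 < A \<nu>"
  shows "escape A d (Suc r) \<nu> \<le> escape A d r \<nu>"
proof (induction r arbitrary: \<nu>)
  case 0 show ?case using escape_bounds(2)[of A d "Suc 0" \<nu>] pos by simp
next
  case (Suc r)
  have "(\<Sum>i<d \<nu>. A (i # \<nu>) * escape A d (Suc r) (i # \<nu>)) \<le> (\<Sum>i<d \<nu>. A (i # \<nu>) * escape A d r (i # \<nu>))"
    by (intro sum_mono mult_left_mono Suc.IH less_imp_le[OF pos])
  moreover have "0 \<le> (\<Sum>i<d \<nu>. A (i # \<nu>) * escape A d (Suc r) (i # \<nu>))"
    by (intro sum_nonneg mult_nonneg_nonneg less_imp_le[OF pos] escape_bounds) (rule pos)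
  ultimately show ?case
    unfolding escape.simps(2)[of A d "Suc r"] escape.simps(2)[of A d r \<nu>] Let_def by (intro frac_mono)
qed

text \<open>The strength at \<open>\<nu>\<close> of the flow that delivers the amount
  \<open>X\<close> to every vertex \<open>r\<close> generations below. Conservation at the vertices
  is the recursion itself.\<close>

primrec flow :: "(nat list \<Rightarrow> real) \<Rightarrow> (nat list \<Rightarrow> nat) \<Rightarrow> nat \<Rightarrow> nat list \<Rightarrow> real" where
  "flow X d 0 \<nu> = X \<nu>"
| "flow X d (Suc r) \<nu> = (\<Sum>i<d \<nu>. flow X d r (i # \<nu>))"

text \<open>The edge above \<open>\<nu>\<close> is included, since an escape probability compares
  that edge with the network below it.\<close>

primrec energy :: "(nat list \<Rightarrow> real) \<Rightarrow> (nat list \<Rightarrow> nat) \<Rightarrow> (nat list \<Rightarrow> real) \<Rightarrow> nat \<Rightarrow> nat list \<Rightarrow> real"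
where
  "energy X d c 0 \<nu> = (flow X d 0 \<nu>)\<^sup>2 / c \<nu>"
| "energy X d c (Suc r) \<nu> = (flow X d (Suc r) \<nu>)\<^sup>2 / c \<nu> + (\<Sum>i<d \<nu>. energy X d c r (i # \<nu>))"

lemma energy_nonneg: "(\<And>\<nu>. 0 < c \<nu>) \<Longrightarrow> 0 \<le> energy X d c r \<nu>"
proof (induction r arbitrary: \<nu>)
  case (Suc r)
  then show ?case using less_imp_le[OF Suc.prems]
    by (auto intro!: add_nonneg_nonneg divide_nonneg_nonneg sum_nonneg)
qed (simp add: less_imp_le)

text \<open>Thomson's principle, \<open>c \<nu> * escape A d r \<nu>\<close> being the effective conductance.\<close>
lemma flow_square_le_energy:
  assumes pos: "\<And>\<nu>. 0 < A \<nu>" and c: "\<And>i \<nu>. c (i # \<nu>) = c \<nu> * A (i # \<nu>)" and c0: "\<And>\<nu>. 0 < c \<nu>"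
  shows "(flow X d r \<nu>)\<^sup>2 \<le> c \<nu> * escape A d r \<nu> * energy X d c r \<nu>"
proof (induction r arbitrary: \<nu>)
  case 0 show ?case using c0[of \<nu>] by simp
next
  case (Suc r)
  let ?w = "\<lambda>i. c (i # \<nu>) * escape A d r (i # \<nu>)"
  let ?e = "\<lambda>i. energy X d c r (i # \<nu>)"
  let ?\<theta> = "\<lambda>i. flow X d r (i # \<nu>)"
  define S where "S = (\<Sum>i<d \<nu>. A (i # \<nu>) * escape A d r (i # \<nu>))"
  define E where "E = (\<Sum>i<d \<nu>. ?e i)"
  define \<theta> where "\<theta> = flow X d (Suc r) \<nu>"
  have w0: "0 \<le> ?w i" for i using escape_bounds(1)[of A d r] pos c0 by (simp add: less_imp_le)
  have e0: "0 \<le> ?e i" for i using energy_nonneg[of c] c0 by blast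
  have S0: "0 \<le> S" unfolding S_def using escape_bounds(1)[of A d r] pos
    by (intro sum_nonneg) (simp add: less_imp_le)
  \<comment> \<open>Cauchy-Schwarz over the children is the parallel law and gives conductance
    \<open>c \<nu> * S\<close> below \<open>\<nu>\<close>. The edge above \<open>\<nu>\<close> is
    then added in series, which yields \<open>c \<nu> * (S / (1 + S))\<close>.\<close>
  have "\<bar>?\<theta> i\<bar> \<le> sqrt (?w i) * sqrt (?e i)" for i
    using Suc.IH[of "i # \<nu>"] real_sqrt_le_mono[of "(?\<theta> i)\<^sup>2"] by (simp add: real_sqrt_mult[symmetric])
  then have "\<bar>\<theta>\<bar> \<le> (\<Sum>i<d \<nu>. sqrt (?w i) * sqrt (?e i))"
    unfolding \<theta>_def flow.simps by (intro order_trans[OF sum_abs] sum_mono)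
  from power_mono[OF this abs_ge_zero, of 2]
  have "\<theta>\<^sup>2 \<le> (\<Sum>i<d \<nu>. sqrt (?w i) * sqrt (?e i))\<^sup>2" by simp
  also have "\<dots> \<le> (\<Sum>i<d \<nu>. (sqrt (?w i))\<^sup>2) * (\<Sum>i<d \<nu>. (sqrt (?e i))\<^sup>2)"
    by (rule Cauchy_Schwarz_ineq_sum)
  also have "\<dots> = c \<nu> * S * E"
    using w0 e0 by (simp add: S_def E_def c sum_distrib_left mult.assoc)
  finally have "\<theta>\<^sup>2 \<le> c \<nu> * S * E" .
  moreover have "energy X d c (Suc r) \<nu> = \<theta>\<^sup>2 / c \<nu> + E" by (simp add: \<theta>_def E_def)
  moreover have "escape A d (Suc r) \<nu> = S / (1 + S)" by (simp add: S_def Let_def)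
  ultimately have "\<theta>\<^sup>2 \<le> c \<nu> * escape A d (Suc r) \<nu> * energy X d c (Suc r) \<nu>"
  proof -
    assume le: "\<theta>\<^sup>2 \<le> c \<nu> * S * E" and en: "energy X d c (Suc r) \<nu> = \<theta>\<^sup>2 / c \<nu> + E"
      and es: "escape A d (Suc r) \<nu> = S / (1 + S)"
    have "c \<nu> * (S / (1 + S)) * (\<theta>\<^sup>2 / c \<nu> + E) = (S * \<theta>\<^sup>2 + c \<nu> * S * E) / (1 + S)"
      using c0[of \<nu>] by (simp add: distrib_left add_divide_distrib)
    moreover have "\<theta>\<^sup>2 \<le> (S * \<theta>\<^sup>2 + c \<nu> * S * E) / (1 + S)"
      using le S0 by (simp add: pos_le_divide_eq algebra_simps)
    ultimately show ?thesis unfolding en es by (simp only:)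
  qed
  then show ?case by (simp only: \<theta>_def)
qed

text \<open>Descents of \<open>r\<close> generations in the tree truncated at \<open>L\<close>.
  Labels being written leaf first, \<open>xs @ \<mu>\<close> lies below
  \<open>\<mu>\<close>.\<close>

definition words :: "nat \<Rightarrow> nat \<Rightarrow> nat list set" where
  "words L r = {xs. set xs \<subseteq> {..<L} \<and> length xs = r}"

lemma finite_words: "finite (words L r)"
  unfolding words_def by (rule finite_lists_length_eq) simp

lemma words_0: "words L 0 = {[]}" by (auto simp: words_def)

lemma sum_words_Suc: "sum f (words L (Suc r)) = (\<Sum>xs\<in>words L r. \<Sum>i<L. f (i # xs))"
proof -
  have "words L (Suc r) = (\<lambda>(xs, i). i # xs) ` (words L r \<times> {..<L})"
  proof (intro set_eqI iffI)
    fix ys assume "ys \<in> words L (Suc r)"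
    then show "ys \<in> (\<lambda>(xs, i). i # xs) ` (words L r \<times> {..<L})"
      by (cases ys) (auto simp: words_def image_def)
  qed (auto simp: words_def)
  then have "sum f (words L (Suc r)) = (\<Sum>(xs, i)\<in>words L r \<times> {..<L}. f (i # xs))"
    by (simp add: sum.reindex inj_on_def case_prod_unfold)
  then show ?thesis by (simp add: sum.cartesian_product)
qed

text \<open>Splits off the letter next to the root, as the recursion of \<open>flow\<close> does,
  whereas the moment estimates split off the letter at the leaf.\<close>

lemma sum_words_Suc': "sum f (words L (Suc r)) = (\<Sum>i<L. \<Sum>xs\<in>words L r. f (xs @ [i]))"
proof (induction r arbitrary: f)
  case 0 show ?case by (simp add: sum_words_Suc words_0)
next
  case (Suc r)
  have "sum f (words L (Suc (Suc r))) = (\<Sum>xs\<in>words L (Suc r). \<Sum>j<L. f (j # xs))" by (rule sum_words_Suc)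
  also have "\<dots> = (\<Sum>i<L. \<Sum>xs\<in>words L r. \<Sum>j<L. f (j # xs @ [i]))" by (rule Suc.IH)
  also have "\<dots> = (\<Sum>i<L. \<Sum>xs\<in>words L (Suc r). f (xs @ [i]))" by (simp add: sum_words_Suc)
  finally show ?case .
qed

lemma in_tree_append_iff: "in_tree d (xs @ \<mu>) \<Longrightarrow> in_tree d \<mu>"
  by (induction xs) auto

lemma flow_eq_sum_words:
  assumes "in_tree d \<mu>" and L: "\<And>\<mu>. d \<mu> \<le> L"
  shows "flow X d r \<mu> = (\<Sum>xs\<in>words L r. if in_tree d (xs @ \<mu>) then X (xs @ \<mu>) else 0)"
  using assms(1)
proof (induction r arbitrary: \<mu>)
  case 0 then show ?case by (simp add: words_0)
next
  case (Suc r)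
  have "flow X d (Suc r) \<mu> = (\<Sum>i<d \<mu>. \<Sum>xs\<in>words L r. if in_tree d (xs @ i # \<mu>) then X (xs @ i # \<mu>) else
      0)"
    unfolding flow.simps using Suc.prems by (intro sum.cong refl Suc.IH) simp
  also have "\<dots> = (\<Sum>i<L. \<Sum>xs\<in>words L r. if in_tree d (xs @ i # \<mu>) then X (xs @ i # \<mu>) else 0)"
    using L[of \<mu>] by (intro sum.mono_neutral_left) (auto dest!: in_tree_append_iff intro!: sum.neutral)
  also have "\<dots> = (\<Sum>xs\<in>words L (Suc r). if in_tree d (xs @ \<mu>) then X (xs @ \<mu>) else 0)"
    unfolding sum_words_Suc' by (simp cong: if_cong)
  finally show ?case .
qed

section \<open>The random flow and its second moment\<close>

text \<open>The generation at which two lines of descent of equal length part.\<close>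
fun split_gen :: "nat list \<Rightarrow> nat list \<Rightarrow> nat" where
  "split_gen (i # \<mu>) (j # \<mu>') = (if \<mu> = \<mu>' then Suc (length \<mu>) else split_gen \<mu> \<mu>')"
| "split_gen _ _ = 0"

lemma split_gen_same: "split_gen \<mu> \<mu> = length \<mu>"
  by (cases \<mu>) auto

text \<open>All that the second moment argument uses of the weights. Given the past, the weight of a
  child is a function \<open>H\<close> of its value with conditional mean \<open>X \<nu>\<close>, so
  that \<open>X\<close> is a martingale along every line. Its growth is bounded through
  \<open>a\<close>, and through \<open>z\<close> that of the resistances
  \<open>1 / cond \<nu>\<close> at vertices that still have a descendant of positive weight. The
  condition \<open>a * z < b\<close> makes the energies of the generations summable.\<close>

locale flow_weight = markov_tree M p K x0 off \<Gamma>
  for M :: "'w measure" and p and K :: "real \<times> 's::polish_space \<Rightarrow> (real \<times> 's) measure"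
    and x0 off \<Gamma> +
  fixes X :: "nat list \<Rightarrow> 'w \<Rightarrow> real" and H :: "nat list \<Rightarrow> 'w \<times> (real \<times> 's) \<Rightarrow> real"
    and u a z C b :: real and L :: nat
  assumes X_Nil: "\<And>\<omega>. \<omega> \<in> space M \<Longrightarrow> X [] \<omega> = 1"
    and X_Cons: "\<And>i \<nu> \<omega>. \<omega> \<in> space M \<Longrightarrow> X (i # \<nu>) \<omega> = H \<nu> (\<omega>, env (i # \<nu>) \<omega>)"
    and X_meas: "\<And>\<nu>. X \<nu> \<in> borel_measurable (F (length \<nu>))"
    and H_meas: "\<And>\<nu>. H \<nu> \<in> borel_measurable (F (length \<nu>) \<Otimes>\<^sub>M Sigma')"
    and X_nonneg: "\<And>\<nu> \<omega>. 0 \<le> X \<nu> \<omega>" and H_nonneg: "\<And>\<nu> x. 0 \<le> H \<nu> x"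
    and H_martingale: "\<And>\<nu> \<omega>. \<omega> \<in> tree_event (\<lambda>k. k) \<nu> \<Longrightarrow> (\<integral>\<^sup>+ y. ennreal (H \<nu> (\<omega>, y)) \<partial>K (\<Gamma> \<nu> \<omega>))
        = ennreal (X \<nu> \<omega>)"
    and X_bound: "\<And>\<nu> \<omega>. \<omega> \<in> space M \<Longrightarrow> X \<nu> \<omega> \<le> u * a ^ length \<nu>"
    and X_cond: "\<And>xs \<nu> \<omega>. \<omega> \<in> space M \<Longrightarrow> 0 < X (xs @ \<nu>) \<omega> \<Longrightarrow> 1 / cond \<nu> \<omega> \<le> C * z ^ length \<nu>"
    and params: "1 \<le> u" "1 \<le> a" "1 \<le> z" "0 < C" "a * z < b"
    and b: "b = (\<Sum>i<L. measure_pmf.prob p {k. i < min k L})"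
begin

abbreviation "T \<equiv> tree_event (\<lambda>k. min k L)"
abbreviation "q \<equiv> \<lambda>i. measure_pmf.prob p {k. i < min k L}"

lemma b_pos: "0 < b" "a < b"
proof -
  have "a \<le> a * z" using mult_left_mono[of 1 z a] params by simp
  then show "a < b" using params(5) by linarith
  then show "0 < b" using params by simp
qed

lemma T_sub: "T \<nu> \<subseteq> tree_event (\<lambda>k. k) \<nu>"
proof (induction \<nu>)
  case (Cons i \<nu>)
  have "in_tree (thinned (\<lambda>k. min k L) \<omega>) (i # \<nu>) \<Longrightarrow> in_tree (thinned (\<lambda>k. k) \<omega>) (i # \<nu>)"
    if "in_tree (thinned (\<lambda>k. min k L) \<omega>) \<nu> \<Longrightarrow> in_tree (thinned (\<lambda>k. k) \<omega>) \<nu>" for \<omega>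
    using that by (auto simp: thinned_def)
  with Cons show ?case by (auto simp: tree_event_def)
qed (simp add: tree_event_def)

lemma X_meas_M[measurable]: "X \<nu> \<in> borel_measurable M"
  by (rule measurable_from_subalg[OF subalgebra_past X_meas])

lemma expectation_X:
  assumes E: "\<And>n. E \<in> sets (F n)" and sub: "E \<subseteq> tree_event (\<lambda>k. k) \<nu>"
  shows "(\<integral>\<^sup>+ \<omega>. indicator E \<omega> * ennreal (X \<nu> \<omega>) \<partial>M) = emeasure M E"
  using sub
proof (induction \<nu>)
  case Nil
  have EM: "E \<in> sets M" using E subalgebra_past by (auto simp: subalgebra_def)
  have "(\<integral>\<^sup>+ \<omega>. indicator E \<omega> * ennreal (X [] \<omega>) \<partial>M) = (\<integral>\<^sup>+ \<omega>. indicator E \<omega> \<partial>M)"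
    by (intro nn_integral_cong) (simp add: X_Nil)
  then show ?case using EM by simp
next
  case (Cons i \<nu>)
  have sub': "E \<subseteq> tree_event (\<lambda>k. k) \<nu>" using Cons.prems by (auto simp: tree_event_def)
  have "(\<integral>\<^sup>+ \<omega>. indicator E \<omega> * ennreal (X (i # \<nu>) \<omega>) \<partial>M)
      = (\<integral>\<^sup>+ \<omega>. indicator E \<omega> * ennreal (H \<nu> (\<omega>, \<Gamma> (i # \<nu>) \<omega>)) \<partial>M)"
    using Cons.prems by (intro nn_integral_cong) (auto simp: X_Cons env_eq split: split_indicator)
  also have "\<dots> = (\<integral>\<^sup>+ \<omega>. indicator E \<omega> * (\<integral>\<^sup>+ y. ennreal (H \<nu> (\<omega>, y)) \<partial>K (\<Gamma> \<nu> \<omega>)) \<partial>M)"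
    by (rule nn_integral_child[where H="\<lambda>x. ennreal (H \<nu> x)", OF E Cons.prems])
        (intro measurable_compose[OF H_meas measurable_ennreal])
  also have "\<dots> = (\<integral>\<^sup>+ \<omega>. indicator E \<omega> * ennreal (X \<nu> \<omega>) \<partial>M)"
    using sub' by (intro nn_integral_cong) (auto simp: H_martingale split: split_indicator)
  finally show ?case using Cons.IH[OF sub'] by simp
qed

text \<open>Two lines of descent are independent once they have parted, so that the martingale property
  takes the product back to the generation where they part. There the joint law is unknown, and one
  factor is bounded by its maximum.\<close>
lemma expectation_X_pair:
  assumes E: "\<And>n. E \<in> sets (F n)" and l: "length \<nu> = length \<nu>'"
    and sub: "E \<subseteq> tree_event (\<lambda>k. k) \<nu>" "E \<subseteq> tree_event (\<lambda>k. k) \<nu>'"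
  shows "(\<integral>\<^sup>+ \<omega>. indicator E \<omega> * ennreal (X \<nu> \<omega> * X \<nu>' \<omega>) \<partial>M)
      \<le> ennreal (u * a ^ split_gen \<nu> \<nu>' * prob E)"
proof -
  have EM[measurable]: "E \<in> sets M" using E subalgebra_past by (auto simp: subalgebra_def)
  have "(\<integral>\<^sup>+ \<omega>. indicator E \<omega> * ennreal (X [] \<omega> * X [] \<omega>) \<partial>M) = (\<integral>\<^sup>+ \<omega>. indicator E \<omega> \<partial>M)"
    by (intro nn_integral_cong) (simp add: X_Nil)
  also have "\<dots> \<le> ennreal (u * prob E)"
    using EM params mult_right_mono[of 1 u "prob E"] by (simp add: emeasure_eq_measure ennreal_leI)
  finally have nil: "(\<integral>\<^sup>+ \<omega>. indicator E \<omega> * ennreal (X [] \<omega> * X [] \<omega>) \<partial>M) \<le> ennreal (u * prob E)" .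
  show ?thesis
    using l sub
  proof (induction \<nu> \<nu>' rule: split_gen.induct)
    case (1 i \<mu> j \<mu>')
    show ?case
    proof (cases "\<mu> = \<mu>'")
      case True
      have "(\<integral>\<^sup>+ \<omega>. indicator E \<omega> * ennreal (X (i # \<mu>) \<omega> * X (j # \<mu>') \<omega>) \<partial>M) \<le>
         (\<integral>\<^sup>+ \<omega>. ennreal (u * a ^ Suc (length \<mu>)) * (indicator E \<omega> * ennreal (X (j # \<mu>') \<omega>)) \<partial>M)"
      proof (intro nn_integral_mono)
        fix \<omega> assume w: "\<omega> \<in> space M"
        have "ennreal (X (i # \<mu>) \<omega> * X (j # \<mu>') \<omega>) \<le> ennreal (u * a ^ Suc (length \<mu>)) * ennreal
            (X (j # \<mu>') \<omega>)"
          using X_bound[OF w, of "i # \<mu>"] X_nonneg params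
          by (subst ennreal_mult[symmetric]) (auto intro!: ennreal_leI mult_right_mono)
        then show "indicator E \<omega> * ennreal (X (i # \<mu>) \<omega> * X (j # \<mu>') \<omega>)
            \<le> ennreal (u * a ^ Suc (length \<mu>)) * (indicator E \<omega> * ennreal (X (j # \<mu>') \<omega>))"
          by (auto split: split_indicator)
      qed
      also have "\<dots> = ennreal (u * a ^ Suc (length \<mu>)) * (\<integral>\<^sup>+ \<omega>. indicator E \<omega> * ennreal (X (j # \<mu>') \<omega>)
          \<partial>M)"
        by (rule nn_integral_cmult) measurable
      also have "\<dots> = ennreal (u * a ^ Suc (length \<mu>) * prob E)"
        using params by (subst expectation_X[OF E "1.prems"(3)]) (simp add: emeasure_eq_measure
            ennreal_mult[symmetric])
      finally show ?thesis using True by simp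
    next
      case False
      have sub': "E \<subseteq> tree_event (\<lambda>k. k) \<mu>" "E \<subseteq> tree_event (\<lambda>k. k) \<mu>'"
        using "1.prems" by (auto simp: tree_event_def)
      have l: "length \<mu> = length \<mu>'" using "1.prems" by simp
      let ?H = "\<lambda>(\<omega>, y, y'). ennreal (H \<mu> (\<omega>, y)) * ennreal (H \<mu>' (\<omega>, y'))"
      let ?S = "Sigma' :: (real \<times> 's) measure"
      have "(\<integral>\<^sup>+ \<omega>. indicator E \<omega> * ennreal (X (i # \<mu>) \<omega> * X (j # \<mu>') \<omega>) \<partial>M) =
        (\<integral>\<^sup>+ \<omega>. indicator E \<omega> * ?H (\<omega>, \<Gamma> (i # \<mu>) \<omega>, \<Gamma> (j # \<mu>') \<omega>) \<partial>M)"
      proof (intro nn_integral_cong)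
        fix \<omega> assume w: "\<omega> \<in> space M"
        have e: "env (i # \<mu>) \<omega> = \<Gamma> (i # \<mu>) \<omega>" "env (j # \<mu>') \<omega> = \<Gamma> (j # \<mu>') \<omega>" if "\<omega> \<in> E"
          using that "1.prems" by (auto intro!: env_eq)
        show "indicator E \<omega> * ennreal (X (i # \<mu>) \<omega> * X (j # \<mu>') \<omega>)
            = indicator E \<omega> * ?H (\<omega>, \<Gamma> (i # \<mu>) \<omega>, \<Gamma> (j # \<mu>') \<omega>)"
          by (cases "\<omega> \<in> E") (simp_all add: X_Cons[OF w] e ennreal_mult H_nonneg)
      qed
      also have "\<dots> = (\<integral>\<^sup>+ \<omega>. indicator E \<omega> * (\<integral>\<^sup>+ y. ?H (\<omega>, y) \<partial>(K (\<Gamma> \<mu> \<omega>) \<Otimes>\<^sub>M K (\<Gamma> \<mu>' \<omega>))) \<partial>M)"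
      proof (rule nn_integral_children_pair[OF False refl l[symmetric] E "1.prems"(2,3)])
        note H_meas[measurable]
        have 1: "(\<lambda>x. (fst x, fst (snd x))) \<in> F (length \<mu>) \<Otimes>\<^sub>M (?S \<Otimes>\<^sub>M ?S) \<rightarrow>\<^sub>M F (length \<mu>) \<Otimes>\<^sub>M ?S"
          by measurable
        have 2: "(\<lambda>x. (fst x, snd (snd x))) \<in> F (length \<mu>) \<Otimes>\<^sub>M (?S \<Otimes>\<^sub>M ?S) \<rightarrow>\<^sub>M F (length \<mu>') \<Otimes>\<^sub>M ?S"
          unfolding l by measurable
        show "?H \<in> borel_measurable (F (length \<mu>) \<Otimes>\<^sub>M (?S \<Otimes>\<^sub>M ?S))"
          unfolding case_prod_unfold
          by (rule borel_measurable_times_ennreal[OF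
              measurable_compose[OF measurable_compose[OF 1 H_meas] measurable_ennreal]
              measurable_compose[OF measurable_compose[OF 2 H_meas] measurable_ennreal]])
      qed
      also have "\<dots> = (\<integral>\<^sup>+ \<omega>. indicator E \<omega> * ennreal (X \<mu> \<omega> * X \<mu>' \<omega>) \<partial>M)"
      proof (intro nn_integral_cong)
        fix \<omega> assume w: "\<omega> \<in> space M"
        show "indicator E \<omega> * (\<integral>\<^sup>+ y. ?H (\<omega>, y) \<partial>(K (\<Gamma> \<mu> \<omega>) \<Otimes>\<^sub>M K (\<Gamma> \<mu>' \<omega>)))
            = indicator E \<omega> * ennreal (X \<mu> \<omega> * X \<mu>' \<omega>)"
        proof (cases "\<omega> \<in> E")
          case True
          have pr: "prob_space (K (\<Gamma> \<nu> \<omega>))" and s: "sets (K (\<Gamma> \<nu> \<omega>)) = sets ?S" for \<nu>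
            using measurable_space[OF kernel_env w] by (auto simp: space_prob_algebra)
          have hm: "(\<lambda>y. ennreal (H \<nu> (\<omega>, y))) \<in> borel_measurable (K (\<Gamma> \<nu>' \<omega>))" for \<nu> \<nu>'
            unfolding measurable_cong_sets[OF s refl]
            by (rule measurable_compose[OF measurable_Pair1' measurable_compose[OF H_meas
                measurable_ennreal]])
               (simp add: space_past w)
          interpret B: sigma_finite_measure "K (\<Gamma> \<mu>' \<omega>)" by (rule prob_space_imp_sigma_finite[OF pr])
          have pm: "(\<lambda>y. ennreal (H \<mu> (\<omega>, fst y)) * ennreal (H \<mu>' (\<omega>, snd y))) \<in> borel_measurable
              (K (\<Gamma> \<mu> \<omega>) \<Otimes>\<^sub>M K (\<Gamma> \<mu>' \<omega>))"
            by (rule borel_measurable_times_ennreal[OF measurable_compose[OF measurable_fst hm]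
                measurable_compose[OF measurable_snd hm]])
          have "(\<integral>\<^sup>+ y. ?H (\<omega>, y) \<partial>(K (\<Gamma> \<mu> \<omega>) \<Otimes>\<^sub>M K (\<Gamma> \<mu>' \<omega>))) =
            (\<integral>\<^sup>+ y. (\<integral>\<^sup>+ y'. ennreal (H \<mu> (\<omega>, y)) * ennreal (H \<mu>' (\<omega>, y')) \<partial>K (\<Gamma> \<mu>' \<omega>)) \<partial>K (\<Gamma> \<mu> \<omega>))"
            by (subst B.nn_integral_fst[symmetric]) (simp_all add: case_prod_unfold pm)
          also have "\<dots> = ennreal (X \<mu> \<omega>) * ennreal (X \<mu>' \<omega>)"
          proof -
            have t: "\<omega> \<in> tree_event (\<lambda>k. k) \<mu>" "\<omega> \<in> tree_event (\<lambda>k. k) \<mu>'" using sub' True by auto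
            show ?thesis
              unfolding nn_integral_cmult[OF hm] nn_integral_multc[OF hm] H_martingale[OF t(1)]
                  H_martingale[OF t(2)] ..
          qed
          finally show ?thesis by (simp add: ennreal_mult X_nonneg)
        qed simp
      qed
      also have "\<dots> \<le> ennreal (u * a ^ split_gen \<mu> \<mu>' * prob E)" by (rule "1.IH"[OF False l sub'])
      finally show ?thesis using False by simp
    qed
  next
    case ("2_1" \<nu>')
    then show ?case using nil by simp
  next
    case ("2_2" \<nu>)
    then show ?case using nil by simp
  qed
qed


section \<open>Counting pairs of lines by the generation where they part\<close>

lemma sum_prob_words: "(\<Sum>xs\<in>words L r. prob (T (xs @ \<mu>))) = b ^ r * prob (T \<mu>)"
proof (induction r)
  case (Suc r)
  have "(\<Sum>xs\<in>words L (Suc r). prob (T (xs @ \<mu>))) = (\<Sum>xs\<in>words L r. \<Sum>i<L. prob (T (xs @ \<mu>)) * q i)"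
    by (simp add: sum_words_Suc prob_tree_event_Cons)
  also have "\<dots> = b * (\<Sum>xs\<in>words L r. prob (T (xs @ \<mu>)))"
    by (simp add: sum_distrib_left[symmetric] sum_distrib_right[symmetric] b mult.commute)
  finally show ?case by (simp add: Suc.IH)
qed (simp add: words_0)

text \<open>Up to the factor \<open>u\<close>, the bound that \<open>expectation_X_pair\<close>
  gives for the second moment of the flow below \<open>\<mu>\<close>.\<close>

definition pair_sum :: "nat \<Rightarrow> nat list \<Rightarrow> real" where
  "pair_sum r \<mu> = (\<Sum>xs\<in>words L r. \<Sum>ys\<in>words L r.
     a ^ split_gen (xs @ \<mu>) (ys @ \<mu>) * prob (T (xs @ \<mu>) \<inter> T (ys @ \<mu>)))"

text \<open>A pair that has already parted keeps its parting generation and has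
  \<open>b\<^sup>2\<close> pairs of children in the mean. A vertex paired with itself creates at
  most \<open>L\<^sup>2\<close> pairs, all parting at generation
  \<open>length \<mu> + Suc r\<close>.\<close>

lemma pair_sum_Suc:
  "pair_sum (Suc r) \<mu> \<le> b\<^sup>2 * pair_sum r \<mu> + (real L)\<^sup>2 * a ^ (length \<mu> + Suc r) * (b ^ r * prob (T \<mu>))"
proof -
  let ?t = "\<lambda>\<nu> \<nu>'. a ^ split_gen \<nu> \<nu>' * prob (T \<nu> \<inter> T \<nu>')"
  let ?D = "\<lambda>xs. (real L)\<^sup>2 * a ^ (length \<mu> + Suc r) * prob (T (xs @ \<mu>))"
  have a0: "0 \<le> a" using params by simp
  have step: "(\<Sum>i<L. \<Sum>j<L. ?t (i # xs @ \<mu>) (j # ys @ \<mu>)) \<le> b\<^sup>2 * ?t (xs @ \<mu>) (ys @ \<mu>) + (if ys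
      = xs then ?D xs else 0)"
    if xs: "xs \<in> words L r" and ys: "ys \<in> words L r" for xs ys
  proof (cases "xs = ys")
    case True
    have "?t (i # xs @ \<mu>) (j # ys @ \<mu>) \<le> a ^ (length \<mu> + Suc r) * prob (T (xs @ \<mu>))" for i j
    proof -
      have "prob (T (i # xs @ \<mu>) \<inter> T (j # ys @ \<mu>)) \<le> prob (T (xs @ \<mu>))"
        by (rule finite_measure_mono[OF _ tree_event_sets]) (auto simp: tree_event_def)
      moreover have "split_gen (i # xs @ \<mu>) (j # ys @ \<mu>) = length \<mu> + Suc r"
        using True xs by (simp add: words_def)
      ultimately show ?thesis using a0 by (simp add: mult_left_mono)
    qed
    then have "(\<Sum>i<L. \<Sum>j<L. ?t (i # xs @ \<mu>) (j # ys @ \<mu>))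
        \<le> (\<Sum>i<L. \<Sum>j<L. a ^ (length \<mu> + Suc r) * prob (T (xs @ \<mu>)))"
      by (intro sum_mono)
    also have "\<dots> = ?D xs" by (simp add: power2_eq_square)
    finally have "(\<Sum>i<L. \<Sum>j<L. ?t (i # xs @ \<mu>) (j # ys @ \<mu>)) \<le> ?D xs" .
    moreover have "0 \<le> b\<^sup>2 * ?t (xs @ \<mu>) (ys @ \<mu>)" using a0 by simp
    ultimately show ?thesis using True by simp
  next
    case False
    have "length (xs @ \<mu>) = length (ys @ \<mu>)" using xs ys by (simp add: words_def)
    with False have "(\<Sum>i<L. \<Sum>j<L. ?t (i # xs @ \<mu>) (j # ys @ \<mu>))
        = (\<Sum>i<L. \<Sum>j<L. ?t (xs @ \<mu>) (ys @ \<mu>) * (q i * q j))"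
      by (simp add: prob_tree_event_pair_Cons mult.assoc)
    also have "\<dots> = ?t (xs @ \<mu>) (ys @ \<mu>) * (b * b)"
      unfolding b sum_product by (simp add: sum_distrib_left)
    finally show ?thesis using False by (simp add: power2_eq_square)
  qed
  have "pair_sum (Suc r) \<mu> = (\<Sum>xs\<in>words L r. \<Sum>ys\<in>words L r. \<Sum>i<L. \<Sum>j<L. ?t (i # xs @ \<mu>) (j # ys @ \<mu>))"
    unfolding pair_sum_def sum_words_Suc append_Cons
    by (intro sum.cong refl) (rule sum.swap)
  also have "\<dots> \<le> (\<Sum>xs\<in>words L r. \<Sum>ys\<in>words L r. b\<^sup>2 * ?t (xs @ \<mu>) (ys @ \<mu>) + (if ys
      = xs then ?D xs else 0))"
    by (intro sum_mono step)
  also have "\<dots> = b\<^sup>2 * pair_sum r \<mu> + (\<Sum>xs\<in>words L r. ?D xs)"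
    by (simp add: sum.distrib sum_distrib_left pair_sum_def finite_words)
  also have "(\<Sum>xs\<in>words L r. ?D xs) = (real L)\<^sup>2 * a ^ (length \<mu> + Suc r) * (b ^ r * prob (T \<mu>))"
    by (simp only: sum_distrib_left[symmetric] sum_prob_words)
  finally show ?thesis .
qed

definition "pair_const = 1 + (real L)\<^sup>2 * a / b\<^sup>2 / (1 - a / b)"

text \<open>Divided by \<open>b ^ (2 * r)\<close>, the recursion sums a geometric series with ratio
  \<open>a / b < 1\<close> and first term \<open>k\<close>.\<close>

lemma pair_sum_le: "pair_sum r \<mu> \<le> prob (T \<mu>) * a ^ length \<mu> * b ^ (2 * r) * pair_const"
proof -
  define k where "k = (real L)\<^sup>2 * a / b\<^sup>2"
  have k0: "0 \<le> k" using params by (simp add: k_def)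
  have "pair_sum r \<mu> \<le> prob (T \<mu>) * a ^ length \<mu> * b ^ (2 * r) * (1 + k * (\<Sum>j<r. (a / b) ^ j))"
  proof (induction r)
    case 0 show ?case by (simp add: pair_sum_def words_0 split_gen_same mult.commute)
  next
    case (Suc r)
    have "pair_sum (Suc r) \<mu> \<le> b\<^sup>2 * pair_sum r \<mu> + (real L)\<^sup>2 * a ^ (length \<mu> + Suc r)
        * (b ^ r * prob (T \<mu>))"
      by (rule pair_sum_Suc)
    also have "\<dots> \<le> b\<^sup>2 * (prob (T \<mu>) * a ^ length \<mu> * b ^ (2 * r) * (1 + k * (\<Sum>j<r. (a / b) ^ j)))
        + (real L)\<^sup>2 * a ^ (length \<mu> + Suc r) * (b ^ r * prob (T \<mu>))"
      by (intro add_right_mono mult_left_mono Suc.IH) simp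
    also have "(real L)\<^sup>2 * a ^ (length \<mu> + Suc r) * (b ^ r * prob (T \<mu>))
        = prob (T \<mu>) * a ^ length \<mu> * b ^ (2 * Suc r) * (k * (a / b) ^ r)"
    proof -
      have e: "b ^ (2 * Suc r) = b ^ r * b ^ r * b\<^sup>2" by (simp add: mult_2 power_add power2_eq_square)
      show ?thesis unfolding e using b_pos by (simp add: k_def power_add power_divide field_simps)
    qed
    also have "b\<^sup>2 * (prob (T \<mu>) * a ^ length \<mu> * b ^ (2 * r) * (1 + k * (\<Sum>j<r. (a / b) ^ j))) + \<dots>
       = prob (T \<mu>) * a ^ length \<mu> * b ^ (2 * Suc r) * (1 + k * (\<Sum>j<Suc r. (a / b) ^ j))"
      by (simp add: algebra_simps power2_eq_square)
    finally show ?case .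
  qed
  also have "\<dots> \<le> prob (T \<mu>) * a ^ length \<mu> * b ^ (2 * r) * pair_const"
  proof -
    have "(\<Sum>j<r. (a / b) ^ j) \<le> (\<Sum>j. (a / b) ^ j)"
      using params b_pos by (intro sum_le_suminf summable_geometric) auto
    also have "\<dots> = 1 / (1 - a / b)" using params b_pos by (intro suminf_geometric) auto
    finally have "1 + k * (\<Sum>j<r. (a / b) ^ j) \<le> 1 + k * (1 / (1 - a / b))"
      by (intro add_left_mono mult_left_mono k0)
    then have "1 + k * (\<Sum>j<r. (a / b) ^ j) \<le> pair_const" by (simp add: pair_const_def k_def)
    then show ?thesis using params b_pos by (intro mult_left_mono) auto
  qed
  finally show ?thesis .
qed

section \<open>Flow, energy and escape on the truncated tree\<close>

abbreviation "dL \<equiv> thinned (\<lambda>k. min k L)"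

definition \<Theta> :: "nat \<Rightarrow> nat list \<Rightarrow> 'w \<Rightarrow> real" where
  "\<Theta> r \<mu> \<omega> = flow (\<lambda>\<nu>. X \<nu> \<omega>) (dL \<omega>) r \<mu>"

text \<open>\<open>escape\<close> uses the weights from \<open>\<Gamma>\<close> at all labels, so
  Thomson's principle needs conductances built from the same weights. On \<open>T \<nu>\<close> they
  agree with \<open>cond\<close>.\<close>

definition cnd :: "nat list \<Rightarrow> 'w \<Rightarrow> real" where
  "cnd \<nu> \<omega> = conductance (\<lambda>\<nu>. fst (\<Gamma> \<nu> \<omega>)) \<nu>"

definition En :: "nat \<Rightarrow> nat list \<Rightarrow> 'w \<Rightarrow> real" where
  "En r \<mu> \<omega> = energy (\<lambda>\<nu>. X \<nu> \<omega>) (dL \<omega>) (\<lambda>\<nu>. cnd \<nu> \<omega>) r \<mu>"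

definition esc :: "nat \<Rightarrow> nat list \<Rightarrow> 'w \<Rightarrow> real" where
  "esc r \<mu> \<omega> = escape (\<lambda>\<nu>. fst (\<Gamma> \<nu> \<omega>)) (dL \<omega>) r \<mu>"

lemma A_pos: "\<omega> \<in> space M \<Longrightarrow> 0 < fst (\<Gamma> \<nu> \<omega>)"
  using measurable_space[OF env_measurable, of \<omega> \<nu>]
  by (auto simp: Sigma'_def space_restrict_space mem_Times_iff)

lemma cnd_pos: "\<omega> \<in> space M \<Longrightarrow> 0 < cnd \<nu> \<omega>"
  unfolding cnd_def by (rule conductance_pos) (rule A_pos)

lemma cnd_eq: "\<omega> \<in> T \<nu> \<Longrightarrow> cnd \<nu> \<omega> = cond \<nu> \<omega>"
  using T_sub[of \<nu>] by (auto simp: cnd_def cond_eq tree_event_def off_in_tree)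

lemma sum_thinned: "(\<Sum>i<dL \<omega> \<mu>. f i) = (\<Sum>i<L. if i < min (off \<mu> \<omega>) L then f i else 0)"
  by (rule sum.mono_neutral_cong_left) (auto simp: thinned_def)

lemma A_meas[measurable]: "(\<lambda>\<omega>. fst (\<Gamma> \<nu> \<omega>)) \<in> borel_measurable M"
  by (rule measurable_compose[OF env_measurable fst_Sigma'])

lemma cnd_meas[measurable]: "cnd \<nu> \<in> borel_measurable M"
  unfolding cnd_def by (induction \<nu>) auto

lemma \<Theta>_meas[measurable]: "\<Theta> r \<mu> \<in> borel_measurable M"
  unfolding \<Theta>_def
proof (induction r arbitrary: \<mu>)
  case (Suc r)
  note Suc[measurable]
  show ?case unfolding flow.simps sum_thinned by measurable
qed simp

lemma En_meas[measurable]: "En r \<mu> \<in> borel_measurable M"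
  unfolding En_def
proof (induction r arbitrary: \<mu>)
  case 0
  show ?case unfolding energy.simps \<Theta>_def[symmetric] by measurable
next
  case (Suc r)
  note Suc[measurable]
  show ?case unfolding energy.simps sum_thinned \<Theta>_def[symmetric] by measurable
qed

lemma esc_meas[measurable]: "esc r \<mu> \<in> borel_measurable M"
  unfolding esc_def
proof (induction r arbitrary: \<mu>)
  case (Suc r)
  note Suc[measurable]
  show ?case unfolding escape.simps Let_def sum_thinned by measurable
qed simp

lemma En_nonneg: "\<omega> \<in> space M \<Longrightarrow> 0 \<le> En r \<mu> \<omega>"
  unfolding En_def by (rule energy_nonneg) (rule cnd_pos)

lemma \<Theta>_eq:
  assumes "\<omega> \<in> T \<mu>"
  shows "\<Theta> r \<mu> \<omega> = (\<Sum>xs\<in>words L r. indicator (T (xs @ \<mu>)) \<omega> * X (xs @ \<mu>) \<omega>)"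
proof -
  have "\<Theta> r \<mu> \<omega> = (\<Sum>xs\<in>words L r. if in_tree (dL \<omega>) (xs @ \<mu>) then X (xs @ \<mu>) \<omega> else 0)"
    unfolding \<Theta>_def using assms by (intro flow_eq_sum_words) (auto simp: tree_event_def thinned_def)
  then show ?thesis using assms by (auto simp: tree_event_def intro!: sum.cong split: split_indicator)
qed

lemma expectation_\<Theta>_square:
  "(\<integral>\<^sup>+ \<omega>. indicator (T \<mu>) \<omega> * ennreal ((\<Theta> r \<mu> \<omega>)\<^sup>2) \<partial>M) \<le> ennreal (u * pair_sum r \<mu>)"
proof -
  let ?TT = "\<lambda>xs ys. T (xs @ \<mu>) \<inter> T (ys @ \<mu>)"
  have "(\<integral>\<^sup>+ \<omega>. indicator (T \<mu>) \<omega> * ennreal ((\<Theta> r \<mu> \<omega>)\<^sup>2) \<partial>M) \<le>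
    (\<integral>\<^sup>+ \<omega>. (\<Sum>xs\<in>words L r. \<Sum>ys\<in>words L r. indicator (?TT xs ys) \<omega> * ennreal (X (xs @ \<mu>) \<omega> * X (ys @ \<mu>)
        \<omega>)) \<partial>M)"
  proof (intro nn_integral_mono)
    fix \<omega>
    show "indicator (T \<mu>) \<omega> * ennreal ((\<Theta> r \<mu> \<omega>)\<^sup>2)
        \<le> (\<Sum>xs\<in>words L r. \<Sum>ys\<in>words L r. indicator (?TT xs ys) \<omega> * ennreal (X (xs @ \<mu>) \<omega> * X (ys @ \<mu>)
        \<omega>))"
    proof (cases "\<omega> \<in> T \<mu>")
      case True
      have "(\<Theta> r \<mu> \<omega>)\<^sup>2 = (\<Sum>xs\<in>words L r. \<Sum>ys\<in>words L r. indicator (?TT xs ys) \<omega>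
          * (X (xs @ \<mu>) \<omega> * X (ys @ \<mu>) \<omega>))"
        unfolding \<Theta>_eq[OF True] power2_eq_square sum_product
        by (simp add: indicator_inter_arith mult_ac)
      then have "ennreal ((\<Theta> r \<mu> \<omega>)\<^sup>2)
          = (\<Sum>xs\<in>words L r. \<Sum>ys\<in>words L r. ennreal (indicator (?TT xs ys) \<omega> * (X (xs @ \<mu>) \<omega> * X (ys @ \<mu>)
          \<omega>)))"
        by (simp add: sum_ennreal sum_nonneg X_nonneg)
      also have "\<dots> = (\<Sum>xs\<in>words L r. \<Sum>ys\<in>words L r. indicator (?TT xs ys) \<omega> * ennreal
          (X (xs @ \<mu>) \<omega> * X (ys @ \<mu>) \<omega>))"
        by (intro sum.cong refl) (auto split: split_indicator)
      finally show ?thesis using True by simp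
    qed simp
  qed
  also have "\<dots> = (\<Sum>xs\<in>words L r. \<Sum>ys\<in>words L r. \<integral>\<^sup>+ \<omega>. indicator (?TT xs ys) \<omega> * ennreal
      (X (xs @ \<mu>) \<omega> * X (ys @ \<mu>) \<omega>) \<partial>M)"
    by (simp add: nn_integral_sum)
  also have "\<dots> \<le> (\<Sum>xs\<in>words L r. \<Sum>ys\<in>words L r. ennreal (u * a ^ split_gen (xs @ \<mu>) (ys @ \<mu>)
      * prob (?TT xs ys)))"
    using T_sub by (intro sum_mono expectation_X_pair) (auto simp: words_def
        intro!: sets.Int tree_event_past)
  also have "\<dots> = ennreal (\<Sum>xs\<in>words L r. \<Sum>ys\<in>words L r. u * a ^ split_gen (xs @ \<mu>) (ys @ \<mu>)
      * prob (?TT xs ys))"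
    using params by (simp add: sum_ennreal sum_nonneg)
  also have "\<dots> = ennreal (u * pair_sum r \<mu>)"
    unfolding pair_sum_def sum_distrib_left by (simp add: mult.assoc)
  finally show ?thesis .
qed

definition "energy_const = C * u * pair_const / (1 - a * z / b)"

lemma pair_const_pos: "0 < pair_const"
proof -
  have "0 \<le> (real L)\<^sup>2 * a / b\<^sup>2 / (1 - a / b)"
    using params b_pos by (intro divide_nonneg_nonneg mult_nonneg_nonneg) auto
  then show ?thesis unfolding pair_const_def by linarith
qed

lemma energy_const_pos: "0 < energy_const"
  using params b_pos pair_const_pos by (auto simp: energy_const_def intro!: divide_pos_pos mult_pos_pos)

lemma expectation_\<Theta>_square_div:
  "(\<integral>\<^sup>+ \<omega>. indicator (T \<mu>) \<omega> * ennreal ((\<Theta> r \<mu> \<omega>)\<^sup>2 / cnd \<mu> \<omega>) \<partial>M) \<le>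
    ennreal (prob (T \<mu>) * (C * u * pair_const) * (a * z) ^ length \<mu> * b ^ (2 * r))"
proof -
  have "(\<integral>\<^sup>+ \<omega>. indicator (T \<mu>) \<omega> * ennreal ((\<Theta> r \<mu> \<omega>)\<^sup>2 / cnd \<mu> \<omega>) \<partial>M) \<le>
    (\<integral>\<^sup>+ \<omega>. ennreal (C * z ^ length \<mu>) * (indicator (T \<mu>) \<omega> * ennreal ((\<Theta> r \<mu> \<omega>)\<^sup>2)) \<partial>M)"
  proof (intro nn_integral_mono)
    fix \<omega> assume w: "\<omega> \<in> space M"
    have "(\<Theta> r \<mu> \<omega>)\<^sup>2 / cnd \<mu> \<omega> \<le> C * z ^ length \<mu> * (\<Theta> r \<mu> \<omega>)\<^sup>2" if t: "\<omega> \<in> T \<mu>"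
    proof (cases "1 / cnd \<mu> \<omega> \<le> C * z ^ length \<mu>")
      case True
      then have "1 / cnd \<mu> \<omega> * (\<Theta> r \<mu> \<omega>)\<^sup>2 \<le> C * z ^ length \<mu> * (\<Theta> r \<mu> \<omega>)\<^sup>2"
        by (intro mult_right_mono) auto
      then show ?thesis by simp
    next
      \<comment> \<open>If the resistance bound fails at \<open>\<mu>\<close>, then by
        \<open>X_cond\<close> no descendant carries any weight and the flow through
        \<open>\<mu>\<close> vanishes.\<close>
      case False
      then have "X (xs @ \<mu>) \<omega> = 0" for xs
        using X_cond[OF w, of xs \<mu>] X_nonneg[of "xs @ \<mu>" \<omega>] cnd_eq[OF t]
        by (cases "X (xs @ \<mu>) \<omega> = 0") auto
      then show ?thesis by (simp add: \<Theta>_eq[OF t])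
    qed
    then show "indicator (T \<mu>) \<omega> * ennreal ((\<Theta> r \<mu> \<omega>)\<^sup>2 / cnd \<mu> \<omega>) \<le> ennreal (C * z ^ length \<mu>)
        * (indicator (T \<mu>) \<omega> * ennreal ((\<Theta> r \<mu> \<omega>)\<^sup>2))"
      using params by (auto simp: ennreal_mult[symmetric] ennreal_leI split: split_indicator)
  qed
  also have "\<dots> = ennreal (C * z ^ length \<mu>) * (\<integral>\<^sup>+ \<omega>. indicator (T \<mu>) \<omega> * ennreal ((\<Theta> r \<mu> \<omega>)\<^sup>2) \<partial>M)"
    by (rule nn_integral_cmult) measurable
  also have "\<dots> \<le> ennreal (C * z ^ length \<mu>) * ennreal (u * pair_sum r \<mu>)"
    by (intro mult_left_mono expectation_\<Theta>_square) simp
  also have "\<dots> \<le> ennreal (C * z ^ length \<mu>) * ennreal (u * (prob (T \<mu>) * a ^ length \<mu> * b ^ (2 * r)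
      * pair_const))"
    using params by (intro mult_left_mono ennreal_leI pair_sum_le) auto
  also have "\<dots> = ennreal (prob (T \<mu>) * (C * u * pair_const) * (a * z) ^ length \<mu> * b ^ (2 * r))"
    using params b_pos pair_const_pos
    by (subst ennreal_mult[symmetric]) (auto simp: power_mult_distrib mult_ac)
  finally show ?thesis .
qed

text \<open>A vertex of generation \<open>k\<close> contributes at most
  \<open>(a * z) ^ k * b ^ (2 * (r - k))\<close> up to constants, and there are \<open>b ^ k\<close>
  of them in the mean, so the generations form a geometric series of ratio \<open>a * z / b\<close>.
  Its sum \<open>energy_const\<close> is the fixed point that lets the induction close with the same
  constant.\<close>

lemma expectation_En:
  "(\<integral>\<^sup>+ \<omega>. indicator (T \<mu>) \<omega> * ennreal (En r \<mu> \<omega>) \<partial>M) \<le>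
    ennreal (prob (T \<mu>) * energy_const * (a * z) ^ length \<mu> * b ^ (2 * r))"
proof (induction r arbitrary: \<mu>)
  let ?c = "C * u * pair_const"
  have w: "0 < 1 - a * z / b" "1 - a * z / b \<le> 1" using params b_pos by auto
  have c0: "0 < ?c" using params pair_const_pos by simp
  have e: "energy_const = ?c / (1 - a * z / b)" by (simp add: energy_const_def)
  {
    case 0
    have "(\<integral>\<^sup>+ \<omega>. indicator (T \<mu>) \<omega> * ennreal (En 0 \<mu> \<omega>) \<partial>M)
        \<le> ennreal (prob (T \<mu>) * ?c * (a * z) ^ length \<mu> * b ^ (2 * 0))"
      using expectation_\<Theta>_square_div[of \<mu> 0] by (simp add: En_def \<Theta>_def)
    also have "\<dots> \<le> ennreal (prob (T \<mu>) * energy_const * (a * z) ^ length \<mu> * b ^ (2 * 0))"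
    proof -
      have "?c * (1 - a * z / b) \<le> ?c * 1" using w c0 by (intro mult_left_mono) auto
      then have "?c \<le> energy_const" unfolding e using w by (simp add: pos_le_divide_eq)
      then show ?thesis using params b_pos by (intro ennreal_leI mult_right_mono mult_left_mono) auto
    qed
    finally show ?case .
  next
    case (Suc r)
    let ?k = "length \<mu>"
    have "(\<integral>\<^sup>+ \<omega>. indicator (T \<mu>) \<omega> * ennreal (En (Suc r) \<mu> \<omega>) \<partial>M) =
      (\<integral>\<^sup>+ \<omega>. indicator (T \<mu>) \<omega> * ennreal ((\<Theta> (Suc r) \<mu> \<omega>)\<^sup>2 / cnd \<mu> \<omega>) + (\<Sum>i<L. indicator (T (i # \<mu>)) \<omega>
          * ennreal (En r (i # \<mu>) \<omega>)) \<partial>M)"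
    proof (intro nn_integral_cong)
      fix \<omega> assume w: "\<omega> \<in> space M"
      show "indicator (T \<mu>) \<omega> * ennreal (En (Suc r) \<mu> \<omega>)
          = indicator (T \<mu>) \<omega> * ennreal ((\<Theta> (Suc r) \<mu> \<omega>)\<^sup>2 / cnd \<mu> \<omega>) + (\<Sum>i<L. indicator (T (i # \<mu>)) \<omega> *
          ennreal (En r (i # \<mu>) \<omega>))"
      proof (cases "\<omega> \<in> T \<mu>")
        case True
        have "En (Suc r) \<mu> \<omega> = (\<Theta> (Suc r) \<mu> \<omega>)\<^sup>2 / cnd \<mu> \<omega> + (\<Sum>i<L. if i
            < min (off \<mu> \<omega>) L then En r (i # \<mu>) \<omega> else 0)"
          unfolding En_def energy.simps(2) sum_thinned \<Theta>_def ..
        then have "ennreal (En (Suc r) \<mu> \<omega>) = ennreal ((\<Theta> (Suc r) \<mu> \<omega>)\<^sup>2 / cnd \<mu> \<omega>)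
            + (\<Sum>i<L. ennreal (if i < min (off \<mu> \<omega>) L then En r (i # \<mu>) \<omega> else 0))"
          using En_nonneg[OF w] cnd_pos[OF w]
          by (subst sum_ennreal) (auto simp: ennreal_plus[symmetric] sum_nonneg less_imp_le simp
          del: ennreal_plus)
        also have "(\<Sum>i<L. ennreal (if i < min (off \<mu> \<omega>) L then En r (i # \<mu>) \<omega> else 0))
            = (\<Sum>i<L. indicator (T (i # \<mu>)) \<omega> * ennreal (En r (i # \<mu>) \<omega>))"
          using True by (intro sum.cong) (auto simp: tree_event_def thinned_def split: split_indicator)
        finally show ?thesis using True by simp
      next
        case False
        then have "\<omega> \<notin> T (i # \<mu>)" for i by (auto simp: tree_event_def)
        with False show ?thesis by simp
      qed
    qed
    also have "\<dots> = (\<integral>\<^sup>+ \<omega>. indicator (T \<mu>) \<omega> * ennreal ((\<Theta> (Suc r) \<mu> \<omega>)\<^sup>2 / cnd \<mu> \<omega>) \<partial>M)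
        + (\<Sum>i<L. \<integral>\<^sup>+ \<omega>. indicator (T (i # \<mu>)) \<omega> * ennreal (En r (i # \<mu>) \<omega>) \<partial>M)"
    proof -
      have "(\<integral>\<^sup>+ \<omega>. (\<Sum>i<L. indicator (T (i # \<mu>)) \<omega> * ennreal (En r (i # \<mu>) \<omega>)) \<partial>M)
          = (\<Sum>i<L. \<integral>\<^sup>+ \<omega>. indicator (T (i # \<mu>)) \<omega> * ennreal (En r (i # \<mu>) \<omega>) \<partial>M)"
        by (rule nn_integral_sum) measurable
      moreover have "(\<integral>\<^sup>+ \<omega>. indicator (T \<mu>) \<omega> * ennreal ((\<Theta> (Suc r) \<mu> \<omega>)\<^sup>2 / cnd \<mu> \<omega>)
          + (\<Sum>i<L. indicator (T (i # \<mu>)) \<omega> * ennreal (En r (i # \<mu>) \<omega>)) \<partial>M)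
         = (\<integral>\<^sup>+ \<omega>. indicator (T \<mu>) \<omega> * ennreal ((\<Theta> (Suc r) \<mu> \<omega>)\<^sup>2 / cnd \<mu> \<omega>) \<partial>M) +
             (\<integral>\<^sup>+ \<omega>. (\<Sum>i<L. indicator (T (i # \<mu>)) \<omega> * ennreal (En r (i # \<mu>) \<omega>)) \<partial>M)"
        by (rule nn_integral_add) measurable
      ultimately show ?thesis by (simp only:)
    qed
    also have "\<dots> \<le> ennreal (prob (T \<mu>) * ?c * (a * z) ^ ?k * b ^ (2 * Suc r))
        + (\<Sum>i<L. ennreal (prob (T (i # \<mu>)) * energy_const * (a * z) ^ length (i # \<mu>) * b ^ (2 * r)))"
      by (intro add_mono sum_mono Suc.IH expectation_\<Theta>_square_div)
    also have "\<dots> = ennreal (prob (T \<mu>) * ?c * (a * z) ^ ?k * b ^ (2 * Suc r) + (\<Sum>i<L. prob (T (i # \<mu>))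
        * energy_const * (a * z) ^ length (i # \<mu>) * b ^ (2 * r)))"
      using params b_pos c0 energy_const_pos
      by (subst sum_ennreal) (auto simp: ennreal_plus[symmetric] sum_nonneg simp del: ennreal_plus)
    also have "(\<Sum>i<L. prob (T (i # \<mu>)) * energy_const * (a * z) ^ length (i # \<mu>) * b ^ (2 * r))
        = prob (T \<mu>) * (\<Sum>i<L. q i) * energy_const * (a * z) ^ Suc ?k * b ^ (2 * r)"
      by (simp add: prob_tree_event_Cons sum_distrib_left sum_distrib_right mult_ac)
    also have "prob (T \<mu>) * ?c * (a * z) ^ ?k * b ^ (2 * Suc r) + \<dots>
        = prob (T \<mu>) * energy_const * (a * z) ^ length \<mu> * b ^ (2 * Suc r)"
    proof -
      have "?c * b + energy_const * (a * z) = energy_const * b"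
        unfolding e using w b_pos by (simp add: field_simps)
      then have "prob (T \<mu>) * (a * z) ^ ?k * b ^ (2 * r) * b * (?c * b + energy_const * (a * z))
          = prob (T \<mu>) * (a * z) ^ ?k * b ^ (2 * r) * b * (energy_const * b)"
        by (rule arg_cong)
      then show ?thesis unfolding b[symmetric] by (simp add: algebra_simps)
    qed
    finally show ?case .
  }
qed

lemma expectation_\<Theta>: "(\<integral>\<^sup>+ \<omega>. ennreal (\<Theta> r [] \<omega>) \<partial>M) = ennreal (b ^ r)"
proof -
  have T0: "\<omega> \<in> T []" if "\<omega> \<in> space M" for \<omega> using that by (simp add: tree_event_def)
  have "(\<integral>\<^sup>+ \<omega>. ennreal (\<Theta> r [] \<omega>) \<partial>M) = (\<integral>\<^sup>+ \<omega>. (\<Sum>xs\<in>words L r. indicator (T xs) \<omega> * ennreal (X xs \<omega>))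
      \<partial>M)"
  proof (intro nn_integral_cong)
    fix \<omega> assume w: "\<omega> \<in> space M"
    have "ennreal (\<Theta> r [] \<omega>) = (\<Sum>xs\<in>words L r. ennreal (indicator (T xs) \<omega> * X xs \<omega>))"
      unfolding \<Theta>_eq[OF T0[OF w]] by (subst sum_ennreal) (auto simp: X_nonneg)
    also have "\<dots> = (\<Sum>xs\<in>words L r. indicator (T xs) \<omega> * ennreal (X xs \<omega>))"
      by (intro sum.cong) (auto split: split_indicator)
    finally show "ennreal (\<Theta> r [] \<omega>) = (\<Sum>xs\<in>words L r. indicator (T xs) \<omega> * ennreal (X xs \<omega>))" .
  qed
  also have "\<dots> = (\<Sum>xs\<in>words L r. \<integral>\<^sup>+ \<omega>. indicator (T xs) \<omega> * ennreal (X xs \<omega>) \<partial>M)"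
    by (rule nn_integral_sum) measurable
  also have "\<dots> = (\<Sum>xs\<in>words L r. ennreal (prob (T xs)))"
    by (simp add: expectation_X[OF tree_event_past T_sub] emeasure_eq_measure)
  also have "\<dots> = ennreal (b ^ r)"
    using sum_prob_words[where r=r and \<mu>="[]"] by (simp add: sum_ennreal tree_event_def prob_space)
  finally show ?thesis .
qed

lemma expectation_esc: "ennreal (1 / energy_const) \<le> (\<integral>\<^sup>+ \<omega>. ennreal (esc r [] \<omega>) \<partial>M)"
proof -
  \<comment> \<open>The product of escape probability and energy in Thomson's principle is split by
    the arithmetic-geometric mean inequality with parameter \<open>t\<close>. For this
    \<open>t\<close> the energy takes exactly half of the mean strength \<open>b ^ r\<close>, and
    the other half is left to the escape probability.\<close>
  define t where "t = energy_const * b ^ r"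
  have t: "0 < t" using energy_const_pos b_pos by (simp add: t_def)
  have esc01: "0 \<le> esc r [] \<omega>" "esc r [] \<omega> \<le> 1" if "\<omega> \<in> space M" for \<omega>
    unfolding esc_def using escape_bounds[of "\<lambda>\<nu>. fst (\<Gamma> \<nu> \<omega>)"] A_pos[OF that] by auto
  have le: "\<Theta> r [] \<omega> \<le> t / 2 * esc r [] \<omega> + 1 / (2 * t) * En r [] \<omega>" if w: "\<omega> \<in> space M" for \<omega>
  proof -
    let ?\<beta> = "esc r [] \<omega>" and ?e = "En r [] \<omega>"
    have "(\<Theta> r [] \<omega>)\<^sup>2 \<le> cnd [] \<omega> * ?\<beta> * ?e"
      unfolding \<Theta>_def esc_def En_def
      by (rule flow_square_le_energy) (auto simp: A_pos[OF w] cnd_pos[OF w], simp add: cnd_def)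
    then have "(\<Theta> r [] \<omega>)\<^sup>2 \<le> ?\<beta> * ?e" by (simp add: cnd_def)
    also have "\<dots> \<le> (t / 2 * ?\<beta> + 1 / (2 * t) * ?e)\<^sup>2"
    proof -
      have "(t / 2 * ?\<beta> + 1 / (2 * t) * ?e)\<^sup>2 - ?\<beta> * ?e = (t / 2 * ?\<beta> - 1 / (2 * t) * ?e)\<^sup>2"
        using t by (simp add: power2_eq_square field_simps)
      then show ?thesis using zero_le_power2[of "t / 2 * ?\<beta> - 1 / (2 * t) * ?e"] by linarith
    qed
    finally show ?thesis
      by (rule power2_le_imp_le) (use t esc01[OF w] En_nonneg[OF w] in auto)
  qed
  define B where "B = enn2real (\<integral>\<^sup>+ \<omega>. ennreal (esc r [] \<omega>) \<partial>M)"
  have "(\<integral>\<^sup>+ \<omega>. ennreal (esc r [] \<omega>) \<partial>M) \<le> (\<integral>\<^sup>+ \<omega>. 1 \<partial>M)"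
    by (intro nn_integral_mono) (simp add: esc01)
  then have "(\<integral>\<^sup>+ \<omega>. ennreal (esc r [] \<omega>) \<partial>M) \<noteq> \<top>" by (auto simp: emeasure_space_1 top_unique)
  then have B: "(\<integral>\<^sup>+ \<omega>. ennreal (esc r [] \<omega>) \<partial>M) = ennreal B" by (simp add: B_def top.not_eq_extremum)
  have B0: "0 \<le> B" by (simp add: B_def)
  have "(\<integral>\<^sup>+ \<omega>. ennreal (En r [] \<omega>) \<partial>M) = (\<integral>\<^sup>+ \<omega>. indicator (T []) \<omega> * ennreal (En r [] \<omega>) \<partial>M)"
    by (intro nn_integral_cong) (simp add: tree_event_def)
  then have e: "(\<integral>\<^sup>+ \<omega>. ennreal (En r [] \<omega>) \<partial>M) \<le> ennreal (energy_const * b ^ (2 * r))"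
    using expectation_En[of "[]" r] by (simp add: tree_event_def prob_space)
  have "ennreal (b ^ r) \<le> (\<integral>\<^sup>+ \<omega>. ennreal (t / 2) * ennreal (esc r [] \<omega>) + ennreal (1 / (2 * t))
      * ennreal (En r [] \<omega>) \<partial>M)"
    unfolding expectation_\<Theta>[symmetric]
  proof (intro nn_integral_mono)
    fix \<omega> assume w: "\<omega> \<in> space M"
    have "ennreal (\<Theta> r [] \<omega>) \<le> ennreal (t / 2 * esc r [] \<omega> + 1 / (2 * t) * En r [] \<omega>)"
      by (rule ennreal_leI[OF le[OF w]])
    then show "ennreal (\<Theta> r [] \<omega>) \<le> ennreal (t / 2) * ennreal (esc r [] \<omega>) + ennreal (1 / (2 * t))
        * ennreal (En r [] \<omega>)"
      using t esc01[OF w] En_nonneg[OF w] by (simp add: ennreal_plus ennreal_mult[symmetric])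
  qed
  also have "\<dots> = ennreal (t / 2) * ennreal B + ennreal (1 / (2 * t)) * (\<integral>\<^sup>+ \<omega>. ennreal (En r [] \<omega>) \<partial>M)"
    unfolding B[symmetric] by (subst nn_integral_add) (auto simp: nn_integral_cmult)
  also have "\<dots> \<le> ennreal (t / 2) * ennreal B + ennreal (1 / (2 * t)) * ennreal
      (energy_const * b ^ (2 * r))"
    by (intro add_left_mono mult_left_mono e) simp
  also have "\<dots> = ennreal (t / 2 * B + 1 / (2 * t) * (energy_const * b ^ (2 * r)))"
    using t B0 energy_const_pos b_pos by (subst ennreal_plus) (auto simp: ennreal_mult[symmetric])
  finally have "b ^ r \<le> t / 2 * B + 1 / (2 * t) * (energy_const * b ^ (2 * r))"
    using t B0 energy_const_pos b_pos by (subst (asm) ennreal_le_iff) auto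
  also have "1 / (2 * t) * (energy_const * b ^ (2 * r)) = b ^ r / 2"
  proof -
    have "b ^ (2 * r) = b ^ r * b ^ r" by (simp add: mult_2 power_add)
    then show ?thesis using energy_const_pos b_pos by (simp add: t_def)
  qed
  finally have "b ^ r \<le> t * B" by linarith
  then have "b ^ r * 1 \<le> b ^ r * (energy_const * B)" by (simp add: t_def mult_ac)
  then have "1 \<le> energy_const * B" using b_pos by (subst (asm) mult_le_cancel_left_pos) auto
  then show ?thesis unfolding B using energy_const_pos by (intro ennreal_leI) (simp add: field_simps)
qed

text \<open>The lower bound on the mean escape probability does not depend on \<open>r\<close>. The
  escape probabilities decrease in \<open>r\<close>, and their limit solves the escape equation of
  the truncated tree, hence is a subsolution for the walk on the full tree.\<close>

lemma transient: "transient M off \<Gamma>"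
proof -
  define e where "e \<mu> \<omega> = lim (\<lambda>r. esc r \<mu> \<omega>)" for \<mu> \<omega>
  have conv: "(\<lambda>r. esc r \<mu> \<omega>) \<longlonglongrightarrow> e \<mu> \<omega>" and e0: "0 \<le> e \<mu> \<omega>" and e1: "e \<mu> \<omega> \<le> esc r \<mu> \<omega>"
    and dec: "decseq (\<lambda>r. esc r \<mu> \<omega>)" if w: "\<omega> \<in> space M" for \<mu> \<omega> r
  proof -
    have b: "0 \<le> esc r \<mu> \<omega>" for r unfolding esc_def by (rule escape_bounds(1)) (rule A_pos[OF w])
    show dec: "decseq (\<lambda>r. esc r \<mu> \<omega>)"
      unfolding esc_def by (intro decseq_SucI escape_decreasing A_pos[OF w])
    have "convergent (\<lambda>r. esc r \<mu> \<omega>)"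
    proof -
      have "\<forall>i. 0 \<le> esc i \<mu> \<omega>" using b by simp
      then obtain l where "(\<lambda>r. esc r \<mu> \<omega>) \<longlonglongrightarrow> l" by (rule decseq_convergent[OF dec])
      then show ?thesis by (rule convergentI)
    qed
    then show c: "(\<lambda>r. esc r \<mu> \<omega>) \<longlonglongrightarrow> e \<mu> \<omega>" unfolding e_def by (simp add: convergent_LIMSEQ_iff)
    show "0 \<le> e \<mu> \<omega>" by (rule LIMSEQ_le_const[OF c]) (use b in auto)
    show "e \<mu> \<omega> \<le> esc r \<mu> \<omega>" using decseq_ge[OF dec c] .
  qed
  have lower: "ennreal (e [] \<omega>) \<le> emeasure (env_walk_law off \<Gamma> \<omega>) {x. \<forall>n. x n \<noteq> None}"
    if w: "\<omega> \<in> space M" for \<omega>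
    unfolding env_walk_law_def
  proof (rule emeasure_walk_law_escape)
    fix \<nu>
    let ?A = "\<lambda>\<nu>. fst (\<Gamma> \<nu> \<omega>)"
    show "0 < ?A \<nu>" by (rule A_pos[OF w])
    show "0 \<le> e \<nu> \<omega>" by (rule e0[OF w])
    show le1: "e \<nu> \<omega> \<le> 1" using e1[OF w, of \<nu> 0] by (simp add: esc_def)
    define S where "S = (\<Sum>i<dL \<omega> \<nu>. ?A (i # \<nu>) * e (i # \<nu>) \<omega>)"
    have S0: "0 \<le> S" unfolding S_def using e0[OF w] A_pos[OF w]
      by (intro sum_nonneg mult_nonneg_nonneg) (auto intro: less_imp_le)
    have "(\<lambda>r. \<Sum>i<dL \<omega> \<nu>. ?A (i # \<nu>) * esc r (i # \<nu>) \<omega>) \<longlonglongrightarrow> S"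
      unfolding S_def by (intro tendsto_intros conv w)
    then have "(\<lambda>r. (\<Sum>i<dL \<omega> \<nu>. ?A (i # \<nu>) * esc r (i # \<nu>) \<omega>) /
        (1 + (\<Sum>i<dL \<omega> \<nu>. ?A (i # \<nu>) * esc r (i # \<nu>) \<omega>))) \<longlonglongrightarrow> S / (1 + S)"
      using S0 by (intro tendsto_intros) auto
    then have "(\<lambda>r. esc (Suc r) \<nu> \<omega>) \<longlonglongrightarrow> S / (1 + S)" by (simp add: esc_def Let_def)
    then have eS: "e \<nu> \<omega> = S / (1 + S)"
      using LIMSEQ_Suc[OF conv[OF w, of \<nu>]] LIMSEQ_unique by blast
    \<comment> \<open>From the truncated sum \<open>S\<close> to the full sum \<open>S'\<close> both
      sides of \<open>e * (1 + S) = S\<close> grow, the left one at most as fast since the escape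
      probability is at most 1.\<close>
    define S' where "S' = (\<Sum>i<off \<nu> \<omega>. ?A (i # \<nu>) * e (i # \<nu>) \<omega>)"
    have SS: "S \<le> S'" unfolding S_def S'_def using e0[OF w] A_pos[OF w]
      by (intro sum_mono2) (auto simp: thinned_def intro!: mult_nonneg_nonneg intro: less_imp_le)
    have "e \<nu> \<omega> * (1 + S') \<le> S'"
    proof -
      have "e \<nu> \<omega> * (1 + S) = S" unfolding eS using S0 by simp
      moreover have "e \<nu> \<omega> * (S' - S) \<le> 1 * (S' - S)" using le1 SS by (intro mult_right_mono) auto
      ultimately show ?thesis by (simp add: algebra_simps)
    qed
    then show "e \<nu> \<omega> * (1 + (\<Sum>i<off \<nu> \<omega>. ?A (i # \<nu>) * e (i # \<nu>) \<omega>))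
        \<le> (\<Sum>i<off \<nu> \<omega>. ?A (i # \<nu>) * e (i # \<nu>) \<omega>)"
      by (simp add: S'_def)
  qed
  have "ennreal (1 / energy_const) \<le> (INF r. \<integral>\<^sup>+ \<omega>. ennreal (esc r [] \<omega>) \<partial>M)"
    by (intro INF_greatest expectation_esc)
  also have "\<dots> = (\<integral>\<^sup>+ \<omega>. (INF r. ennreal (esc r [] \<omega>)) \<partial>M)"
  proof (rule nn_integral_monotone_convergence_INF_AE[symmetric])
    show "AE \<omega> in M. ennreal (esc (Suc i) [] \<omega>) \<le> ennreal (esc i [] \<omega>)" for i
      by (intro AE_I2 ennreal_leI) (metis dec decseq_Suc_iff)
    have "(\<integral>\<^sup>+ \<omega>. ennreal (esc 0 [] \<omega>) \<partial>M) = 1" by (simp add: esc_def emeasure_space_1)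
    then show "(\<integral>\<^sup>+ \<omega>. ennreal (esc 0 [] \<omega>) \<partial>M) < \<infinity>" by simp
  qed measurable
  also have "\<dots> \<le> (\<integral>\<^sup>+ \<omega>. emeasure (env_walk_law off \<Gamma> \<omega>) {x. \<forall>n. x n \<noteq> None} \<partial>M)"
  proof (intro nn_integral_mono)
    fix \<omega> assume w: "\<omega> \<in> space M"
    have "(\<lambda>r. ennreal (esc r [] \<omega>)) \<longlonglongrightarrow> ennreal (e [] \<omega>)" by (intro tendsto_ennrealI conv[OF w])
    moreover have "decseq (\<lambda>r. ennreal (esc r [] \<omega>))"
      using dec[OF w, of "[]"] by (auto simp: decseq_def intro!: ennreal_leI)
    ultimately have "(INF r. ennreal (esc r [] \<omega>)) = ennreal (e [] \<omega>)"
      using LIMSEQ_INF LIMSEQ_unique by blast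
    then show "(INF r. ennreal (esc r [] \<omega>)) \<le> emeasure (env_walk_law off \<Gamma> \<omega>) {x. \<forall>n. x n \<noteq> None}"
      using lower[OF w] by simp
  qed
  finally have "ennreal (1 / energy_const) \<le> (\<integral>\<^sup>+ \<omega>. emeasure (env_walk_law off \<Gamma> \<omega>) {x. \<forall>n. x n \<noteq> None}
      \<partial>M)" .
  moreover have "0 < ennreal (1 / energy_const)" using energy_const_pos by simp
  ultimately show ?thesis unfolding transient_def by (rule less_le_trans[rotated])
qed

end

section \<open>Flows through successful blocks\<close>

text \<open>\<open>hit K e r n s y\<close> is the probability that the chain started at \<open>y\<close> makes \<open>n\<close> steps with
  weights in \<open>{e<..r}\<close> whose logarithms add up to at least \<open>s\<close>.\<close>
primrec hit :: "(real \<times> 's \<Rightarrow> (real \<times> 's) measure) \<Rightarrow> real \<Rightarrow> real \<Rightarrow> nat \<Rightarrow> real \<Rightarrow> real \<times> 's \<Rightarrow> ennreal"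
where
  "hit K e r 0 s y = (if s \<le> 0 then 1 else 0)"
| "hit K e r (Suc n) s y = (\<integral>\<^sup>+ z. indicator {e<..r} (fst z) * hit K e r n (s - ln (fst z)) z \<partial>K y)"

text \<open>Joint measurability is required because the threshold handed on to the next step depends
  on the state being integrated.\<close>

lemma hit_measurable_pair:
  assumes K: "K \<in> Sigma' \<rightarrow>\<^sub>M prob_algebra Sigma'"
  shows "(\<lambda>(s, y). hit K e r n s y) \<in> borel_measurable (borel \<Otimes>\<^sub>M Sigma')"
proof (induction n)
  case (Suc n)
  have "(\<lambda>x. \<integral>\<^sup>+ z. indicator {e<..r} (fst z) * hit K e r n (fst x - ln (fst z)) z \<partial>K (snd x))
      \<in> borel_measurable (borel \<Otimes>\<^sub>M Sigma')"
  proof (rule nn_integral_measurable_subprob_algebra2)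
    have "(\<lambda>x. (fst (fst x) - ln (fst (snd x)), snd x)) \<in> (borel \<Otimes>\<^sub>M Sigma') \<Otimes>\<^sub>M Sigma' \<rightarrow>\<^sub>M borel \<Otimes>\<^sub>M
        Sigma'"
      by measurable
    from measurable_compose[OF this Suc]
    have "(\<lambda>x. hit K e r n (fst (fst x) - ln (fst (snd x))) (snd x)) \<in> borel_measurable
        ((borel \<Otimes>\<^sub>M Sigma') \<Otimes>\<^sub>M Sigma')" by simp
    then show "(\<lambda>(x, z). indicator {e<..r} (fst z) * hit K e r n (fst x - ln (fst z)) z)
        \<in> borel_measurable ((borel \<Otimes>\<^sub>M Sigma') \<Otimes>\<^sub>M Sigma')"
      unfolding case_prod_unfold by measurable
    show "(\<lambda>x. K (snd x)) \<in> borel \<Otimes>\<^sub>M Sigma' \<rightarrow>\<^sub>M subprob_algebra Sigma'"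
      by (rule measurable_compose[OF measurable_snd measurable_prob_algebraD[OF K]])
  qed
  then show ?case by (simp add: case_prod_unfold)
next
  case 0
  show ?case unfolding hit.simps case_prod_unfold by measurable
qed

lemma hit_measurable:
  assumes K: "K \<in> Sigma' \<rightarrow>\<^sub>M prob_algebra Sigma'" and f: "f \<in> borel_measurable N"
    and g: "g \<in> N \<rightarrow>\<^sub>M Sigma'"
  shows "(\<lambda>x. hit K e r n (f x) (g x)) \<in> borel_measurable N"
  using measurable_compose[OF measurable_Pair[OF f g] hit_measurable_pair[OF K]] by simp

lemma kernel_space:
  assumes K: "K \<in> Sigma' \<rightarrow>\<^sub>M prob_algebra Sigma'" and y: "y \<in> space Sigma'"
  shows "prob_space (K y)" "sets (K y) = sets Sigma'" "space (K y) = space Sigma'"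
  using measurable_space[OF K y] by (auto simp: space_prob_algebra dest: sets_eq_imp_space_eq)

lemma hit_le_1:
  assumes K: "K \<in> Sigma' \<rightarrow>\<^sub>M prob_algebra Sigma'" and y: "y \<in> space Sigma'"
  shows "hit K e r n s y \<le> 1"
  using y
proof (induction n arbitrary: s y)
  case (Suc n)
  have "hit K e r (Suc n) s y \<le> (\<integral>\<^sup>+ z. 1 \<partial>K y)"
    unfolding hit.simps by (intro nn_integral_mono) (auto simp: kernel_space[OF K Suc.prems] Suc.IH
        split: split_indicator)
  also have "\<dots> = 1" using prob_space.emeasure_space_1[OF kernel_space(1)[OF K Suc.prems]] by simp
  finally show ?case .
qed simp

text \<open>Because \<open>s \<le> 0\<close>, \<open>supercritical\<close> also entails
  \<open>1 < \<rho> * b ^ n\<close>: one inequality controls both the number of successful lines and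
  their resistances.\<close>

locale block_weight = markov_tree M p K x0 off \<Gamma>
  for M :: "'w measure" and p and K :: "real \<times> 's::polish_space \<Rightarrow> (real \<times> 's) measure"
    and x0 off \<Gamma> +
  fixes e r s \<rho> b :: real and n L :: nat
  assumes e: "0 < e" "e \<le> 1" and n: "0 < n" and s: "s \<le> 0" and \<rho>: "0 < \<rho>" "\<rho> \<le> 1"
    and hit_ge: "\<And>y. y \<in> space Sigma' \<Longrightarrow> ennreal \<rho> \<le> hit K e r n s y"
    and b: "b = (\<Sum>i<L. measure_pmf.prob p {k. i < min k L})"
    and supercritical: "1 < \<rho> * exp s * b ^ n"
begin

definition h :: "nat \<Rightarrow> real \<Rightarrow> real \<times> 's \<Rightarrow> real" where
  "h k t y = enn2real (hit K e r k t y)"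

lemma h_nonneg: "0 \<le> h k t y" by (simp add: h_def)

lemma h_eq:
  assumes "y \<in> space Sigma'"
  shows "ennreal (h k t y) = hit K e r k t y"
proof -
  have "hit K e r k t y < \<top>" by (rule order.strict_trans1[OF hit_le_1[OF kernel assms]]) simp
  then show ?thesis by (simp add: h_def)
qed

lemma h_le_1:
  assumes "y \<in> space Sigma'"
  shows "h k t y \<le> 1"
proof -
  have "ennreal (h k t y) \<le> 1" unfolding h_eq[OF assms] by (rule hit_le_1[OF kernel assms])
  then show ?thesis by simp
qed

lemma h_ge:
  assumes "y \<in> space Sigma'"
  shows "\<rho> \<le> h n s y"
proof -
  have "ennreal \<rho> \<le> ennreal (h n s y)" unfolding h_eq[OF assms] by (rule hit_ge[OF assms])
  then show ?thesis by (simp add: h_nonneg)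
qed

lemma h_0: "h 0 t y = (if t \<le> 0 then 1 else 0)" by (simp add: h_def)

lemma h_measurable:
  "f \<in> borel_measurable N \<Longrightarrow> g \<in> N \<rightarrow>\<^sub>M Sigma' \<Longrightarrow> (\<lambda>x. h k (f x) (g x)) \<in> borel_measurable N"
  unfolding h_def by (rule measurable_compose[OF hit_measurable[OF kernel] borel_measurable_enn2real])
      auto

text \<open>A line of descent is cut into blocks of \<open>n\<close> generations. \<open>thr \<nu>\<close> is what the sum of the
  logarithms of the weights below \<open>\<nu>\<close> still has to reach within the current block.\<close>
primrec thr :: "nat list \<Rightarrow> 'w \<Rightarrow> real" where
  "thr [] \<omega> = s"
| "thr (i # \<nu>) \<omega> = (if Suc (length \<nu>) mod n = 0 then s else thr \<nu> \<omega> - ln (fst (env (i # \<nu>) \<omega>)))"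

text \<open>The indicator of success so far, normalised by the success probability of each block begun.\<close>
primrec U :: "nat list \<Rightarrow> 'w \<Rightarrow> real" where
  "U [] \<omega> = 1 / h n s (env [] \<omega>)"
| "U (i # \<nu>) \<omega> = U \<nu> \<omega> * indicator {e<..r} (fst (env (i # \<nu>) \<omega>)) *
    (if Suc (length \<nu>) mod n = 0
     then (if thr \<nu> \<omega> - ln (fst (env (i # \<nu>) \<omega>)) \<le> 0 then 1 else 0) / h n s (env (i # \<nu>) \<omega>) else 1)"

text \<open>The conditional expectation, given the past, of the normalised success indicator at the
  end of the current block. At the start of a block the new normaliser cancels against the success
  probability.\<close>

definition weight :: "nat list \<Rightarrow> 'w \<Rightarrow> real" where
  "weight \<nu> \<omega> = U \<nu> \<omega> * h (n - length \<nu> mod n) (thr \<nu> \<omega>) (env \<nu> \<omega>)"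

text \<open>The weight of a child with its value left free, as required for integration against the
  kernel. On the last step of a block the remaining length is 0 and \<open>h 0\<close> is the
  success indicator.\<close>

definition child_weight :: "nat list \<Rightarrow> 'w \<times> (real \<times> 's) \<Rightarrow> real" where
  "child_weight \<nu> x = U \<nu> (fst x) * indicator {e<..r} (fst (snd x)) *
     h (n - length \<nu> mod n - 1) (thr \<nu> (fst x) - ln (fst (snd x))) (snd x)"

lemma ln_fst_env_measurable: "length \<nu> \<le> k \<Longrightarrow> (\<lambda>\<omega>. fst (env \<nu> \<omega>)) \<in> borel_measurable (F k)"
  by (rule measurable_compose[OF env_past fst_Sigma'])

lemma thr_measurable: "length \<nu> \<le> k \<Longrightarrow> thr \<nu> \<in> borel_measurable (F k)"
proof (induction \<nu>)
  case (Cons i \<nu>)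
  note ln_fst_env_measurable[OF Cons.prems, measurable]
  have [measurable]: "thr \<nu> \<in> borel_measurable (F k)" using Cons by simp
  show ?case unfolding thr.simps by measurable
next
  case Nil
  have "thr [] = (\<lambda>_. s)" by (rule ext) simp
  then show ?case by simp
qed

lemma U_measurable: "length \<nu> \<le> k \<Longrightarrow> U \<nu> \<in> borel_measurable (F k)"
proof (induction \<nu>)
  case Nil
  have [measurable]: "(\<lambda>\<omega>. h n s (env [] \<omega>)) \<in> borel_measurable (F k)"
    by (rule h_measurable) (auto intro: env_past)
  show ?case unfolding U.simps by measurable
next
  case (Cons i \<nu>)
  note ln_fst_env_measurable[OF Cons.prems, measurable]
  have [measurable]: "U \<nu> \<in> borel_measurable (F k)" using Cons by simp
  have [measurable]: "thr \<nu> \<in> borel_measurable (F k)" using Cons.prems by (intro thr_measurable) simp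
  have [measurable]: "(\<lambda>\<omega>. h n s (env (i # \<nu>) \<omega>)) \<in> borel_measurable (F k)"
    by (rule h_measurable) (use Cons.prems in \<open>auto intro: env_past\<close>)
  show ?case unfolding U.simps by measurable
qed

lemma weight_measurable: "weight \<nu> \<in> borel_measurable (F (length \<nu>))"
proof -
  note U_measurable[OF order_refl, of \<nu>, measurable]
  have [measurable]: "(\<lambda>\<omega>. h (n - length \<nu> mod n) (thr \<nu> \<omega>) (env \<nu> \<omega>)) \<in> borel_measurable
      (F (length \<nu>))"
    by (rule h_measurable[OF thr_measurable env_past]) auto
  show ?thesis unfolding weight_def[abs_def] by measurable
qed

lemma child_weight_measurable: "child_weight \<nu> \<in> borel_measurable (F (length \<nu>) \<Otimes>\<^sub>M Sigma')"
proof -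
  note U_measurable[OF order_refl, of \<nu>, measurable] thr_measurable[OF order_refl, of \<nu>, measurable]
  have [measurable]: "(\<lambda>x. h (n - length \<nu> mod n - 1) (thr \<nu> (fst x) - ln (fst (snd x))) (snd x))
      \<in> borel_measurable (F (length \<nu>) \<Otimes>\<^sub>M Sigma')"
    by (rule h_measurable) measurable
  show ?thesis unfolding child_weight_def[abs_def] by measurable
qed

lemma U_nonneg: "0 \<le> U \<nu> \<omega>"
  by (induction \<nu>) (auto simp: h_nonneg)

lemma weight_Cons:
  assumes w: "\<omega> \<in> space M"
  shows "weight (i # \<nu>) \<omega> = child_weight \<nu> (\<omega>, env (i # \<nu>) \<omega>)"
proof (cases "Suc (length \<nu>) mod n = 0")
  case True
  then have k: "n - length \<nu> mod n - 1 = 0"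
    using mod_Suc[of "length \<nu>" n] n by (auto split: if_splits)
  have "h n s (env (i # \<nu>) \<omega>) > 0" using h_ge[OF env_space[OF w], of "i # \<nu>"] \<rho> by linarith
  then show ?thesis using True k by (simp add: weight_def child_weight_def h_0)
next
  case False
  then have "Suc (length \<nu>) mod n = Suc (length \<nu> mod n)" by (simp add: mod_Suc split: if_splits)
  then show ?thesis using False by (simp add: weight_def child_weight_def)
qed

lemma U_le: "\<omega> \<in> space M \<Longrightarrow> U \<nu> \<omega> \<le> (1 / \<rho>) ^ Suc (length \<nu> div n)"
proof (induction \<nu>)
  have inv: "1 / h n s (env \<nu> \<omega>) \<le> 1 / \<rho>" if "\<omega> \<in> space M" for \<nu>
    using h_ge[OF env_space[OF that], of \<nu>] \<rho> by (intro divide_left_mono mult_pos_pos) auto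
  {
    case Nil then show ?case using inv[of "[]"] by simp
  next
    case (Cons i \<nu>)
    show ?case
    proof (cases "Suc (length \<nu>) mod n = 0")
      case True
      have "U (i # \<nu>) \<omega> \<le> U \<nu> \<omega> * 1 * (1 / \<rho>)"
        unfolding U.simps using True inv[OF Cons.prems, of "i # \<nu>"] U_nonneg[of \<nu> \<omega>] \<rho>
        by (intro mult_mono) (auto simp: h_nonneg split: split_indicator)
      also have "\<dots> \<le> (1 / \<rho>) ^ Suc (length \<nu> div n) * 1 * (1 / \<rho>)"
        using Cons \<rho> by (intro mult_right_mono) auto
      also have "\<dots> = (1 / \<rho>) ^ Suc (length (i # \<nu>) div n)"
        using True by (simp add: div_Suc)
      finally show ?thesis .
    next
      case False
      have "U (i # \<nu>) \<omega> \<le> U \<nu> \<omega> * 1"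
        using False U_nonneg[of \<nu> \<omega>] by (auto split: split_indicator)
      then show ?thesis using Cons False by (simp add: div_Suc)
    qed
  }
qed

text \<open>Here \<open>s - thr \<nu> \<omega>\<close> is the sum of the logarithms in the current
  block. Each completed block contributes at least \<open>s\<close>, and in the unfinished one every
  step loses at most \<open>- ln e\<close>.\<close>

lemma ln_cond_ge:
  assumes w: "\<omega> \<in> space M" and "0 < U \<nu> \<omega>"
  shows "real (length \<nu> div n) * s + s - thr \<nu> \<omega> \<le> ln (cond \<nu> \<omega>) \<and>
    thr \<nu> \<omega> - s \<le> real (length \<nu> mod n) * - ln e"
  using assms(2)
proof (induction \<nu>)
  case (Cons i \<nu>)
  let ?A = "fst (env (i # \<nu>) \<omega>)"
  have "U \<nu> \<omega> \<noteq> 0" "?A \<in> {e<..r}" using Cons.prems by (auto split: split_indicator_asm)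
  then have U: "0 < U \<nu> \<omega>" and A: "e < ?A" using U_nonneg[of \<nu> \<omega>] by auto
  have lnA: "ln e \<le> ln ?A" using A e by simp
  have "0 < ?A" using A e by simp
  then have lc: "ln (cond (i # \<nu>) \<omega>) = ln (cond \<nu> \<omega>) + ln ?A"
    using cond_pos[OF w, of \<nu>] by (simp add: cond_Cons ln_mult)
  note IH = Cons.IH[OF U]
  show ?case
  proof (cases "Suc (length \<nu>) mod n = 0")
    case True
    have "thr \<nu> \<omega> - ln ?A \<le> 0" using Cons.prems True by (auto split: if_splits)
    with IH True show ?thesis by (simp add: lc div_Suc algebra_simps)
  next
    case False
    then have m: "Suc (length \<nu>) mod n = Suc (length \<nu> mod n)" by (simp add: mod_Suc split: if_splits)
    with IH False lnA show ?thesis by (simp add: lc div_Suc algebra_simps)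
  qed
qed simp

lemma U_append: "0 < U (xs @ \<nu>) \<omega> \<Longrightarrow> 0 < U \<nu> \<omega>"
proof (induction xs)
  case (Cons i xs)
  then have "U (xs @ \<nu>) \<omega> \<noteq> 0" by auto
  then show ?case using Cons.IH U_nonneg[of "xs @ \<nu>" \<omega>] by auto
qed simp

text \<open>Each block begun multiplies \<open>U\<close> by at most \<open>1 / \<rho>\<close>, which
  is \<open>(1 / \<rho>) powr (1 / n)\<close> per generation with one factor left over for the
  current block. Likewise \<open>exp (- s / n)\<close> is the loss of conductance per generation,
  and \<open>exp (- real n * ln e)\<close> covers an unfinished block.\<close>

sublocale W: flow_weight M p K x0 off \<Gamma> weight child_weight "1 / \<rho>" "(1 / \<rho>) powr (1 / n)"
    "exp (- s / n)" "exp (- real n * ln e)" b L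
proof
  let ?a = "(1 / \<rho>) powr (1 / n)" and ?z = "exp (- s / n)"
  show "weight [] \<omega> = 1" if w: "\<omega> \<in> space M" for \<omega>
    using h_ge[OF env_space[OF w], of "[]"] \<rho> by (simp add: weight_def)
  show "weight (i # \<nu>) \<omega> = child_weight \<nu> (\<omega>, env (i # \<nu>) \<omega>)" if "\<omega> \<in> space M" for i \<nu> \<omega>
    by (rule weight_Cons[OF that])
  show "weight \<nu> \<in> borel_measurable (F (length \<nu>))" for \<nu> by (rule weight_measurable)
  show "child_weight \<nu> \<in> borel_measurable (F (length \<nu>) \<Otimes>\<^sub>M Sigma')" for \<nu>
    by (rule child_weight_measurable)
  show "0 \<le> weight \<nu> \<omega>" for \<nu> \<omega> by (simp add: weight_def U_nonneg h_nonneg)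
  show "0 \<le> child_weight \<nu> x" for \<nu> x by (simp add: child_weight_def U_nonneg h_nonneg)
  show "(\<integral>\<^sup>+ y. ennreal (child_weight \<nu> (\<omega>, y)) \<partial>K (\<Gamma> \<nu> \<omega>)) = ennreal (weight \<nu> \<omega>)"
    if t: "\<omega> \<in> tree_event (\<lambda>k. k) \<nu>" for \<nu> \<omega>
  proof -
    have w: "\<omega> \<in> space M" using t by (simp add: tree_event_def)
    have g: "\<Gamma> \<nu> \<omega> \<in> space Sigma'" by (rule measurable_space[OF env_measurable w])
    have k: "n - length \<nu> mod n = Suc (n - length \<nu> mod n - 1)" using n by (simp add: Suc_diff_Suc)
    let ?k = "n - length \<nu> mod n - 1"
    let ?f = "\<lambda>z. indicator {e<..r} (fst z) * hit K e r ?k (thr \<nu> \<omega> - ln (fst z)) z"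
    have fm: "?f \<in> borel_measurable (K (\<Gamma> \<nu> \<omega>))"
      unfolding measurable_cong_sets[OF kernel_space(2)[OF kernel g] refl]
      by (intro borel_measurable_times_ennreal hit_measurable[OF kernel]) measurable
    have "(\<integral>\<^sup>+ y. ennreal (child_weight \<nu> (\<omega>, y)) \<partial>K (\<Gamma> \<nu> \<omega>))
        = (\<integral>\<^sup>+ z. ennreal (U \<nu> \<omega>) * ?f z \<partial>K (\<Gamma> \<nu> \<omega>))"
    proof (intro nn_integral_cong)
      fix z assume "z \<in> space (K (\<Gamma> \<nu> \<omega>))"
      then have z: "z \<in> space Sigma'" by (simp add: kernel_space[OF kernel g])
      show "ennreal (child_weight \<nu> (\<omega>, z)) = ennreal (U \<nu> \<omega>) * ?f z"
        unfolding h_eq[OF z, symmetric]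
        by (auto simp: child_weight_def ennreal_mult U_nonneg h_nonneg split: split_indicator)
    qed
    also have "\<dots> = ennreal (U \<nu> \<omega>) * hit K e r (Suc ?k) (thr \<nu> \<omega>) (\<Gamma> \<nu> \<omega>)"
      unfolding hit.simps by (rule nn_integral_cmult[OF fm])
    also have "\<dots> = ennreal (weight \<nu> \<omega>)"
      unfolding k[symmetric] h_eq[OF g, symmetric] weight_def env_eq[OF t]
      by (simp add: ennreal_mult U_nonneg h_nonneg)
    finally show ?thesis .
  qed
  have pow: "(1 / \<rho>) ^ (m div n) \<le> ?a ^ m" for m
  proof -
    have "real (m div n) \<le> real m / n" by (rule of_nat_div_le_of_nat)
    then have "(1 / \<rho>) powr real (m div n) \<le> (1 / \<rho>) powr (real m / n)"
      using \<rho> by (intro powr_mono) auto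
    also have "\<dots> = ?a ^ m" using \<rho> by (simp add: powr_powr powr_realpow[symmetric])
    finally show ?thesis using \<rho> by (simp add: powr_realpow)
  qed
  show "weight \<nu> \<omega> \<le> 1 / \<rho> * ?a ^ length \<nu>" if w: "\<omega> \<in> space M" for \<nu> \<omega>
  proof -
    have "weight \<nu> \<omega> \<le> U \<nu> \<omega> * 1"
      unfolding weight_def by (intro mult_left_mono h_le_1 env_space[OF w] U_nonneg)
    also have "\<dots> \<le> 1 / \<rho> * (1 / \<rho>) ^ (length \<nu> div n)" using U_le[OF w, of \<nu>] by simp
    also have "\<dots> \<le> 1 / \<rho> * ?a ^ length \<nu>" using \<rho> by (intro mult_left_mono pow) auto
    finally show ?thesis .
  qed
  show "1 / cond \<nu> \<omega> \<le> exp (- real n * ln e) * ?z ^ length \<nu>"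
    if w: "\<omega> \<in> space M" and pos: "0 < weight (xs @ \<nu>) \<omega>" for xs \<nu> \<omega>
  proof -
    have "U (xs @ \<nu>) \<omega> \<noteq> 0" using pos by (auto simp: weight_def)
    then have "0 < U (xs @ \<nu>) \<omega>" using U_nonneg[of "xs @ \<nu>" \<omega>] by simp
    from ln_cond_ge[OF w U_append[OF this]]
    have 1: "real (length \<nu> div n) * s - real (length \<nu> mod n) * - ln e \<le> ln (cond \<nu> \<omega>)" by linarith
    \<comment> \<open>The rounding in \<open>div\<close> goes the right way because
      \<open>s \<le> 0\<close>.\<close>
    have "real (length \<nu>) / n * s \<le> real (length \<nu> div n) * s"
      using s by (intro mult_right_mono_neg of_nat_div_le_of_nat)
    moreover have "real (length \<nu> mod n) * - ln e \<le> real n * - ln e"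
      using e n by (intro mult_right_mono) (auto simp: less_imp_le)
    ultimately have "- ln (cond \<nu> \<omega>) \<le> - real n * ln e + real (length \<nu>) * (- s / n)"
      using 1 by (simp add: field_simps)
    then have "exp (- ln (cond \<nu> \<omega>)) \<le> exp (- real n * ln e + real (length \<nu>) * (- s / n))" by simp
    moreover have "exp (- ln (cond \<nu> \<omega>)) = 1 / cond \<nu> \<omega>"
      using cond_pos[OF w, of \<nu>] by (simp add: exp_minus inverse_eq_divide)
    moreover have "exp (- real n * ln e + real (length \<nu>) * (- s / n))
        = exp (- real n * ln e) * ?z ^ length \<nu>"
      by (simp only: exp_add exp_of_nat_mult)
    ultimately show ?thesis by (simp only:)
  qed
  show "1 \<le> 1 / \<rho>" using \<rho> by simp
  show "1 \<le> ?a" using \<rho> n by (intro ge_one_powr_ge_zero) auto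
  show "1 \<le> ?z" using s by (simp add: divide_le_0_iff)
  show "0 < exp (- real n * ln e)" by simp
  show "?a * ?z < b"
  proof (rule power_less_imp_less_base)
    have 1: "?a ^ n = 1 / \<rho>" using \<rho> n by (simp add: powr_realpow[symmetric] powr_powr)
    have 2: "?z ^ n = exp (- s)" using n by (simp flip: exp_of_nat_mult)
    have "(?a * ?z) ^ n = 1 / (\<rho> * exp s)"
      unfolding power_mult_distrib 1 2 by (simp add: exp_minus inverse_eq_divide)
    also have "\<dots> < b ^ n" using supercritical \<rho> by (simp add: field_simps)
    finally show "(?a * ?z) ^ n < b ^ n" .
    show "0 \<le> b" unfolding b by (simp add: sum_nonneg)
  qed
qed (fact b)

lemma transient: "transient M off \<Gamma>"
  by (rule W.transient)

end

section \<open>Success probabilities from different starting points\<close>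

lemma nn_integral_le_sum_measures:
  assumes s: "sets \<mu> = sets N" "\<And>i. i \<in> I \<Longrightarrow> sets (\<nu> i) = sets N" and fin: "finite I"
    and le: "\<And>B. B \<in> sets N \<Longrightarrow> emeasure \<mu> B \<le> c * (\<Sum>i\<in>I. emeasure (\<nu> i) B)"
    and f: "f \<in> borel_measurable N"
  shows "(\<integral>\<^sup>+ x. f x \<partial>\<mu>) \<le> c * (\<Sum>i\<in>I. \<integral>\<^sup>+ x. f x \<partial>\<nu> i)"
  using f
proof (induction f rule: borel_measurable_induct)
  case (cong f g)
  have "(\<integral>\<^sup>+ x. f x \<partial>\<mu>) = (\<integral>\<^sup>+ x. g x \<partial>\<mu>)" "\<And>i. i \<in> I \<Longrightarrow> (\<integral>\<^sup>+ x. f x \<partial>\<nu> i) = (\<integral>\<^sup>+ x. g x \<partial>\<nu> i)"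
    using cong(3) sets_eq_imp_space_eq[OF s(1)] sets_eq_imp_space_eq[OF s(2)]
    by (auto intro!: nn_integral_cong)
  with cong(4) show ?case by simp
next
  case (set A)
  then show ?case using le[OF set] by (simp add: s)
next
  case (mult u k)
  have "u \<in> borel_measurable \<mu>" "\<And>i. i \<in> I \<Longrightarrow> u \<in> borel_measurable (\<nu> i)"
    using mult(2) by (simp_all add: measurable_cong_sets[OF s(1) refl] measurable_cong_sets[OF s(2)
        refl])
  then show ?case using mult_left_mono[OF mult(4), of k]
    by (simp add: nn_integral_cmult sum_distrib_left mult_ac)
next
  case (add u v)
  have m: "u \<in> borel_measurable \<mu>" "\<And>i. i \<in> I \<Longrightarrow> u \<in> borel_measurable (\<nu> i)"
     "v \<in> borel_measurable \<mu>" "\<And>i. i \<in> I \<Longrightarrow> v \<in> borel_measurable (\<nu> i)"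
    using add by (simp_all add: measurable_cong_sets[OF s(1) refl] measurable_cong_sets[OF s(2) refl])
  have "(\<integral>\<^sup>+ x. u x \<partial>\<mu>) + (\<integral>\<^sup>+ x. v x \<partial>\<mu>) \<le> c * (\<Sum>i\<in>I. \<integral>\<^sup>+ x. u x \<partial>\<nu> i) + c * (\<Sum>i\<in>I. \<integral>\<^sup>+ x. v x \<partial>\<nu> i)"
    using add by (intro add_mono) auto
  then show ?case using m by (simp add: nn_integral_add sum.distrib distrib_left add.commute)
next
  case (seq U)
  have m: "U i \<in> borel_measurable \<mu>" for i
    using seq by (simp add: measurable_cong_sets[OF s(1) refl])
  have inc: "incseq U" using seq by simp
  have IH: "(\<integral>\<^sup>+ x. U j x \<partial>\<mu>) \<le> c * (\<Sum>i\<in>I. \<integral>\<^sup>+ x. U j x \<partial>\<nu> i)" for j using seq by simp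
  have "(\<integral>\<^sup>+ x. (SUP i. U i) x \<partial>\<mu>) = (SUP i. \<integral>\<^sup>+ x. U i x \<partial>\<mu>)"
    unfolding SUP_apply by (rule nn_integral_monotone_convergence_SUP[OF inc m])
  also have "\<dots> \<le> c * (\<Sum>i\<in>I. \<integral>\<^sup>+ x. (SUP i. U i) x \<partial>\<nu> i)"
  proof (rule SUP_least)
    fix j
    have "c * (\<Sum>i\<in>I. \<integral>\<^sup>+ x. U j x \<partial>\<nu> i) \<le> c * (\<Sum>i\<in>I. \<integral>\<^sup>+ x. (SUP i. U i) x \<partial>\<nu> i)"
      by (intro mult_left_mono sum_mono nn_integral_mono) (auto intro: SUP_upper)
    with IH[of j] show "(\<integral>\<^sup>+ x. U j x \<partial>\<mu>) \<le> c * (\<Sum>i\<in>I. \<integral>\<^sup>+ x. (SUP i. U i) x \<partial>\<nu> i)" by order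
  qed
  finally show ?case .
qed

definition kop :: "('a \<Rightarrow> 'a measure) \<Rightarrow> ('a \<Rightarrow> ennreal) \<Rightarrow> 'a \<Rightarrow> ennreal" where
  "kop K f y = (\<integral>\<^sup>+ z. f z \<partial>K y)"

text \<open>The transition operator of the chain killed when its weight leaves the strip.\<close>

definition strip_op :: "(real \<times> 's \<Rightarrow> (real \<times> 's) measure) \<Rightarrow> real \<Rightarrow> real \<Rightarrow> (real \<times> 's \<Rightarrow> ennreal) \<Rightarrow> real \<times>
    's \<Rightarrow> ennreal" where
  "strip_op K e r f y = (\<integral>\<^sup>+ z. indicator {e<..r} (fst z) * f z \<partial>K y)"

locale markov_kernel =
  fixes K :: "real \<times> 's::polish_space \<Rightarrow> (real \<times> 's) measure"
  assumes K: "K \<in> Sigma' \<rightarrow>\<^sub>M prob_algebra Sigma'"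
begin

lemma K_sub: "K \<in> Sigma' \<rightarrow>\<^sub>M subprob_algebra Sigma'"
  by (rule measurable_prob_algebraD[OF K])

lemmas K_space = kernel_space[OF K]

lemma kop_measurable: "f \<in> borel_measurable Sigma' \<Longrightarrow> kop K f \<in> borel_measurable Sigma'"
  unfolding kop_def by (rule measurable_compose[OF K_sub nn_integral_measurable_subprob_algebra])

lemma kop_pow_measurable: "f \<in> borel_measurable Sigma' \<Longrightarrow> (kop K ^^ n) f \<in> borel_measurable Sigma'"
  by (induction n) (auto intro: kop_measurable)

lemma strip_op_kop: "strip_op K e r f = kop K (\<lambda>z. indicator {e<..r} (fst z) * f z)"
  by (simp add: strip_op_def kop_def fun_eq_iff)

lemma strip_op_measurable: "f \<in> borel_measurable Sigma' \<Longrightarrow> strip_op K e r f \<in> borel_measurable Sigma'"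
  unfolding strip_op_kop by (rule kop_measurable) measurable

lemma strip_op_pow_measurable: "f \<in> borel_measurable Sigma' \<Longrightarrow> (strip_op K e r ^^ n) f \<in> borel_measurable
    Sigma'"
  by (induction n) (auto intro: strip_op_measurable)

lemma kop_mono: "y \<in> space Sigma' \<Longrightarrow> (\<And>z. z \<in> space Sigma' \<Longrightarrow> f z \<le> g z) \<Longrightarrow> kop K f y \<le> kop K g y"
  unfolding kop_def by (intro nn_integral_mono) (simp add: K_space)

lemma kop_pow_mono:
  "y \<in> space Sigma' \<Longrightarrow> (\<And>z. z \<in> space Sigma' \<Longrightarrow> f z \<le> g z) \<Longrightarrow> (kop K ^^ n) f y \<le> (kop K ^^ n) g y"
  by (induction n arbitrary: y) (auto intro: kop_mono)

lemma strip_op_mono: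
  "y \<in> space Sigma' \<Longrightarrow> (\<And>z. z \<in> space Sigma' \<Longrightarrow> f z \<le> g z) \<Longrightarrow> e' \<le> e \<Longrightarrow> r \<le> r' \<Longrightarrow>
    strip_op K e r f y \<le> strip_op K e' r' g y"
  unfolding strip_op_kop by (intro kop_mono mult_mono) (auto split: split_indicator)

lemma strip_op_pow_mono:
  "y \<in> space Sigma' \<Longrightarrow> (\<And>z. z \<in> space Sigma' \<Longrightarrow> f z \<le> g z) \<Longrightarrow> e' \<le> e \<Longrightarrow> r \<le> r' \<Longrightarrow>
    (strip_op K e r ^^ n) f y \<le> (strip_op K e' r' ^^ n) g y"
  by (induction n arbitrary: y) (auto intro: strip_op_mono)

lemma kop_const: "y \<in> space Sigma' \<Longrightarrow> kop K (\<lambda>_. c) y = c"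
  unfolding kop_def using prob_space.emeasure_space_1[OF K_space(1)] by simp

lemma kop_pow_const: "y \<in> space Sigma' \<Longrightarrow> (kop K ^^ n) (\<lambda>_. c) y = c"
proof (induction n arbitrary: y)
  case (Suc n)
  have "kop K ((kop K ^^ n) (\<lambda>_. c)) y = kop K (\<lambda>_. c) y"
    using Suc by (intro antisym kop_mono) auto
  then show ?case using Suc.prems by (simp add: kop_const)
qed simp

lemma measurable_K:
  "y \<in> space Sigma' \<Longrightarrow> f \<in> borel_measurable Sigma' \<Longrightarrow> f \<in> borel_measurable (K y)"
  by (simp add: measurable_cong_sets[OF K_space(2) refl])

lemma strip_op_cmult_sum:
  assumes y: "y \<in> space Sigma'" and f: "\<And>i. i \<in> I \<Longrightarrow> f i \<in> borel_measurable Sigma'"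
  shows "strip_op K e r (\<lambda>z. \<Sum>i\<in>I. c i * f i z) y = (\<Sum>i\<in>I. c i * strip_op K e r (f i) y)"
proof -
  have "strip_op K e r (\<lambda>z. \<Sum>i\<in>I. c i * f i z) y
      = (\<integral>\<^sup>+ z. (\<Sum>i\<in>I. c i * (indicator {e<..r} (fst z) * f i z)) \<partial>K y)"
    unfolding strip_op_def by (intro nn_integral_cong) (simp add: sum_distrib_left mult_ac)
  also have "\<dots> = (\<Sum>i\<in>I. \<integral>\<^sup>+ z. c i * (indicator {e<..r} (fst z) * f i z) \<partial>K y)"
  proof (rule nn_integral_sum)
    fix i assume "i \<in> I"
    note f[OF this, measurable]
    have "(\<lambda>z. c i * (indicator {e<..r} (fst z) * f i z)) \<in> borel_measurable Sigma'" by measurable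
    then show "(\<lambda>z. c i * (indicator {e<..r} (fst z) * f i z)) \<in> borel_measurable (K y)"
      by (rule measurable_K[OF y])
  qed
  also have "\<dots> = (\<Sum>i\<in>I. c i * strip_op K e r (f i) y)"
  proof (rule sum.cong[OF refl])
    fix i assume "i \<in> I"
    note f[OF this, measurable]
    have "(\<lambda>z. indicator {e<..r} (fst z) * f i z) \<in> borel_measurable Sigma'" by measurable
    then show "(\<integral>\<^sup>+ z. c i * (indicator {e<..r} (fst z) * f i z) \<partial>K y) = c i * strip_op K e r (f i) y"
      unfolding strip_op_def by (intro nn_integral_cmult measurable_K[OF y])
  qed
  finally show ?thesis .
qed

lemma strip_op_pow_cmult_sum:
  assumes y: "y \<in> space Sigma'" and f: "\<And>i. i \<in> I \<Longrightarrow> f i \<in> borel_measurable Sigma'"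
  shows "(strip_op K e r ^^ n) (\<lambda>z. \<Sum>i\<in>I. c i * f i z) y = (\<Sum>i\<in>I. c i * (strip_op K e r ^^ n) (f i) y)"
  using y
proof (induction n arbitrary: y)
  case (Suc n)
  have "strip_op K e r ((strip_op K e r ^^ n) (\<lambda>z. \<Sum>i\<in>I. c i * f i z)) y
      = strip_op K e r (\<lambda>z. \<Sum>i\<in>I. c i * (strip_op K e r ^^ n) (f i) z) y"
    using Suc by (intro antisym strip_op_mono) auto
  also have "\<dots> = (\<Sum>i\<in>I. c i * strip_op K e r ((strip_op K e r ^^ n) (f i)) y)"
    by (intro strip_op_cmult_sum Suc.prems strip_op_pow_measurable f)
  finally show ?case by simp
qed simp

lemma strip_op_pow_cmult:
  assumes y: "y \<in> space Sigma'" and f: "f \<in> borel_measurable Sigma'"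
  shows "(strip_op K e r ^^ n) (\<lambda>z. c * f z) y = c * (strip_op K e r ^^ n) f y"
  using strip_op_pow_cmult_sum[OF y, where I="{()}" and f="\<lambda>_. f" and c="\<lambda>_. c"] f by simp

lemma strip_op_pow_add:
  assumes y: "y \<in> space Sigma'" and f: "f \<in> borel_measurable Sigma'" "g \<in> borel_measurable Sigma'"
  shows "(strip_op K e r ^^ n) (\<lambda>z. f z + g z) y = (strip_op K e r ^^ n) f y + (strip_op K e r ^^ n) g
      y"
  using strip_op_pow_cmult_sum[OF y, where I="{True, False}" and f="\<lambda>b. if b then f else g"
    and c="\<lambda>_. 1"] f by simp

lemma strip_op_le_kop: "y \<in> space Sigma' \<Longrightarrow> strip_op K e r f y \<le> kop K f y"
  unfolding strip_op_kop by (rule kop_mono) (auto split: split_indicator)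

lemma strip_op_pow_le_kop: "y \<in> space Sigma' \<Longrightarrow> (strip_op K e r ^^ n) f y \<le> (kop K ^^ n) f y"
proof (induction n arbitrary: y)
  case (Suc n)
  have "strip_op K e r ((strip_op K e r ^^ n) f) y \<le> kop K ((strip_op K e r ^^ n) f) y"
    by (rule strip_op_le_kop[OF Suc.prems])
  also have "\<dots> \<le> kop K ((kop K ^^ n) f) y" by (intro kop_mono Suc)
  finally show ?case by simp
qed simp

lemma strip_op_pow_ge:
  assumes q: "\<And>y. y \<in> space Sigma' \<Longrightarrow> q \<le> emeasure (K y) ({e<..r} \<times> UNIV)" and e: "0 < e"
    and y: "y \<in> space Sigma'"
  shows "q ^ n * c \<le> (strip_op K e r ^^ n) (\<lambda>_. c) y"
  using y
proof (induction n arbitrary: y)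
  case (Suc n)
  have s: "{e<..r} \<times> UNIV \<in> sets (Sigma' :: (real \<times> 's) measure)"
    unfolding Sigma'_def using e by (subst sets_restrict_space_iff) (auto simp: borel_prod[symmetric])
  have "(q ^ Suc n) * c \<le> emeasure (K y) ({e<..r} \<times> UNIV) * (q ^ n * c)"
    using mult_right_mono[OF q[OF Suc.prems], of "q ^ n * c"] by (simp add: mult_ac)
  also have "\<dots> = (\<integral>\<^sup>+ z. indicator ({e<..r} \<times> UNIV) z * (q ^ n * c) \<partial>K y)"
    using s by (subst nn_integral_multc) (auto simp: K_space[OF Suc.prems]
        intro!: measurable_K[OF Suc.prems])
  also have "\<dots> = strip_op K e r (\<lambda>_. q ^ n * c) y"
    unfolding strip_op_def by (intro nn_integral_cong) (auto split: split_indicator)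
  also have "\<dots> \<le> strip_op K e r ((strip_op K e r ^^ n) (\<lambda>_. c)) y"
    by (intro strip_op_mono Suc) auto
  finally show ?case by simp
qed simp

lemma hit_Suc: "hit K e r (Suc n) s y = strip_op K e r (\<lambda>z. hit K e r n (s - ln (fst z)) z) y"
  by (simp add: strip_op_def)

lemma hit_mono: "y \<in> space Sigma' \<Longrightarrow> s \<le> t \<Longrightarrow> hit K e r n t y \<le> hit K e r n s y"
proof (induction n arbitrary: s t y)
  case (Suc n)
  then show ?case unfolding hit_Suc by (intro strip_op_mono Suc.IH) auto
qed auto

lemma hit_mono_strip: "y \<in> space Sigma' \<Longrightarrow> e' \<le> e \<Longrightarrow> r \<le> r' \<Longrightarrow> hit K e r n s y \<le> hit K e' r' n s y"
proof (induction n arbitrary: s y)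
  case (Suc n)
  then show ?case unfolding hit_Suc by (intro strip_op_mono Suc.IH) auto
qed auto

lemma hit_zero:
  assumes "y \<in> space Sigma'" "real n * ln r < s"
  shows "hit K e r n s y = 0"
  using assms
proof (induction n arbitrary: s y)
  case (Suc n)
  have "hit K e r (Suc n) s y = (\<integral>\<^sup>+ z. 0 \<partial>K y)"
    unfolding hit.simps
  proof (intro nn_integral_cong)
    fix z assume "z \<in> space (K y)"
    then have z: "z \<in> space Sigma'" by (simp add: K_space[OF Suc.prems(1)])
    have "hit K e r n (s - ln (fst z)) z = 0" if "fst z \<in> {e<..r}"
    proof (rule Suc.IH[OF z])
      have "0 < fst z" using z by (auto simp: Sigma'_def space_restrict_space)
      then have "ln (fst z) \<le> ln r" using that by simp
      then show "real n * ln r < s - ln (fst z)" using Suc.prems(2) by (simp add: algebra_simps)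
    qed
    then show "indicator {e<..r} (fst z) * hit K e r n (s - ln (fst z)) z = 0"
      by (auto split: split_indicator)
  qed
  then show ?case by simp
qed auto

text \<open>In the strip a step gains at most \<open>ln r\<close>. Granting this gain in advance to
  \<open>m\<close> steps, one may forget that they stay in the strip.\<close>

lemma hit_le_kop:
  assumes "y \<in> space Sigma'"
  shows "hit K e r (n + m) s y \<le> (kop K ^^ m) (hit K e r n (s - real m * ln r)) y"
  using assms
proof (induction m arbitrary: s y)
  case (Suc m)
  have "hit K e r (n + Suc m) s y \<le> kop K (\<lambda>z. indicator {e<..r} (fst z) * hit K e r (n + m)
      (s - ln (fst z)) z) y"
    unfolding add_Suc_right hit_Suc strip_op_kop ..
  also have "\<dots> \<le> kop K ((kop K ^^ m) (hit K e r n (s - real (Suc m) * ln r))) y"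
  proof (rule kop_mono[OF Suc.prems])
    fix z :: "real \<times> 's" assume z: "z \<in> space Sigma'"
    have "hit K e r (n + m) (s - ln (fst z)) z \<le> (kop K ^^ m) (hit K e r n (s - real (Suc m) * ln r)) z"
      if "fst z \<in> {e<..r}"
    proof -
      have "0 < fst z" using z by (auto simp: Sigma'_def space_restrict_space)
      then have "ln (fst z) \<le> ln r" using that by simp
      then have "hit K e r (n + m) (s - ln (fst z)) z \<le> hit K e r (n + m) (s - ln r) z"
        by (intro hit_mono z) simp
      also have "\<dots> \<le> (kop K ^^ m) (hit K e r n (s - ln r - real m * ln r)) z" by (rule Suc.IH[OF z])
      finally show ?thesis by (simp add: algebra_simps)
    qed
    then show "indicator {e<..r} (fst z) * hit K e r (n + m) (s - ln (fst z)) z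
        \<le> (kop K ^^ m) (hit K e r n (s - real (Suc m) * ln r)) z"
      by (auto split: split_indicator)
  qed
  finally show ?case by simp
qed simp

text \<open>The converse direction: a preliminary step inside the strip spoils the sum by at most
  \<open>- ln e\<close>.\<close>

lemma strip_op_pow_hit_le:
  assumes "y \<in> space Sigma'" and e: "0 < e"
  shows "(strip_op K e r ^^ m) (hit K e r n s) y \<le> hit K e r (n + m) (s + real m * ln e) y"
  using assms(1)
proof (induction m arbitrary: s y)
  case (Suc m)
  have "strip_op K e r ((strip_op K e r ^^ m) (hit K e r n s)) y
      \<le> strip_op K e r (\<lambda>z. hit K e r (n + m) (s + real m * ln e) z) y"
    by (intro strip_op_mono Suc) auto
  also have "\<dots> \<le> strip_op K e r (\<lambda>z. hit K e r (n + m) (s + real (Suc m) * ln e - ln (fst z)) z) y"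
    unfolding strip_op_kop
  proof (rule kop_mono[OF Suc.prems])
    fix z :: "real \<times> 's" assume z: "z \<in> space Sigma'"
    have "hit K e r (n + m) (s + real m * ln e) z
        \<le> hit K e r (n + m) (s + real (Suc m) * ln e - ln (fst z)) z" if "fst z \<in> {e<..r}"
    proof (rule hit_mono[OF z])
      have "ln e \<le> ln (fst z)" using that e by simp
      then show "s + real (Suc m) * ln e - ln (fst z) \<le> s + real m * ln e" by (simp add: algebra_simps)
    qed
    then show "indicator {e<..r} (fst z) * hit K e r (n + m) (s + real m * ln e) z
        \<le> indicator {e<..r} (fst z) * hit K e r (n + m) (s + real (Suc m) * ln e - ln (fst z)) z"
      by (auto split: split_indicator)
  qed
  finally show ?case unfolding add_Suc_right hit_Suc by simp
qed simp

text \<open>Concatenation of blocks: the bound \<open>\<rho>\<close> for the second one holds from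
  every state in which the first may end.\<close>

lemma hit_add:
  assumes "y \<in> space Sigma'" and \<rho>: "\<And>z. z \<in> space Sigma' \<Longrightarrow> \<rho> \<le> hit K e r m t z"
  shows "hit K e r n s y * \<rho> \<le> hit K e r (n + m) (s + t) y"
  using assms(1)
proof (induction n arbitrary: s y)
  case 0
  have "\<rho> \<le> hit K e r m (s + t) y" if "s \<le> 0"
    using \<rho>[OF 0] hit_mono[OF 0, of "s + t" t] that by (meson add_le_same_cancel2 order_trans)
  then show ?case by simp
next
  case (Suc n)
  have "hit K e r (Suc n) s y * \<rho> = (\<integral>\<^sup>+ z. indicator {e<..r} (fst z) * hit K e r n (s - ln (fst z)) z
      * \<rho> \<partial>K y)"
    unfolding hit.simps
  proof (rule nn_integral_multc[symmetric], rule measurable_K[OF Suc.prems])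
    have "(\<lambda>z. hit K e r n (s - ln (fst z)) z) \<in> borel_measurable Sigma'"
      by (rule hit_measurable[OF K]) auto
    then show "(\<lambda>z. indicator {e<..r} (fst z) * hit K e r n (s - ln (fst z)) z) \<in> borel_measurable
        Sigma'" by measurable
  qed
  also have "\<dots> \<le> (\<integral>\<^sup>+ z. indicator {e<..r} (fst z) * hit K e r (n + m) (s + t - ln (fst z)) z \<partial>K y)"
  proof (intro nn_integral_mono)
    fix z assume "z \<in> space (K y)"
    then have "z \<in> space Sigma'" by (simp add: K_space[OF Suc.prems])
    from Suc.IH[OF this, of "s - ln (fst z)"]
    show "indicator {e<..r} (fst z) * hit K e r n (s - ln (fst z)) z * \<rho>
        \<le> indicator {e<..r} (fst z) * hit K e r (n + m) (s + t - ln (fst z)) z"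
      by (auto simp: algebra_simps split: split_indicator)
  qed
  finally show ?case by simp
qed

text \<open>Lengths are adjusted by appending steps that merely stay in the strip, each at the price
  of a factor \<open>q\<close> and of \<open>- ln e\<close> in the sum.\<close>

lemma hit_pad:
  assumes y: "y \<in> space Sigma'" and e: "0 < e"
    and q: "\<And>y. y \<in> space Sigma' \<Longrightarrow> q \<le> emeasure (K y) ({e<..r} \<times> UNIV)"
  shows "hit K e r n s y * q ^ m \<le> hit K e r (n + m) (s + real m * ln e) y"
proof (rule hit_add[OF y])
  fix z :: "real \<times> 's" assume z: "z \<in> space Sigma'"
  have "q ^ m * 1 \<le> (strip_op K e r ^^ m) (\<lambda>_. 1) z" by (rule strip_op_pow_ge[OF q e z])
  also have "\<dots> \<le> (strip_op K e r ^^ m) (hit K e r 0 0) z" by (intro strip_op_pow_mono z) auto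
  also have "\<dots> \<le> hit K e r (0 + m) (0 + real m * ln e) z" by (rule strip_op_pow_hit_le[OF z e])
  finally show "q ^ m \<le> hit K e r m (real m * ln e) z" by simp
qed

section \<open>Iterated kernels, the first assumption and tightness\<close>

lemma iter_kernel_measurable: "iter_kernel Sigma' K m \<in> Sigma' \<rightarrow>\<^sub>M prob_algebra Sigma'"
proof (induction m)
  case 0
  have "iter_kernel Sigma' K 0 = return Sigma'" by (rule ext) simp
  then show ?case by simp
next
  case (Suc m)
  have "iter_kernel Sigma' K (Suc m) = (\<lambda>x. K x \<bind> iter_kernel Sigma' K m)" by (rule ext) simp
  then show ?case using measurable_bind_prob_space[OF K Suc] by simp
qed

lemma nn_integral_iter_kernel:
  assumes "x \<in> space Sigma'" and f: "f \<in> borel_measurable Sigma'"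
  shows "(\<integral>\<^sup>+ z. f z \<partial>iter_kernel Sigma' K m x) = (kop K ^^ m) f x"
  using assms(1)
proof (induction m arbitrary: x)
  case 0 then show ?case by (simp add: nn_integral_return f)
next
  case (Suc m)
  have "(\<integral>\<^sup>+ z. f z \<partial>iter_kernel Sigma' K (Suc m) x)
      = (\<integral>\<^sup>+ y. (\<integral>\<^sup>+ z. f z \<partial>iter_kernel Sigma' K m y) \<partial>K x)"
    unfolding iter_kernel.simps
  proof (rule nn_integral_bind[OF f])
    show "iter_kernel Sigma' K m \<in> K x \<rightarrow>\<^sub>M subprob_algebra Sigma'"
      unfolding measurable_cong_sets[OF K_space(2)[OF Suc.prems] refl]
      by (rule measurable_prob_algebraD[OF iter_kernel_measurable])
  qed
  also have "\<dots> = kop K ((kop K ^^ m) f) x"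
    unfolding kop_def[of K _ x] by (intro nn_integral_cong) (simp add: Suc.IH K_space[OF Suc.prems])
  finally show ?case by simp
qed


lemma assumption1_kop:
  assumes "assumption1 K"
  obtains l N :: nat and k :: real where "0 < l" "l \<le> N" "1 \<le> k"
    "\<And>f x y. f \<in> borel_measurable Sigma' \<Longrightarrow> x \<in> space Sigma' \<Longrightarrow> y \<in> space Sigma' \<Longrightarrow>
      (kop K ^^ l) f x \<le> ennreal (k / real N) * (\<Sum>m=1..N. (kop K ^^ m) f y)"
proof -
  from assms obtain l N k where l: "0 < l" "l \<le> N" and k: "1 \<le> k"
    and le: "\<And>x y B. x \<in> space Sigma' \<Longrightarrow> y \<in> space Sigma' \<Longrightarrow> B \<in> sets (Sigma' :: (real \<times> 's) measure) \<Longrightarrow>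
        measure (iter_kernel Sigma' K l x) B \<le> k / real N * (\<Sum>m=1..N. measure (iter_kernel Sigma' K m y)
            B)"
    unfolding assumption1_def by blast
  have "(kop K ^^ l) f x \<le> ennreal (k / real N) * (\<Sum>m=1..N. (kop K ^^ m) f y)"
    if f: "f \<in> borel_measurable Sigma'" and x: "x \<in> space Sigma'" and y: "y \<in> space Sigma'" for f x y
    unfolding nn_integral_iter_kernel[OF x f, symmetric] nn_integral_iter_kernel[OF y f, symmetric]
  proof (rule nn_integral_le_sum_measures[OF _ _ _ _ f])
    have P: "prob_space (iter_kernel Sigma' K m z)" "sets (iter_kernel Sigma' K m z) = sets Sigma'"
      if "z \<in> space Sigma'" for m z
      using measurable_space[OF iter_kernel_measurable that] by (auto simp: space_prob_algebra)
    show "sets (iter_kernel Sigma' K l x) = sets Sigma'" by (rule P[OF x])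
    show "sets (iter_kernel Sigma' K m y) = sets Sigma'" for m by (rule P[OF y])
    fix B assume B: "B \<in> sets (Sigma' :: (real \<times> 's) measure)"
    have em: "emeasure (iter_kernel Sigma' K m z) B = ennreal (measure (iter_kernel Sigma' K m z) B)"
      if "z \<in> space Sigma'" for m z
    proof -
      interpret prob_space "iter_kernel Sigma' K m z" by (rule P[OF that])
      show ?thesis by (rule emeasure_eq_measure)
    qed
    have "emeasure (iter_kernel Sigma' K l x) B
        \<le> ennreal (k / real N * (\<Sum>m=1..N. measure (iter_kernel Sigma' K m y) B))"
      unfolding em[OF x] by (intro ennreal_leI le x y B)
    also have "\<dots> = ennreal (k / real N) * (\<Sum>m=1..N. emeasure (iter_kernel Sigma' K m y) B)"
    proof -
      have "ennreal (k / real N * (\<Sum>m=1..N. measure (iter_kernel Sigma' K m y) B))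
          = ennreal (k / real N) * ennreal (\<Sum>m=1..N. measure (iter_kernel Sigma' K m y) B)"
        by (rule ennreal_mult) (use k in \<open>auto intro: sum_nonneg\<close>)
      then show ?thesis by (simp only: em[OF y] sum_ennreal[OF measure_nonneg])
    qed
    finally show "emeasure (iter_kernel Sigma' K l x) B
        \<le> ennreal (k / real N) * (\<Sum>m=1..N. emeasure (iter_kernel Sigma' K m y) B)" .
  qed simp
  with l k that show ?thesis by blast
qed

text \<open>The hypothesis dominates the \<open>l\<close>-step laws from all starting points by one
  finite measure, built from the single point \<open>y0\<close>. The complements of the strips
  decrease to the empty set, so this measure gives them arbitrarily little mass. For
  \<open>j \<ge> l\<close> one conditions on the state after \<open>j - l\<close> steps.\<close>

lemma tight:
  assumes le: "\<And>f x y. f \<in> borel_measurable Sigma' \<Longrightarrow> x \<in> space Sigma' \<Longrightarrow> y \<in> space Sigma' \<Longrightarrow>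
      (kop K ^^ l) f x \<le> ennreal k * (\<Sum>m=1..N. (kop K ^^ m) f y)"
    and k: "0 \<le> k" and \<delta>: "0 < \<delta>" and e: "0 < e"
  obtains e' r' where "0 < e'" "e' \<le> e" "r \<le> r'"
    "\<And>y j. y \<in> space Sigma' \<Longrightarrow> l \<le> j \<Longrightarrow> (kop K ^^ j) (\<lambda>z. indicator (- {e'<..r'}) (fst z)) y \<le> ennreal \<delta>"
proof -
  define y0 :: "real \<times> 's" where "y0 = (1, undefined)"
  have y0: "y0 \<in> space Sigma'" by (simp add: y0_def Sigma'_def space_restrict_space)
  let ?\<nu> = "\<lambda>m. iter_kernel Sigma' K m y0"
  have P: "prob_space (?\<nu> m)" "sets (?\<nu> m) = sets Sigma'" for m
    using measurable_space[OF iter_kernel_measurable y0] by (auto simp: space_prob_algebra)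
  define E where "E i = min e (1 / (real i + 1))" for i :: nat
  define R where "R i = max r (real i)" for i :: nat
  define D where "D i = {z \<in> space (Sigma' :: (real \<times> 's) measure). fst z \<notin> {E i<..R i}}" for i
  have D: "D i \<in> sets Sigma'" for i unfolding D_def by measurable
  have dec: "decseq D"
  proof (intro decseq_SucI subsetI)
    fix i z assume "z \<in> D (Suc i)"
    moreover have "E (Suc i) \<le> E i" unfolding E_def by (intro min.mono) (auto simp: frac_le)
    moreover have "R i \<le> R (Suc i)" unfolding R_def by auto
    ultimately show "z \<in> D i" by (auto simp: D_def)
  qed
  have empty: "(\<Inter>i. D i) = {}"
  proof (rule ccontr)
    assume "(\<Inter>i. D i) \<noteq> {}"
    then obtain z where z: "\<And>i. z \<in> D i" by auto
    have z0: "0 < fst z" using z[of 0]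
      by (auto simp: D_def Sigma'_def space_restrict_space mem_Times_iff)
    obtain i where i: "1 / fst z < real i" using reals_Archimedean2 by blast
    obtain j where j: "fst z < real j" using reals_Archimedean2 by blast
    define m where "m = max i j"
    have "1 / fst z < real m + 1" using i by (simp add: m_def)
    then have "1 / (real m + 1) < fst z" using z0 by (simp add: divide_less_eq mult.commute)
    then have "E m < fst z" by (simp add: E_def)
    moreover have "fst z \<le> R m" using j by (simp add: R_def m_def)
    ultimately show False using z[of m] by (simp add: D_def)
  qed
  have "(\<lambda>i. measure (?\<nu> m) (D i)) \<longlonglongrightarrow> 0" for m
  proof -
    interpret prob_space "?\<nu> m" by (rule P)
    have "(\<lambda>i. measure (?\<nu> m) (D i)) \<longlonglongrightarrow> measure (?\<nu> m) (\<Inter>i. D i)"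
      using D dec by (intro finite_Lim_measure_decseq) (auto simp: P)
    then show ?thesis by (simp add: empty)
  qed
  then have "(\<lambda>i. k * (\<Sum>m=1..N. measure (?\<nu> m) (D i))) \<longlonglongrightarrow> k * (\<Sum>m=1..N. 0)"
    by (intro tendsto_intros)
  then have "eventually (\<lambda>i. k * (\<Sum>m=1..N. measure (?\<nu> m) (D i)) < \<delta>) sequentially"
    using \<delta> by (intro order_tendstoD(2)) auto
  then obtain i where i: "k * (\<Sum>m=1..N. measure (?\<nu> m) (D i)) < \<delta>"
    using eventually_happens trivial_limit_sequentially by blast
  let ?f = "\<lambda>z :: real \<times> 's. indicator (- {E i<..R i}) (fst z) :: ennreal"
  have f: "?f \<in> borel_measurable Sigma'" by measurable
  have fl: "(kop K ^^ l) ?f x \<le> ennreal \<delta>" if x: "x \<in> space Sigma'" for x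
  proof -
    have em: "(kop K ^^ m) ?f y0 = ennreal (measure (?\<nu> m) (D i))" for m
    proof -
      interpret prob_space "?\<nu> m" by (rule P)
      have "(kop K ^^ m) ?f y0 = (\<integral>\<^sup>+ z. ?f z \<partial>?\<nu> m)"
        by (rule nn_integral_iter_kernel[OF y0 f, symmetric])
      also have "\<dots> = (\<integral>\<^sup>+ z. indicator (D i) z \<partial>?\<nu> m)"
        using sets_eq_imp_space_eq[OF P(2)]
        by (intro nn_integral_cong) (auto simp: D_def split: split_indicator)
      also have "\<dots> = emeasure (?\<nu> m) (D i)" using D by (simp add: P)
      finally show ?thesis by (simp add: emeasure_eq_measure)
    qed
    have "(kop K ^^ l) ?f x \<le> ennreal k * (\<Sum>m=1..N. (kop K ^^ m) ?f y0)" by (rule le[OF f x y0])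
    also have "\<dots> = ennreal (k * (\<Sum>m=1..N. measure (?\<nu> m) (D i)))"
      using k by (simp add: em sum_ennreal ennreal_mult sum_nonneg)
    also have "\<dots> \<le> ennreal \<delta>" using i by (intro ennreal_leI) simp
    finally show ?thesis .
  qed
  show ?thesis
  proof (rule that[of "E i" "R i"])
    show "0 < E i" using e by (simp add: E_def)
    show "E i \<le> e" by (simp add: E_def)
    show "r \<le> R i" by (simp add: R_def)
    fix y :: "real \<times> 's" and j assume y: "y \<in> space Sigma'" and j: "l \<le> j"
    have "(kop K ^^ j) ?f y = (kop K ^^ (j - l)) ((kop K ^^ l) ?f) y"
      using j funpow_add[of "j - l" l "kop K"] by simp
    also have "\<dots> \<le> (kop K ^^ (j - l)) (\<lambda>_. ennreal \<delta>) y" by (intro kop_pow_mono y fl)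
    also have "\<dots> = ennreal \<delta>" by (rule kop_pow_const[OF y])
    finally show "(kop K ^^ j) ?f y \<le> ennreal \<delta>" .
  qed
qed

text \<open>A union bound over the times at which the free chain may be outside the strip; once it
  has left, \<open>G\<close> bounds what remains.\<close>

lemma kop_pow_le_strip_op:
  assumes g: "g \<in> borel_measurable Sigma'" and G: "\<And>z. z \<in> space Sigma' \<Longrightarrow> g z \<le> G"
    and y: "y \<in> space Sigma'"
  shows "(kop K ^^ m) g y \<le> (strip_op K e r ^^ m) g y + G
      * (\<Sum>i<m. (kop K ^^ Suc i) (\<lambda>z. indicator (- {e<..r}) (fst z)) y)"
  using y
proof (induction m arbitrary: y)
  case (Suc m)
  let ?f = "\<lambda>z :: real \<times> 's. indicator (- {e<..r}) (fst z) :: ennreal"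
  let ?s = "(strip_op K e r ^^ m) g"
  have f: "?f \<in> borel_measurable Sigma'" by measurable
  have sG: "?s z \<le> G" if z: "z \<in> space Sigma'" for z
  proof -
    have "?s z \<le> (kop K ^^ m) g z" by (rule strip_op_pow_le_kop[OF z])
    also have "\<dots> \<le> (kop K ^^ m) (\<lambda>_. G) z" by (intro kop_pow_mono z G)
    also have "\<dots> = G" by (rule kop_pow_const[OF z])
    finally show ?thesis .
  qed
  have [measurable]: "?s \<in> borel_measurable Sigma'" "\<And>i. (kop K ^^ Suc i) ?f \<in> borel_measurable Sigma'"
    by (rule strip_op_pow_measurable[OF g]) (rule kop_pow_measurable[OF f])
  have kadd: "kop K (\<lambda>z. u z + v z) y = kop K u y + kop K v y"
    if "u \<in> borel_measurable Sigma'" "v \<in> borel_measurable Sigma'" for u v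
    unfolding kop_def using that by (intro nn_integral_add measurable_K[OF Suc.prems])
  have ksum: "kop K (\<lambda>z. G * (\<Sum>i<m. (kop K ^^ Suc i) ?f z)) y = G * (\<Sum>i<m. (kop K ^^ Suc (Suc i)) ?f y)"
  proof -
    have "kop K (\<lambda>z. G * (\<Sum>i<m. (kop K ^^ Suc i) ?f z)) y
        = G * (\<integral>\<^sup>+ z. (\<Sum>i<m. (kop K ^^ Suc i) ?f z) \<partial>K y)"
      unfolding kop_def[of K _ y] by (intro nn_integral_cmult measurable_K[OF Suc.prems]) measurable
    also have "(\<integral>\<^sup>+ z. (\<Sum>i<m. (kop K ^^ Suc i) ?f z) \<partial>K y) = (\<Sum>i<m. \<integral>\<^sup>+ z. (kop K ^^ Suc i) ?f z \<partial>K y)"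
      by (intro nn_integral_sum measurable_K[OF Suc.prems] kop_pow_measurable f)
    also have "\<dots> = (\<Sum>i<m. (kop K ^^ Suc (Suc i)) ?f y)"
      unfolding kop_def[of K _ y, symmetric] by simp
    finally show ?thesis .
  qed
  have "(kop K ^^ Suc m) g y = kop K ((kop K ^^ m) g) y" by simp
  also have "\<dots> \<le> kop K (\<lambda>z. (indicator {e<..r} (fst z) * ?s z + G * ?f z) + G
      * (\<Sum>i<m. (kop K ^^ Suc i) ?f z)) y"
  proof (rule kop_mono[OF Suc.prems])
    fix z :: "real \<times> 's" assume z: "z \<in> space Sigma'"
    have "(kop K ^^ m) g z \<le> ?s z + G * (\<Sum>i<m. (kop K ^^ Suc i) ?f z)" by (rule Suc.IH[OF z])
    also have "?s z \<le> indicator {e<..r} (fst z) * ?s z + G * ?f z"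
      using sG[OF z] by (auto split: split_indicator)
    finally show "(kop K ^^ m) g z \<le> (indicator {e<..r} (fst z) * ?s z + G * ?f z) + G
        * (\<Sum>i<m. (kop K ^^ Suc i) ?f z)"
      by (simp add: add_right_mono)
  qed
  also have "\<dots> = (kop K (\<lambda>z. indicator {e<..r} (fst z) * ?s z) y + kop K (\<lambda>z. G * ?f z) y) + G
      * (\<Sum>i<m. (kop K ^^ Suc (Suc i)) ?f y)"
  proof -
    have "(\<lambda>z. indicator {e<..r} (fst z) * ?s z) \<in> borel_measurable Sigma'"
        "(\<lambda>z. G * ?f z) \<in> borel_measurable Sigma'"
      "(\<lambda>z. indicator {e<..r} (fst z) * ?s z + G * ?f z) \<in> borel_measurable Sigma'"
      "(\<lambda>z. G * (\<Sum>i<m. (kop K ^^ Suc i) ?f z)) \<in> borel_measurable Sigma'"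
      by measurable
    then show ?thesis by (simp only: ksum[symmetric] kadd)
  qed
  also have "kop K (\<lambda>z. G * ?f z) y = G * kop K ?f y"
    unfolding kop_def by (intro nn_integral_cmult measurable_K[OF Suc.prems] f)
  also have "kop K (\<lambda>z. indicator {e<..r} (fst z) * ?s z) y = (strip_op K e r ^^ Suc m) g y"
    unfolding strip_op_kop[symmetric] by simp
  also have "(strip_op K e r ^^ Suc m) g y + G * kop K ?f y + G * (\<Sum>i<m. (kop K ^^ Suc (Suc i)) ?f y)
     = (strip_op K e r ^^ Suc m) g y + G * (\<Sum>i<Suc m. (kop K ^^ Suc i) ?f y)"
    unfolding sum.lessThan_Suc_shift by (simp add: distrib_left add.assoc)
  finally show ?case .
qed simp


text \<open>A maximal success probability at one starting point is turned into a lower bound at all starting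
  points: the first assumption connects the starting points, and as it makes \<open>K\<^sup>l\<close> uniformly tight
  it suffices to enlarge the strip once. Only the first \<open>l - 1\<close> steps may leave every strip; there the
  second assumption (through \<open>q\<close>) is used.\<close>
lemma comparison:
  assumes A: "assumption1 K" and e: "0 < e" "e \<le> 1" and r: "1 \<le> r" and q: "0 < (q::real)"
    and qK: "\<And>y. y \<in> space Sigma' \<Longrightarrow> ennreal q \<le> emeasure (K y) ({e<..r} \<times> UNIV)"
  obtains l N :: nat and e' r' c w u :: real where "0 < N" "0 < e'" "e' \<le> 1" "0 < c" "0 \<le> w" "0 \<le> u"
    "\<And>n a x y. x \<in> space Sigma' \<Longrightarrow> y \<in> space Sigma' \<Longrightarrow>
       (\<And>z. z \<in> space Sigma' \<Longrightarrow> hit K e r (n + l) (a - w) z \<le> ennreal (2 * exp w) * hit K e r (n + l) a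
           x) \<Longrightarrow>
       ennreal c * hit K e r (n + l) a x \<le> hit K e' r' (n + l + N) (a - u) y"
proof -
  obtain l N :: nat and k :: real where l: "0 < l" "l \<le> N" and k: "1 \<le> k"
    and A1: "\<And>f x y. f \<in> borel_measurable Sigma' \<Longrightarrow> x \<in> space Sigma' \<Longrightarrow> y \<in> space Sigma' \<Longrightarrow>
      (kop K ^^ l) f x \<le> ennreal (k / real N) * (\<Sum>m=1..N. (kop K ^^ m) f y)"
    by (rule assumption1_kop[OF A]) (rule that; blast)
  \<comment> \<open>The \<open>l\<close> steps removed from a block may gain up to
    \<open>ln r\<close> each, while the \<open>l\<close> steps that pad it again guarantee only
    \<open>ln e\<close> each; \<open>w\<close> is the difference.\<close>
  define w where "w = real l * (ln r - ln e)"
  have w0: "0 \<le> w" unfolding w_def using e r by (intro mult_nonneg_nonneg) auto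
  define Q where "Q = q ^ (l - 1)"
  \<comment> \<open>\<open>G * p\<close> bounds the shortened success probability \<open>?g\<close>
    everywhere: padding by \<open>l\<close> steps costs \<open>q ^ l\<close>, and near maximality
    supplies \<open>2 * exp w\<close>.\<close>
  define G where "G = 2 * exp w / q ^ l"
  have Q0: "0 < Q" and G0: "0 < G" using q by (auto simp: Q_def G_def)
  have N0: "0 < N" using l by simp
  \<comment> \<open>Chosen so that the mass lost outside the enlarged strip amounts to
    \<open>Q / 2 * p\<close>, half of the lower bound \<open>Q * p\<close>.\<close>
  define \<delta> where "\<delta> = Q / (2 * k * G * real N)"
  have \<delta>0: "0 < \<delta>" unfolding \<delta>_def using Q0 G0 k N0 by simp
  have k': "0 \<le> k / real N" using k by simp
  obtain e' r' where e': "0 < e'" "e' \<le> e" and r': "r \<le> r'" and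
    ti: "\<And>y j. y \<in> space Sigma' \<Longrightarrow> l \<le> j \<Longrightarrow> (kop K ^^ j) (\<lambda>z. indicator (- {e'<..r'}) (fst z)) y
        \<le> ennreal \<delta>"
  proof (rule tight[of l "k / real N" N \<delta> e r, OF _ k' \<delta>0 e(1)])
    fix f :: "real \<times> 's \<Rightarrow> ennreal" and x y :: "real \<times> 's"
    assume "f \<in> borel_measurable Sigma'" "x \<in> space Sigma'" "y \<in> space Sigma'"
    then show "(kop K ^^ l) f x \<le> ennreal (k / real N) * (\<Sum>m=1..N. (kop K ^^ m) f y)" by (rule A1)
  qed (rule that; blast)
  have qK': "ennreal q \<le> emeasure (K y) ({e'<..r'} \<times> UNIV)" if y: "y \<in> space Sigma'" for y
  proof -
    have "{e'<..r'} \<times> UNIV \<in> sets (Sigma' :: (real \<times> 's) measure)"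
      unfolding Sigma'_def using e' by (subst sets_restrict_space_iff) (auto
          simp: borel_prod[symmetric])
    then have "emeasure (K y) ({e<..r} \<times> UNIV) \<le> emeasure (K y) ({e'<..r'} \<times> UNIV)"
      using e' r' by (intro emeasure_mono) (auto simp: K_space[OF y])
    with qK[OF y] show ?thesis by order
  qed
  \<comment> \<open>The removed steps gain up to \<open>ln r\<close> each, and the steps put in
    their place guarantee only \<open>ln e'\<close> each. The final threshold is lowered by
    \<open>u - ln e'\<close>, the extra step coming from the padding.\<close>
  define u where "u = real l * ln r - real (l - 1 + N) * ln e'"
  have le': "ln e' \<le> 0" using e' e by simp
  have u0: "0 \<le> u"
  proof -
    have "0 \<le> real l * ln r" using r by simp
    moreover have "real (l - 1 + N) * ln e' \<le> 0" using le' by (intro mult_nonneg_nonpos) auto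
    ultimately show ?thesis unfolding u_def by linarith
  qed
  define c where "c = Q * q ^ (N + 1) / (2 * k)"
  have c0: "0 < c" unfolding c_def using Q0 q k by simp
  show ?thesis
  proof (rule that[of N e' c w "u - ln e'" l r'])
    show "0 < N" "0 < e'" "0 < c" "0 \<le> w" by fact+
    show "e' \<le> 1" using e' e by simp
    show "0 \<le> u - ln e'" using u0 le' by simp
    fix n :: nat and a :: real and x y :: "real \<times> 's"
    assume x: "x \<in> space Sigma'" and y: "y \<in> space Sigma'"
      and near: "\<And>z. z \<in> space Sigma' \<Longrightarrow> hit K e r (n + l) (a - w) z
          \<le> ennreal (2 * exp w) * hit K e r (n + l) a x"
    define p where "p = enn2real (hit K e r (n + l) a x)"
    have "hit K e r (n + l) a x < \<top>" by (rule order.strict_trans1[OF hit_le_1[OF K x]]) simp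
    then have p: "hit K e r (n + l) a x = ennreal p" by (simp add: p_def)
    have p0: "0 \<le> p" by (simp add: p_def)
    let ?g = "hit K e r n (a - real l * ln r)"
    have g: "?g \<in> borel_measurable Sigma'" by (rule hit_measurable[OF K]) auto
    have pg: "ennreal p \<le> ennreal (k / real N) * (\<Sum>m=1..N. (kop K ^^ m) ?g z)" if z: "z \<in> space Sigma'"
      for z
    proof -
      have "ennreal p \<le> (kop K ^^ l) ?g x" unfolding p[symmetric] by (rule hit_le_kop[OF x])
      also have "\<dots> \<le> ennreal (k / real N) * (\<Sum>m=1..N. (kop K ^^ m) ?g z)" by (rule A1[OF g x z])
      finally show ?thesis .
    qed
    have gG: "?g z \<le> ennreal (G * p)" if z: "z \<in> space Sigma'" for z
    proof -
      have "?g z * ennreal q ^ l \<le> hit K e r (n + l) (a - real l * ln r + real l * ln e) z"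
        by (rule hit_pad[OF z e(1) qK])
      also have "a - real l * ln r + real l * ln e = a - w" by (simp add: w_def algebra_simps)
      also have "hit K e r (n + l) (a - w) z \<le> ennreal (2 * exp w) * ennreal p" using near[OF z]
        unfolding p .
      finally have 1: "?g z * ennreal (q ^ l) \<le> ennreal (2 * exp w * p)"
        using q by (simp add: ennreal_power ennreal_mult p0)
      have "?g z < \<top>" by (rule order.strict_trans1[OF hit_le_1[OF K z]]) simp
      then obtain g' where g': "?g z = ennreal g'" "0 \<le> g'" by (cases "?g z") auto
      have "g' * q ^ l \<le> 2 * exp w * p"
        using 1 g' q p0 by (simp add: ennreal_mult[symmetric])
      then have "g' \<le> G * p" using q by (simp add: G_def pos_le_divide_eq)
      then show ?thesis using g' by (simp add: ennreal_leI)
    qed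
    let ?f = "\<lambda>z :: real \<times> 's. indicator (- {e'<..r'}) (fst z) :: ennreal"
    have f: "?f \<in> borel_measurable Sigma'" by measurable
    \<comment> \<open>The first \<open>l - 1\<close> steps are kept in the original strip by means
      of \<open>q\<close>. All later times are at least \<open>l\<close>, where tightness controls
      leaving the enlarged strip.\<close>
    let ?S = "strip_op K e r ^^ (l - 1)" and ?S' = "strip_op K e' r'"
    define Y where "Y = (\<Sum>m=1..N. (?S' ^^ (l - 1 + m)) ?g y)"
    have split: "?S ((kop K ^^ m) ?g) y \<le> (?S' ^^ (l - 1 + m)) ?g y + ennreal (G * p * real N * \<delta>)"
      if m: "m \<le> N" for m
    proof -
      let ?b = "\<lambda>z. \<Sum>i<m. (kop K ^^ Suc i) ?f z"
      have b: "?b \<in> borel_measurable Sigma'" by (intro borel_measurable_sum kop_pow_measurable f)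
      have sm: "(?S' ^^ m) ?g \<in> borel_measurable Sigma'" by (rule strip_op_pow_measurable[OF g])
      have "?S ((kop K ^^ m) ?g) y \<le> ?S (\<lambda>z. (?S' ^^ m) ?g z + ennreal (G * p) * ?b z) y"
        by (intro strip_op_pow_mono y kop_pow_le_strip_op g gG) auto
      also have "\<dots> = ?S ((?S' ^^ m) ?g) y + ennreal (G * p) * ?S ?b y"
      proof -
        have "(\<lambda>z. ennreal (G * p) * ?b z) \<in> borel_measurable Sigma'" using b by measurable
        then show ?thesis using b sm by (simp only: strip_op_pow_add[OF y sm] strip_op_pow_cmult[OF y
            b])
      qed
      also have "?S ((?S' ^^ m) ?g) y \<le> (?S' ^^ (l - 1 + m)) ?g y"
      proof -
        have "?S ((?S' ^^ m) ?g) y \<le> (?S' ^^ (l - 1)) ((?S' ^^ m) ?g) y"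
          using e' r' by (intro strip_op_pow_mono y) auto
        then show ?thesis by (simp add: funpow_add)
      qed
      also have "?S ?b y \<le> ennreal (real N * \<delta>)"
      proof -
        have "?S ?b y = (\<Sum>i<m. 1 * ?S ((kop K ^^ Suc i) ?f) y)"
        proof -
          have "?S (\<lambda>z. \<Sum>i<m. 1 * (kop K ^^ Suc i) ?f z) y = (\<Sum>i<m. 1 * ?S ((kop K ^^ Suc i) ?f) y)"
            by (intro strip_op_pow_cmult_sum y kop_pow_measurable f)
          then show ?thesis by (simp only: mult_1)
        qed
        also have "\<dots> \<le> (\<Sum>i<m. ennreal \<delta>)"
        proof (intro sum_mono)
          fix i
          have "?S ((kop K ^^ Suc i) ?f) y \<le> (kop K ^^ (l - 1)) ((kop K ^^ Suc i) ?f) y"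
            by (rule strip_op_pow_le_kop[OF y])
          also have "\<dots> = (kop K ^^ (l - 1 + Suc i)) ?f y" by (simp only: funpow_add comp_def)
          also have "\<dots> \<le> ennreal \<delta>" using l by (intro ti y) simp
          finally show "1 * ?S ((kop K ^^ Suc i) ?f) y \<le> ennreal \<delta>" by simp
        qed
        also have "\<dots> = ennreal (real m * \<delta>)" using \<delta>0 by (subst sum_ennreal) auto
        also have "\<dots> \<le> ennreal (real N * \<delta>)" using m \<delta>0 by (intro ennreal_leI mult_right_mono) auto
        finally show ?thesis .
      qed
      finally show ?thesis using G0 p0 \<delta>0
        by (simp add: ennreal_mult[symmetric] mult.assoc add_mono mult_left_mono)
    qed
    have "ennreal (Q * p) \<le> ?S (\<lambda>_. ennreal p) y"
      using strip_op_pow_ge[OF qK e(1) y, of "l - 1" "ennreal p"] q p0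
      by (simp add: Q_def ennreal_mult ennreal_power)
    also have "\<dots> \<le> ?S (\<lambda>z. \<Sum>m=1..N. ennreal (k / real N) * (kop K ^^ m) ?g z) y"
      using pg by (intro strip_op_pow_mono y) (auto simp: sum_distrib_left)
    also have "\<dots> = (\<Sum>m=1..N. ennreal (k / real N) * ?S ((kop K ^^ m) ?g) y)"
      by (intro strip_op_pow_cmult_sum y kop_pow_measurable g)
    also have "\<dots> \<le> (\<Sum>m=1..N. ennreal (k / real N) * ((?S' ^^ (l - 1 + m)) ?g y + ennreal (G * p * real N
        * \<delta>)))"
      by (intro sum_mono mult_left_mono split) auto
    also have "\<dots> = ennreal (k / real N) * (Y + ennreal (real N * (G * p * real N * \<delta>)))"
      using G0 p0 \<delta>0 by (simp add: Y_def sum_distrib_left[symmetric] sum.distrib ennreal_mult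
          ennreal_of_nat_eq_real_of_nat)
    also have "\<dots> = ennreal (k / real N) * Y + ennreal (Q / 2 * p)"
    proof -
      have "k / real N * (real N * (G * p * real N * \<delta>)) = Q / 2 * p"
        unfolding \<delta>_def using N0 G0 k by simp
      moreover have "ennreal (k / real N) * ennreal (real N * (G * p * real N * \<delta>))
          = ennreal (k / real N * (real N * (G * p * real N * \<delta>)))"
        by (rule ennreal_mult[symmetric]) (use k' G0 p0 \<delta>0 in auto)
      ultimately show ?thesis by (simp only: distrib_left)
    qed
    finally have main: "ennreal (Q * p) \<le> ennreal (k / real N) * Y + ennreal (Q / 2 * p)" .
    have half: "ennreal (Q / 2 * p) \<le> ennreal (k / real N) * Y"
    proof (cases "ennreal (k / real N) * Y")
      case (real v)
      then have "Q * p \<le> v + Q / 2 * p"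
        using main Q0 p0 by (simp add: ennreal_plus[symmetric] del: ennreal_plus)
      then show ?thesis using real by (simp add: ennreal_leI)
    next
      case top
      then show ?thesis by simp
    qed
    let ?h = "hit K e' r' (n + l + N) (a - (u - ln e')) y"
    have Yh: "Y * ennreal (q ^ (N + 1)) \<le> of_nat N * ?h"
    proof -
      have q1: "ennreal q \<le> 1"
      proof -
        have "ennreal q \<le> emeasure (K y) (space (K y))"
          by (rule order_trans[OF qK[OF y] emeasure_space])
        then show ?thesis using prob_space.emeasure_space_1[OF K_space(1)[OF y]] by simp
      qed
      \<comment> \<open>The averaging in the first assumption produces blocks of different lengths
        \<open>n + (l - 1 + m)\<close>. Appending \<open>N + 1 - m\<close> steps brings all of them
        to \<open>n + l + N\<close>.\<close>
      have "(?S' ^^ (l - 1 + m)) ?g y * ennreal (q ^ (N + 1)) \<le> ?h" if m: "m \<in> {1..N}" for m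
      proof -
        have "(?S' ^^ (l - 1 + m)) ?g y \<le> (?S' ^^ (l - 1 + m)) (hit K e' r' n (a - real l * ln r)) y"
          using e' r' by (intro strip_op_pow_mono y hit_mono_strip) auto
        also have "\<dots> \<le> hit K e' r' (n + (l - 1 + m)) (a - real l * ln r + real (l - 1 + m) * ln e') y"
          by (rule strip_op_pow_hit_le[OF y e'(1)])
        finally have 1: "(?S' ^^ (l - 1 + m)) ?g y
            \<le> hit K e' r' (n + (l - 1 + m)) (a - real l * ln r + real (l - 1 + m) * ln e') y" .
        have "ennreal (q ^ (N + 1)) \<le> ennreal q ^ (N + 1 - m)"
        proof -
          have "ennreal (q ^ (N + 1)) = ennreal q ^ (N + 1)" using q
            by (simp only: ennreal_power less_imp_le)
          also have "\<dots> \<le> ennreal q ^ (N + 1 - m)" by (intro power_decreasing q1) auto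
          finally show ?thesis .
        qed
        then have "(?S' ^^ (l - 1 + m)) ?g y * ennreal (q ^ (N + 1))
            \<le> hit K e' r' (n + (l - 1 + m)) (a - real l * ln r + real (l - 1 + m) * ln e') y * ennreal q
            ^ (N + 1 - m)"
          using 1 by (intro mult_mono) auto
        also have "\<dots> \<le> hit K e' r' (n + (l - 1 + m) + (N + 1 - m)) (a - real l * ln r + real (l - 1 + m)
            * ln e' + real (N + 1 - m) * ln e') y"
          by (rule hit_pad[OF y e'(1) qK'])
        also have "n + (l - 1 + m) + (N + 1 - m) = n + l + N" using m l by simp
        also have "a - real l * ln r + real (l - 1 + m) * ln e' + real (N + 1 - m) * ln e'
            = a - (u - ln e')"
          using m l by (simp add: u_def of_nat_diff algebra_simps)
        finally show ?thesis .
      qed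
      then have "(\<Sum>m=1..N. (?S' ^^ (l - 1 + m)) ?g y * ennreal (q ^ (N + 1))) \<le> (\<Sum>m=1..N. ?h)"
        by (rule sum_mono)
      then show ?thesis by (simp add: Y_def sum_distrib_right)
    qed
    have "ennreal c * ennreal p = ennreal (q ^ (N + 1) / k) * ennreal (Q / 2 * p)"
      using c0 p0 q k Q0 by (simp add: c_def ennreal_mult[symmetric] mult_ac)
    also have "\<dots> \<le> ennreal (q ^ (N + 1) / k) * (ennreal (k / real N) * Y)"
      by (intro mult_left_mono half) simp
    also have "\<dots> = ennreal (1 / real N) * (Y * ennreal (q ^ (N + 1)))"
    proof -
      have "ennreal (q ^ (N + 1) / k) * ennreal (k / real N)
          = ennreal (1 / real N) * ennreal (q ^ (N + 1))"
        using k q N0 by (subst (1 2) ennreal_mult[symmetric]) auto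
      then have "ennreal (q ^ (N + 1) / k) * ennreal (k / real N) * Y
          = ennreal (1 / real N) * ennreal (q ^ (N + 1)) * Y"
        by (rule arg_cong)
      then show ?thesis by (simp only: mult_ac)
    qed
    also have "\<dots> \<le> ennreal (1 / real N) * (of_nat N * ?h)" by (intro mult_left_mono Yh) simp
    also have "\<dots> = ?h"
    proof -
      have "ennreal (1 / real N) * of_nat N = 1"
        using N0 by (simp add: ennreal_of_nat_eq_real_of_nat ennreal_mult[symmetric])
      then show ?thesis by (simp add: mult.assoc[symmetric])
    qed
    finally show "ennreal c * hit K e r (n + l) a x \<le> ?h" unfolding p .
  qed
qed

end

section \<open>Exponential moments and uniform blocks\<close>

text \<open>The parameters served by elements with \<open>u > 0\<close> and those served by elements
  with \<open>v > 0\<close> form two open sets covering the unit interval, so they meet by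
  connectedness. At a common parameter the two elements lie on the positive side of one line, and if
  neither is in the quadrant they lie on opposite sides of it; a positive combination then enters
  the quadrant.\<close>

lemma cone_meets_positive_quadrant:
  fixes S :: "(real \<times> real) set"
  assumes add: "\<And>x y. x \<in> S \<Longrightarrow> y \<in> S \<Longrightarrow> x + y \<in> S"
    and cover: "\<And>l. 0 \<le> l \<Longrightarrow> l \<le> 1 \<Longrightarrow> \<exists>(u, v)\<in>S. 0 < (1 - l) * u + l * v"
  shows "\<exists>(u, v)\<in>S. 0 < u \<and> 0 < v"
proof (rule ccontr)
  assume neg: "\<not> (\<exists>(u, v)\<in>S. 0 < u \<and> 0 < v)"
  define O1 where "O1 = (\<Union>(u, v)\<in>{(u, v)\<in>S. 0 < u}. {l. 0 < (1 - l) * u + l * v})"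
  define O2 where "O2 = (\<Union>(u, v)\<in>{(u, v)\<in>S. 0 < v}. {l. 0 < (1 - l) * u + l * v})"
  have op: "open {l::real. 0 < (1 - l) * u + l * v}" for u v
    by (intro open_Collect_less continuous_intros)
  have o: "open O1" "open O2" unfolding O1_def O2_def by (auto intro!: open_UN op)
  have sub: "{0..1} \<subseteq> O1 \<union> O2"
  proof
    fix l :: real assume l: "l \<in> {0..1}"
    then obtain u v where uv: "(u, v) \<in> S" "0 < (1 - l) * u + l * v" using cover[of l] by auto
    have "0 < u \<or> 0 < v"
    proof (rule ccontr)
      assume "\<not> (0 < u \<or> 0 < v)"
      then have "(1 - l) * u \<le> 0" "l * v \<le> 0" using l by (auto intro!: mult_nonneg_nonpos)
      with uv(2) show False by linarith
    qed
    with uv show "l \<in> O1 \<union> O2" unfolding O1_def O2_def by blast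
  qed
  have "0 \<in> O1" using cover[of 0] unfolding O1_def by fastforce
  moreover have "1 \<in> O2" using cover[of 1] unfolding O2_def by fastforce
  ultimately have "O1 \<inter> O2 \<inter> {0..1} \<noteq> {}"
    using connectedD[OF connected_Icc[of "0::real" 1] o _ sub] by force
  then obtain l u1 v1 u2 v2 where l: "0 \<le> l" "l \<le> 1"
    and 1: "(u1, v1) \<in> S" "0 < u1" "0 < (1 - l) * u1 + l * v1"
    and 2: "(u2, v2) \<in> S" "0 < v2" "0 < (1 - l) * u2 + l * v2"
    unfolding O1_def O2_def by auto
  have v1: "v1 \<le> 0" and u2: "u2 \<le> 0" using neg 1 2 by force+
  have l0: "0 < l" using l u2 2(3) by (cases "l = 0") auto
  have l1: "l < 1" using l v1 1(3) by (cases "l = 1") auto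
  have "(l * - v1) * ((1 - l) * - u2) < ((1 - l) * u1) * (l * v2)"
  proof (rule mult_strict_mono')
    show "l * - v1 < (1 - l) * u1" using 1(3) by linarith
    show "(1 - l) * - u2 < l * v2" using 2(3) by linarith
    show "0 \<le> l * - v1" "0 \<le> (1 - l) * - u2" using u2 v1 l0 l1 by (simp_all add: mult_nonneg_nonpos)
  qed
  then have "l * (1 - l) * (v1 * u2) < l * (1 - l) * (u1 * v2)" by (simp add: algebra_simps)
  then have det: "v1 * u2 < u1 * v2" using l0 l1 by (simp add: mult_less_cancel_left_pos)
  \<comment> \<open>The ratio of the two coefficients ranges over an open interval, nonempty by
    \<open>det\<close>. A rational ratio is taken since closure under addition provides positive
    integer multiples only.\<close>
  have "\<exists>x::real. - u2 / u1 < x \<and> x \<in> \<rat> \<and> 0 < x * v1 + v2"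
  proof (cases "v1 = 0")
    case True
    have "\<exists>x\<in>\<rat>. - u2 / u1 < x \<and> x < - u2 / u1 + 1" by (rule Rats_dense_in_real) simp
    then show ?thesis using True 2 by auto
  next
    case False
    then have v1': "v1 < 0" using v1 by simp
    have "- u2 / u1 < v2 / - v1" using det 1(2) v1' by (simp add: field_simps)
    then obtain x where x: "x \<in> \<rat>" "- u2 / u1 < x" "x < v2 / - v1" using Rats_dense_in_real by blast
    have pv: "0 < - v1" using v1' by simp
    have "x * - v1 < v2" using x(3) unfolding pos_less_divide_eq[OF pv] .
    then show ?thesis using x by auto
  qed
  then obtain x where x: "- u2 / u1 < x" "x \<in> \<rat>" "0 < x * v1 + v2" by blast
  have xu: "0 < x * u1 + u2" using x(1) unfolding pos_divide_less_eq[OF 1(2)] by linarith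
  have "0 \<le> - u2 / u1" using u2 1(2) by (intro divide_nonneg_pos) auto
  then have x0: "0 < x" using x(1) by linarith
  obtain i n where xi: "x = of_int i / of_nat n" "(n::nat) \<noteq> 0"
    using x(2) unfolding Rats_eq_int_div_nat by auto
  have i: "0 < i" using x0 xi by (simp add: zero_less_divide_iff)
  have mult: "Suc k *\<^sub>R y \<in> S" if "y \<in> S" for k y
  proof (induction k)
    case (Suc k)
    have "real (Suc (Suc k)) = real (Suc k) + 1" by simp
    then have "real (Suc (Suc k)) *\<^sub>R y = real (Suc k) *\<^sub>R y + y"
      by (simp only: scaleR_left_distrib scaleR_one)
    then show ?case using add[OF Suc that] by (simp only:)
  qed (use that in simp)
  have "real (nat i) *\<^sub>R (u1, v1) \<in> S" using mult[OF 1(1), of "nat i - 1"] i by simp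
  moreover have "real n *\<^sub>R (u2, v2) \<in> S" using mult[OF 2(1), of "n - 1"] xi by simp
  ultimately have "real (nat i) *\<^sub>R (u1, v1) + real n *\<^sub>R (u2, v2) \<in> S" by (rule add)
  moreover have "0 < real (nat i) * u1 + real n * u2"
  proof -
    have "real n * (x * u1 + u2) = real (nat i) * u1 + real n * u2" using xi i
      by (simp add: field_simps)
    then show ?thesis using mult_pos_pos[of "real n", OF _ xu] xi by simp
  qed
  moreover have "0 < real (nat i) * v1 + real n * v2"
  proof -
    have "real n * (x * v1 + v2) = real (nat i) * v1 + real n * v2" using xi i
      by (simp add: field_simps)
    then show ?thesis using mult_pos_pos[of "real n", OF _ x(3)] xi by simp
  qed
  ultimately show False using neg by auto
qed

context markov_kernel begin

definition tilt :: "real \<Rightarrow> real \<Rightarrow> real \<Rightarrow> (real \<times> 's \<Rightarrow> ennreal) \<Rightarrow> real \<times> 's \<Rightarrow> ennreal" where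
  "tilt l e r f = strip_op K e r (\<lambda>z. ennreal (fst z powr l) * f z)"

lemma tilt_pow_measurable: "(tilt l e r ^^ n) (\<lambda>_. 1) \<in> borel_measurable Sigma'"
proof (induction n)
  case (Suc n)
  note Suc[measurable]
  show ?case
    unfolding funpow.simps comp_def tilt_def[of l e r "(tilt l e r ^^ n) (\<lambda>_. 1)"]
    by (rule strip_op_measurable) measurable
qed simp

text \<open>The offset \<open>\<theta>\<close> collects the logarithms of the steps already made,
  and a path is sorted by the integer part \<open>j\<close> of its final value. On such a path the
  tilt is at most \<open>exp (l * (j + 1))\<close>, as \<open>l \<ge> 0\<close>, and the remaining
  sum is at least \<open>j - \<theta>\<close>.\<close>

lemma tilt_pow_le_sum_hit:
  assumes "y \<in> space Sigma'" and e: "0 < e" and l: "0 \<le> l" and J: "finite J"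
    and "\<And>v. \<theta> + real n * ln e \<le> v \<Longrightarrow> v \<le> \<theta> + real n * ln r \<Longrightarrow> \<lfloor>v\<rfloor> \<in> J"
  shows "(tilt l e r ^^ n) (\<lambda>_. 1) y * ennreal (exp (l * \<theta>))
      \<le> (\<Sum>j\<in>J. ennreal (exp (l * (of_int j + 1))) * hit K e r n (of_int j - \<theta>) y)"
  using assms(1,5)
proof (induction n arbitrary: \<theta> y)
  case 0
  have j: "\<lfloor>\<theta>\<rfloor> \<in> J" using 0(2)[of \<theta>] by simp
  have "l * \<theta> \<le> l * (of_int \<lfloor>\<theta>\<rfloor> + 1)" using l by (intro mult_left_mono) linarith+
  then have "ennreal (exp (l * \<theta>)) \<le> ennreal (exp (l * (of_int \<lfloor>\<theta>\<rfloor> + 1))) * hit K e r 0 (of_int \<lfloor>\<theta>\<rfloor> - \<theta>)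
      y"
    by (simp add: ennreal_leI)
  also have "\<dots> \<le> (\<Sum>j\<in>J. ennreal (exp (l * (of_int j + 1))) * hit K e r 0 (of_int j - \<theta>) y)"
    by (rule member_le_sum[OF j]) (auto simp: J)
  finally show ?case by simp
next
  case (Suc n)
  have tm: "(\<lambda>z. ennreal (fst z powr l) * (tilt l e r ^^ n) (\<lambda>_. 1) z) \<in> borel_measurable Sigma'"
  proof -
    note tilt_pow_measurable[measurable]
    show ?thesis by measurable
  qed
  have "(tilt l e r ^^ Suc n) (\<lambda>_. 1) y * ennreal (exp (l * \<theta>))
      = (\<integral>\<^sup>+ z. indicator {e<..r} (fst z) * (ennreal (fst z powr l) * (tilt l e r ^^ n) (\<lambda>_. 1) z) *
          ennreal (exp (l * \<theta>)) \<partial>K y)"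
    unfolding funpow.simps comp_def tilt_def[of l e r "(tilt l e r ^^ n) (\<lambda>_. 1)"] strip_op_def
    by (rule nn_integral_multc[symmetric], rule measurable_K[OF Suc.prems(1)]) (use tm in measurable)
  also have "\<dots> \<le> strip_op K e r (\<lambda>z. \<Sum>j\<in>J. ennreal (exp (l * (of_int j + 1))) * hit K e r n
      (of_int j - \<theta> - ln (fst z)) z) y"
    unfolding strip_op_def
  proof (intro nn_integral_mono)
    fix z assume "z \<in> space (K y)"
    then have z: "z \<in> space Sigma'" by (simp add: K_space[OF Suc.prems(1)])
    have "ennreal (fst z powr l) * (tilt l e r ^^ n) (\<lambda>_. 1) z * ennreal (exp (l * \<theta>))
        \<le> (\<Sum>j\<in>J. ennreal (exp (l * (of_int j + 1))) * hit K e r n (of_int j - \<theta> - ln (fst z)) z)"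
      if D: "fst z \<in> {e<..r}"
    proof -
      have A: "0 < fst z" "ln e \<le> ln (fst z)" "ln (fst z) \<le> ln r" using D e by auto
      have "ennreal (fst z powr l) * ennreal (exp (l * \<theta>)) = ennreal (exp (l * (\<theta> + ln (fst z))))"
        using A(1) by (simp add: ennreal_mult[symmetric] powr_def exp_add[symmetric] algebra_simps)
      then have "ennreal (fst z powr l) * ennreal (exp (l * \<theta>)) * (tilt l e r ^^ n) (\<lambda>_. 1) z
          = ennreal (exp (l * (\<theta> + ln (fst z)))) * (tilt l e r ^^ n) (\<lambda>_. 1) z"
        by (rule arg_cong)
      then have "ennreal (fst z powr l) * (tilt l e r ^^ n) (\<lambda>_. 1) z * ennreal (exp (l * \<theta>))
          = (tilt l e r ^^ n) (\<lambda>_. 1) z * ennreal (exp (l * (\<theta> + ln (fst z))))"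
        by (simp only: mult_ac)
      also have "\<dots> \<le> (\<Sum>j\<in>J. ennreal (exp (l * (of_int j + 1))) * hit K e r n
          (of_int j - (\<theta> + ln (fst z))) z)"
      proof (rule Suc.IH[OF z])
        fix v assume v: "\<theta> + ln (fst z) + real n * ln e \<le> v" "v \<le> \<theta> + ln (fst z) + real n * ln r"
        have "real (Suc n) * x = real n * x + x" for x :: real by (simp add: algebra_simps)
        then show "\<lfloor>v\<rfloor> \<in> J" using v A by (intro Suc.prems(2)) simp_all
      qed
      finally show ?thesis by (simp add: diff_diff_eq)
    qed
    then show "indicator {e<..r} (fst z) * (ennreal (fst z powr l) * (tilt l e r ^^ n) (\<lambda>_. 1) z)
        * ennreal (exp (l * \<theta>)) \<le>
       indicator {e<..r} (fst z) * (\<Sum>j\<in>J. ennreal (exp (l * (of_int j + 1))) * hit K e r n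
           (of_int j - \<theta> - ln (fst z)) z)"
      by (auto split: split_indicator)
  qed
  also have "\<dots> = (\<Sum>j\<in>J. ennreal (exp (l * (of_int j + 1))) * hit K e r (Suc n) (of_int j - \<theta>) y)"
    unfolding hit_Suc by (intro strip_op_cmult_sum Suc.prems hit_measurable[OF K]) auto
  finally show ?case .
qed

text \<open>The moment splits into a number of level sets of the sum of logarithms that grows only linearly
  in \<open>n\<close>, so some \<open>(a, x)\<close> nearly maximising \<open>hit K e r n a x * exp (l * a)\<close> carries the exponential
  growth; being near maximal controls all other starting points.\<close>
lemma near_maximiser:
  assumes y: "y \<in> space Sigma'" and e: "0 < e" "e \<le> 1" and r: "1 \<le> r" and l: "0 \<le> l" "l \<le> 1"
    and B: "0 < B"
    and ge: "ennreal B \<le> (tilt l e r ^^ n) (\<lambda>_. 1) y" and w: "0 \<le> w"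
  obtains a x p where "x \<in> space Sigma'" "0 < p" "hit K e r n a x = ennreal p"
    "B / (2 * exp 1 * (real n * (ln r - ln e) + 2)) \<le> p * exp (l * a)"
    "\<And>z. z \<in> space Sigma' \<Longrightarrow> hit K e r n (a - w) z \<le> ennreal (2 * exp w) * hit K e r n a x"
proof -
  let ?P = "(UNIV :: real set) \<times> space (Sigma' :: (real \<times> 's) measure)"
  let ?v = "\<lambda>p. hit K e r n (fst p) (snd p) * ennreal (exp (l * fst p))"
  \<comment> \<open>The supremum runs over all thresholds and starting points. It is finite since no
    path in the strip sums to more than \<open>n * ln r\<close>.\<close>
  define V where "V = (SUP p\<in>?P. ?v p)"
  have "V \<le> ennreal (exp (l * (real n * ln r)))"
    unfolding V_def
  proof (rule SUP_least)
    fix p assume p: "p \<in> ?P"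
    then have s: "snd p \<in> space Sigma'" by auto
    show "?v p \<le> ennreal (exp (l * (real n * ln r)))"
    proof (cases "real n * ln r < fst p")
      case True
      then show ?thesis using hit_zero[OF s] by simp
    next
      case False
      then have "exp (l * fst p) \<le> exp (l * (real n * ln r))" using l by (simp add: mult_left_mono)
      then have "?v p \<le> 1 * ennreal (exp (l * (real n * ln r)))"
        by (intro mult_mono hit_le_1[OF K s] ennreal_leI) auto
      then show ?thesis by simp
    qed
  qed
  also have "\<dots> < \<top>" by simp
  finally obtain V' where V': "V = ennreal V'" "0 \<le> V'" by (cases V) auto
  have hV: "?v (a, x) \<le> ennreal V'" if "x \<in> space Sigma'" for a x
    unfolding V'(1)[symmetric] V_def by (rule SUP_upper) (use that in auto)
  define J where "J = {\<lfloor>real n * ln e\<rfloor>..\<lfloor>real n * ln r\<rfloor>}"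
  have le: "real n * ln e \<le> real n * ln r" using e r by (intro mult_left_mono) auto
  then have "\<lfloor>real n * ln e\<rfloor> \<le> \<lfloor>real n * ln r\<rfloor>" by (rule floor_mono)
  then have "real (card J) = of_int (\<lfloor>real n * ln r\<rfloor> - \<lfloor>real n * ln e\<rfloor> + 1)" by (simp add: J_def)
  also have "\<dots> \<le> real n * (ln r - ln e) + 2" by (simp add: algebra_simps) linarith
  finally have cJ: "real (card J) \<le> real n * (ln r - ln e) + 2" .
  define W where "W = real n * (ln r - ln e) + 2"
  have W: "0 < W" unfolding W_def using le by (simp add: algebra_simps)
  have "ennreal B \<le> (tilt l e r ^^ n) (\<lambda>_. 1) y * ennreal (exp (l * 0))" using ge by simp
  also have "\<dots> \<le> (\<Sum>j\<in>J. ennreal (exp (l * (of_int j + 1))) * hit K e r n (of_int j - 0) y)"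
    by (rule tilt_pow_le_sum_hit[OF y e(1) l(1)]) (auto simp: J_def intro: floor_mono)
  also have "\<dots> \<le> (\<Sum>j\<in>J. ennreal (exp 1) * ennreal V')"
  proof (rule sum_mono)
    fix j :: int
    have "exp (l * (of_int j + 1)) \<le> exp 1 * exp (l * of_int j)"
      using l by (simp add: exp_add[symmetric] algebra_simps)
    then have "ennreal (exp (l * (of_int j + 1))) * hit K e r n (of_int j - 0) y
        \<le> ennreal (exp 1 * exp (l * of_int j)) * hit K e r n (of_int j) y"
      by (intro mult_mono ennreal_leI) auto
    also have "\<dots> = ennreal (exp 1) * ?v (of_int j, y)" by (simp add: ennreal_mult mult_ac)
    also have "\<dots> \<le> ennreal (exp 1) * ennreal V'" by (intro mult_left_mono hV y) simp
    finally show "ennreal (exp (l * (of_int j + 1))) * hit K e r n (of_int j - 0) y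
        \<le> ennreal (exp 1) * ennreal V'" .
  qed
  also have "\<dots> = ennreal (real (card J) * (exp 1 * V'))"
    using V' by (simp add: ennreal_mult ennreal_of_nat_eq_real_of_nat)
  finally have "B \<le> real (card J) * (exp 1 * V')" using V' by (simp add: ennreal_le_iff)
  also have "\<dots> \<le> W * (exp 1 * V')" using cJ V' unfolding W_def by (intro mult_right_mono) auto
  finally have BV: "B \<le> W * (exp 1 * V')" .
  then have "0 < W * (exp 1 * V')" using B by linarith
  then have V0: "0 < V'" using W by (simp add: zero_less_mult_iff)
  have "ennreal (V' / 2) < V" unfolding V'(1) using V0 by (intro ennreal_lessI) auto
  then obtain p0 where p0: "p0 \<in> ?P" "ennreal (V' / 2) < ?v p0" unfolding V_def less_SUP_iff by blast
  define a x where "a = fst p0" and "x = snd p0"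
  have x: "x \<in> space Sigma'" using p0(1) by (auto simp: x_def)
  define p where "p = enn2real (hit K e r n a x)"
  have "hit K e r n a x < \<top>" by (rule order.strict_trans1[OF hit_le_1[OF K x]]) simp
  then have p: "hit K e r n a x = ennreal p" by (simp add: p_def)
  have p0': "0 \<le> p" by (simp add: p_def)
  have "ennreal (V' / 2) < ennreal p * ennreal (exp (l * a))" using p0(2)
    by (simp add: a_def[symmetric] x_def[symmetric] p)
  then have pV: "V' / 2 < p * exp (l * a)"
    using p0' V0 by (simp add: ennreal_mult[symmetric] ennreal_less_iff)
  then have "0 < p * exp (l * a)" using V0 by linarith
  then have pp: "0 < p" by (simp add: zero_less_mult_iff)
  show ?thesis
  proof (rule that[OF x pp p])
    have "B / (2 * exp 1 * W) \<le> V' / 2" using BV W by (simp add: pos_divide_le_eq mult_ac)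
    then have "B / (2 * exp 1 * W) \<le> p * exp (l * a)" using pV by linarith
    then show "B / (2 * exp 1 * (real n * (ln r - ln e) + 2)) \<le> p * exp (l * a)" unfolding W_def .
    fix z :: "real \<times> 's" assume z: "z \<in> space Sigma'"
    have "hit K e r n (a - w) z < \<top>" by (rule order.strict_trans1[OF hit_le_1[OF K z]]) simp
    then obtain h where h: "hit K e r n (a - w) z = ennreal h" "0 \<le> h"
      by (cases "hit K e r n (a - w) z") auto
    \<comment> \<open>Moving the threshold by \<open>w\<close> changes the tilt by
      \<open>exp (l * w) \<le> exp w\<close>, and \<open>(a, x)\<close> attains more than half of
      the supremum. This is the control over other starting points.\<close>
    have "h * exp (l * (a - w)) \<le> V'"
      using hV[OF z, of "a - w"] h V' by (simp add: ennreal_mult[symmetric])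
    also have "V' \<le> 2 * (p * exp (l * a))" using pV by simp
    finally have "h * exp (l * (a - w)) * exp (l * w) \<le> 2 * (p * exp (l * a)) * exp (l * w)"
      by (rule mult_right_mono) simp
    moreover have "exp (l * a) = exp (l * (a - w)) * exp (l * w)"
      by (simp add: exp_add[symmetric] algebra_simps)
    ultimately have "h * exp (l * a) \<le> (2 * p * exp (l * w)) * exp (l * a)" by (simp add: mult_ac)
    then have "h \<le> 2 * p * exp (l * w)" by simp
    also have "\<dots> \<le> 2 * p * exp w" using l w p0'
      by (intro mult_left_mono) (auto intro: mult_left_le_one_le)
    finally show "hit K e r n (a - w) z \<le> ennreal (2 * exp w) * hit K e r n a x"
      unfolding h p using p0' by (simp add: ennreal_mult[symmetric] ennreal_leI mult_ac)
  qed
qed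

text \<open>For a block of \<open>n\<close> generations that succeeds with probability at least \<open>\<rho>\<close> from everywhere, put
  \<open>x = ln \<rho> + n * ln b\<close> and \<open>v = x + s\<close>. Concatenating blocks adds these pairs, and the growth of the
  moments provides, for each \<open>l\<close> in \<open>[0, 1]\<close>, a pair with \<open>(1 - l) * x + l * v > 0\<close>.\<close>
lemma uniform_block:
  assumes A: "assumption1 K" and e: "0 < e" "e \<le> 1" and r: "1 \<le> r" and q: "0 < (q::real)"
    and qK: "\<And>y. y \<in> space Sigma' \<Longrightarrow> ennreal q \<le> emeasure (K y) ({e<..r} \<times> UNIV)"
    and b: "1 \<le> b" and t: "0 < t + ln b"
    and grow: "\<And>l n0. 0 \<le> l \<Longrightarrow> l \<le> 1 \<Longrightarrow> \<exists>n\<ge>n0. \<exists>y\<in>space Sigma'. ennreal (exp (real n * t))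
        \<le> (tilt l e r ^^ n) (\<lambda>_. 1) y"
  obtains e' r' s \<rho> :: real and n :: nat where "0 < e'" "e' \<le> 1" "0 < n" "s \<le> 0" "0 < \<rho>" "\<rho> \<le> 1"
    "\<And>y. y \<in> space Sigma' \<Longrightarrow> ennreal \<rho> \<le> hit K e' r' n s y" "1 < \<rho> * exp s * b ^ n"
proof -
  obtain l0 N :: nat and e' r' c w u :: real where N: "0 < N" and e': "0 < e'" "e' \<le> 1" and c: "0 < c"
    and w: "0 \<le> w" and u: "0 \<le> u"
    and comp: "\<And>n a x y. x \<in> space Sigma' \<Longrightarrow> y \<in> space Sigma' \<Longrightarrow>
       (\<And>z. z \<in> space Sigma' \<Longrightarrow> hit K e r (n + l0) (a - w) z \<le> ennreal (2 * exp w) * hit K e r (n + l0) a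
           x) \<Longrightarrow>
       ennreal c * hit K e r (n + l0) a x \<le> hit K e' r' (n + l0 + N) (a - u) y"
  proof (rule comparison[OF A e r q])
    fix y :: "real \<times> 's" assume "y \<in> space Sigma'"
    then show "ennreal q \<le> emeasure (K y) ({e<..r} \<times> UNIV)" by (rule qK)
  qed (rule that; blast)
  define ok where "ok n s \<rho> \<longleftrightarrow> 0 < n \<and> 0 < \<rho> \<and> \<rho> \<le> 1 \<and> (\<forall>y\<in>space Sigma'. ennreal \<rho> \<le> hit K e' r' n s y)"
    for n s and \<rho> :: real
  define S where "S = {(x, v). \<exists>n s \<rho>. ok n s \<rho> \<and> x = ln \<rho> + real n * ln b \<and> v = x + s}"
  have "\<exists>(x, v)\<in>S. 0 < x \<and> 0 < v"
  proof (rule cone_meets_positive_quadrant)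
    fix x y assume "x \<in> S" "y \<in> S"
    then obtain n s \<rho> n' s' \<rho>' where 1: "ok n s \<rho>"
        "x = (ln \<rho> + real n * ln b, ln \<rho> + real n * ln b + s)"
      and 2: "ok n' s' \<rho>'" "y = (ln \<rho>' + real n' * ln b, ln \<rho>' + real n' * ln b + s')"
      unfolding S_def by auto
    have "ok (n + n') (s + s') (\<rho> * \<rho>')"
      unfolding ok_def
    proof (intro conjI ballI)
      fix y :: "real \<times> 's" assume y: "y \<in> space Sigma'"
      have "ennreal (\<rho> * \<rho>') \<le> hit K e' r' n s y * ennreal \<rho>'"
        using 1(1) 2(1) y unfolding ok_def by (simp add: ennreal_mult mult_right_mono)
      also have "\<dots> \<le> hit K e' r' (n + n') (s + s') y"
        using 2(1) by (intro hit_add[OF y]) (auto simp: ok_def)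
      finally show "ennreal (\<rho> * \<rho>') \<le> hit K e' r' (n + n') (s + s') y" .
    qed (use 1 2 in \<open>auto simp: ok_def mult_le_one\<close>)
    moreover have "ln (\<rho> * \<rho>') = ln \<rho> + ln \<rho>'" using 1 2 by (simp add: ok_def ln_mult)
    ultimately show "x + y \<in> S" unfolding S_def 1(2) 2(2)
      by (auto intro!: exI[of _ "n + n'"] exI[of _ "s + s'"] exI[of _ "\<rho> * \<rho>'"] simp: algebra_simps)
  next
    fix l :: real assume l: "0 \<le> l" "l \<le> 1"
    define \<tau> where "\<tau> = t + ln b"
    have \<tau>: "0 < \<tau>" using t by (simp add: \<tau>_def)
    define D where "D = ln r - ln e"
    have D: "0 \<le> D" using e r by (simp add: D_def)
    \<comment> \<open>Beyond \<open>Z\<close> the quadratic lower bound for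
      \<open>exp (real n * \<tau>)\<close> beats the linear number of level sets together with the
      constants lost in the comparison.\<close>
    define Z where "Z = 2 * exp 1 * (D + 2) * 2 * exp u / (c * \<tau>\<^sup>2)"
    obtain m :: nat where m: "Z < real m" using reals_Archimedean2 by blast
    obtain n y where n: "n \<ge> max (Suc l0) (Suc m)" and y: "y \<in> space Sigma'"
      and ge: "ennreal (exp (real n * t)) \<le> (tilt l e r ^^ n) (\<lambda>_. 1) y"
      using grow[OF l] by blast
    obtain a x p where x: "x \<in> space Sigma'" and p0: "0 < p" and p: "hit K e r n a x = ennreal p"
      and pB: "exp (real n * t) / (2 * exp 1 * (real n * (ln r - ln e) + 2)) \<le> p * exp (l * a)"
      and near: "\<And>z. z \<in> space Sigma' \<Longrightarrow> hit K e r n (a - w) z \<le> ennreal (2 * exp w) * hit K e r n a x"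
      by (rule near_maximiser[OF y e r l exp_gt_zero ge w]) (rule that; blast)
    have n': "n - l0 + l0 = n" "1 \<le> n" "real m < real n" using n by auto
    have cp: "ennreal (c * p) \<le> hit K e' r' (n + N) (a - u) z" if z: "z \<in> space Sigma'" for z
      using comp[OF x z, of "n - l0" a] near c p0 unfolding n' p by (simp add: ennreal_mult)
    have "ennreal (c * p) \<le> 1" using order_trans[OF cp[OF x] hit_le_1[OF K x]] .
    then have cp1: "c * p \<le> 1" by simp
    have ok: "ok (n + N) (a - u) (c * p)" unfolding ok_def using N c p0 cp cp1 by simp
    have W: "0 < real n * D + 2" using D by (simp add: add_nonneg_pos)
    have W2: "real n * D + 2 \<le> real n * (D + 2)" using n' by (simp add: distrib_left)
    have "1 < c * exp (- u) * exp (real n * \<tau>) / (2 * exp 1 * (real n * D + 2))"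
    proof -
      have "2 * exp 1 * (real n * D + 2) \<le> 2 * exp 1 * (real n * (D + 2))" using W2 by simp
      also have "\<dots> < c * exp (- u) * ((real n * \<tau>)\<^sup>2 / 2)"
      proof -
        have "Z < real n" using m n' by simp
        then have "2 * exp 1 * (D + 2) * 2 * exp u < real n * (c * \<tau>\<^sup>2)" unfolding Z_def using c \<tau>
          by (simp add: pos_divide_less_eq)
        then have lt: "(2 * exp 1 * (D + 2) * 2 * exp u) * (real n * exp (- u) / 2)
            < real n * (c * \<tau>\<^sup>2) * (real n * exp (- u) / 2)"
          using n' by (intro mult_strict_right_mono) auto
        have eq1: "(2 * exp 1 * (D + 2) * 2 * exp u) * (real n * exp (- u) / 2)
            = 2 * exp 1 * (real n * (D + 2))"
          by (simp add: exp_minus field_simps)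
        have eq2: "real n * (c * \<tau>\<^sup>2) * (real n * exp (- u) / 2) = c * exp (- u) * ((real n * \<tau>)\<^sup>2 / 2)"
          by (simp add: power2_eq_square)
        show ?thesis using lt unfolding eq1 eq2 .
      qed
      also have "\<dots> \<le> c * exp (- u) * exp (real n * \<tau>)"
      proof -
        have x0: "0 \<le> real n * \<tau>" using \<tau> by simp
        have "(real n * \<tau>)\<^sup>2 / 2 \<le> exp (real n * \<tau>)" using exp_lower_Taylor_quadratic[OF x0] x0
          by linarith
        then show ?thesis using c by (intro mult_left_mono) auto
      qed
      finally show ?thesis using W by (simp add: pos_less_divide_eq)
    qed
    also have "\<dots> = c * exp (- u) * b ^ n * (exp (real n * t) / (2 * exp 1 * (real n * D + 2)))"
    proof -
      have "exp (real n * \<tau>) = exp (real n * t) * exp (real n * ln b)"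
        by (simp add: \<tau>_def exp_add[symmetric] algebra_simps)
      also have "exp (real n * ln b) = b ^ n" using b by (simp add: exp_of_nat_mult)
      finally show ?thesis by simp
    qed
    also have "\<dots> \<le> c * exp (- u) * b ^ n * (p * exp (l * a))"
      using pB c b unfolding D_def by (intro mult_left_mono) auto
    \<comment> \<open>The comparison lowers the threshold by \<open>u\<close> and lengthens the
      block by \<open>N\<close>. Both changes are harmless here because \<open>l \<le> 1\<close> and
      \<open>b \<ge> 1\<close>.\<close>
    also have "\<dots> \<le> c * exp (- (l * u)) * b ^ (n + N) * (p * exp (l * a))"
    proof -
      have "exp (- u) \<le> exp (- (l * u))" using l u by (simp add: mult_left_le_one_le)
      moreover have "b ^ n \<le> b ^ (n + N)" using b by (intro power_increasing) auto
      ultimately have "c * exp (- u) * b ^ n \<le> c * exp (- (l * u)) * b ^ (n + N)"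
        using c b by (intro mult_mono) auto
      then show ?thesis using p0 by (intro mult_right_mono) auto
    qed
    finally have gt: "1 < c * exp (- (l * u)) * b ^ (n + N) * (p * exp (l * a))" .
    have "0 < ln (c * exp (- (l * u)) * b ^ (n + N) * (p * exp (l * a)))" using gt by (rule ln_gt_zero)
    also have "\<dots> = ln (c * p) + real (n + N) * ln b + l * (a - u)"
      using c p0 b by (simp add: ln_mult ln_realpow algebra_simps)
    finally have "0 < (1 - l) * (ln (c * p) + real (n + N) * ln b) + l * (ln (c * p) + real (n + N)
        * ln b + (a - u))"
      by (simp add: algebra_simps)
    moreover have "(ln (c * p) + real (n + N) * ln b, ln (c * p) + real (n + N) * ln b + (a - u)) \<in> S"
      unfolding S_def mem_Collect_eq case_prod_conv
      by (intro exI[of _ "n + N"] exI[of _ "a - u"] exI[of _ "c * p"] conjI ok refl)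
    ultimately show "\<exists>(x, v)\<in>S. 0 < (1 - l) * x + l * v"
      by (intro bexI[of _ "(ln (c * p) + real (n + N) * ln b, ln (c * p) + real (n + N) * ln b
          + (a - u))"]) auto
  qed
  then obtain n s \<rho> where ok: "ok n s \<rho>"
    and pos: "0 < ln \<rho> + real n * ln b" "0 < ln \<rho> + real n * ln b + s"
    unfolding S_def by auto
  show ?thesis
  \<comment> \<open>Lowering the threshold can only help the block. With \<open>min s 0\<close> the
    two positive coordinates, one for each sign of \<open>s\<close>, become a single
    inequality.\<close>
  proof (rule that[of e' n "min s 0" \<rho> r'])
    show "0 < e'" "e' \<le> 1" by fact+
    show "0 < n" "min s 0 \<le> 0" "0 < \<rho>" "\<rho> \<le> 1" using ok by (auto simp: ok_def)
    show "ennreal \<rho> \<le> hit K e' r' n (min s 0) y" if y: "y \<in> space Sigma'" for y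
    proof -
      have "ennreal \<rho> \<le> hit K e' r' n s y" using ok y by (simp add: ok_def)
      also have "\<dots> \<le> hit K e' r' n (min s 0) y" by (rule hit_mono[OF y]) simp
      finally show ?thesis .
    qed
    have "exp 0 < exp (ln \<rho> + real n * ln b + min s 0)" using pos
      by (subst exp_less_cancel_iff) (simp add: min_def)
    also have "\<dots> = \<rho> * exp (min s 0) * b ^ n"
      using ok b by (simp add: exp_add ok_def exp_of_nat_mult mult_ac)
    finally show "1 < \<rho> * exp (min s 0) * b ^ n" by simp
  qed
qed

end

section \<open>The rate functions of the logarithmic kernels\<close>

lemma less_ln_ennreal_iff:
  assumes "0 < n"
  shows "ereal t < ereal (1 / real n) * ln_ennreal E \<longleftrightarrow> ennreal (exp (real n * t)) < E"
proof (cases E)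
  case (real x)
  show ?thesis
  proof (cases "x = 0")
    case True
    then show ?thesis using real assms by (simp add: ln_ennreal_def)
  next
    case False
    then have x: "0 < x" using real by simp
    have "t < 1 / real n * ln x \<longleftrightarrow> real n * t < ln x" using assms
      by (simp add: pos_less_divide_eq mult.commute)
    also have "\<dots> \<longleftrightarrow> exp (real n * t) < x" using x by (metis exp_less_cancel_iff exp_ln)
    finally show ?thesis using real x by (simp add: ln_ennreal_def ennreal_less_iff)
  qed
next
  case top
  then show ?thesis using assms by (simp add: ln_ennreal_def)
qed

lemma frequently_of_less_limsup:
  fixes f :: "nat \<Rightarrow> ereal"
  assumes "c < limsup f"
  shows "\<exists>n\<ge>n0. c < f n"
proof (rule ccontr)
  assume "\<not> (\<exists>n\<ge>n0. c < f n)"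
  then have "eventually (\<lambda>n. f n \<le> c) sequentially"
    by (auto simp: eventually_sequentially not_less intro!: exI[of _ n0])
  then have "limsup f \<le> c" by (rule Limsup_bounded)
  with assms show False by simp
qed

abbreviation (input) from_ln :: "real \<times> 's \<Rightarrow> real \<times> 's" where
  "from_ln y \<equiv> (exp (fst y), snd y)"

lemma from_ln_measurable: "(\<lambda>y. from_ln y) \<in> borel \<rightarrow>\<^sub>M (Sigma' :: (real \<times> 's::polish_space) measure)"
  unfolding Sigma'_def
  by (intro measurable_restrict_space2 borel_measurable_continuous_onI continuous_intros) auto

lemma to_ln_measurable: "(\<lambda>(a, w). (ln a, w)) \<in> (Sigma' :: (real \<times> 's::polish_space) measure) \<rightarrow>\<^sub>M borel"
proof -
  have "snd \<in> (Sigma' :: (real \<times> 's) measure) \<rightarrow>\<^sub>M borel"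
    unfolding Sigma'_def by (rule measurable_restrict_space1) (simp add: borel_prod[symmetric])
  then have "(\<lambda>z. (ln (fst z), snd z)) \<in> (Sigma' :: (real \<times> 's) measure) \<rightarrow>\<^sub>M borel \<Otimes>\<^sub>M borel"
    by measurable
  then show ?thesis by (simp add: borel_prod case_prod_unfold)
qed

context markov_kernel begin

lemma from_ln_space: "from_ln y \<in> space (Sigma' :: (real \<times> 's) measure)"
  using measurable_space[OF from_ln_measurable] by simp

lemma to_ln_measurable_K: "(\<lambda>(a, w). (ln a, w)) \<in> K (from_ln y) \<rightarrow>\<^sub>M borel"
  unfolding measurable_cong_sets[OF K_space(2)[OF from_ln_space] refl] by (rule to_ln_measurable)

lemma K_ln_measurable: "K_ln K \<in> borel \<rightarrow>\<^sub>M prob_algebra borel"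
proof (rule measurable_prob_algebraI)
  show "prob_space (K_ln K y)" for y
    unfolding K_ln_def by (rule prob_space.prob_space_distr[OF K_space(1)[OF from_ln_space]
        to_ln_measurable_K])
  have "(\<lambda>y. distr (K (from_ln y)) borel (\<lambda>(a, w). (ln a, w))) \<in> borel \<rightarrow>\<^sub>M subprob_algebra borel"
    by (rule measurable_compose[OF measurable_compose[OF from_ln_measurable K_sub]
        measurable_distr[OF to_ln_measurable]])
  then show "K_ln K \<in> borel \<rightarrow>\<^sub>M subprob_algebra borel" by (simp add: K_ln_def[abs_def])
qed

lemma nn_integral_K_ln:
  assumes "f \<in> borel_measurable borel"
  shows "(\<integral>\<^sup>+ z. f z \<partial>K_ln K y) = (\<integral>\<^sup>+ z. f (ln (fst z), snd z) \<partial>K (from_ln y))"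
  unfolding K_ln_def using assms
  by (subst nn_integral_distr[OF to_ln_measurable_K]) (auto simp: case_prod_unfold)

lemma Sigma'_pos: "z \<in> space (Sigma' :: (real \<times> 's) measure) \<Longrightarrow> 0 < fst z"
  by (auto simp: Sigma'_def space_restrict_space mem_Times_iff)

lemma nn_integral_chain_law_K_ln:
  "(\<integral>\<^sup>+ x. ennreal (exp (l * (\<Sum>i=1..n. fst (x i)))) \<partial>chain_law borel (K_ln K) y)
      = (moment_op K l ^^ n) (\<lambda>_. 1) (from_ln y)"
proof -
  let ?T = "\<lambda>f y. \<integral>\<^sup>+ z. ennreal (exp (l * fst z)) * f z \<partial>K_ln K y"
  have "(?T ^^ n) (\<lambda>_. 1) = (\<lambda>y. (moment_op K l ^^ n) (\<lambda>_. 1) (from_ln y))"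
  proof (induction n)
    case (Suc n)
    let ?m = "(moment_op K l ^^ n) (\<lambda>_. 1)"
    have mm: "(\<lambda>y. ?m (from_ln y)) \<in> borel_measurable borel"
      by (rule measurable_compose[OF from_ln_measurable moment_op_funpow_measurable[OF K]]) simp
    have fm: "(fst :: real \<times> 's \<Rightarrow> real) \<in> borel_measurable borel" by (simp add: borel_prod[symmetric])
    show ?case
    proof (rule ext)
      fix y :: "real \<times> 's"
      have "(?T ^^ Suc n) (\<lambda>_. 1) y = (\<integral>\<^sup>+ z. ennreal (exp (l * fst z)) * ?m (from_ln z) \<partial>K_ln K y)"
        using Suc by simp
      also have "\<dots> = (\<integral>\<^sup>+ z. ennreal (exp (l * ln (fst z))) * ?m (from_ln (ln (fst z), snd z))
          \<partial>K (from_ln y))"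
      proof -
        note mm[measurable] fm[measurable]
        have "(\<lambda>z. ennreal (exp (l * fst z)) * ?m (from_ln z)) \<in> borel_measurable borel" by measurable
        from nn_integral_K_ln[OF this] show ?thesis by simp
      qed
      also have "\<dots> = moment_op K l ?m (from_ln y)"
        unfolding moment_op_def[of K l ?m]
        by (intro nn_integral_cong) (simp add: K_space[OF from_ln_space] Sigma'_pos powr_def
            less_imp_neq[symmetric])
      finally show "(?T ^^ Suc n) (\<lambda>_. 1) y = (moment_op K l ^^ Suc n) (\<lambda>_. 1) (from_ln y)" by simp
    qed
  qed simp
  moreover have "(fst :: real \<times> 's \<Rightarrow> real) \<in> borel_measurable borel"
    by (simp add: borel_prod[symmetric])
  ultimately show ?thesis
    by (subst nn_integral_chain_law_exp[OF K_ln_measurable]) simp_all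
qed

text \<open>A rate below \<open>- ln b\<close> at some \<open>l\<close> bounds the moments uniformly
  in the starting point for all large \<open>n\<close>, by powers of \<open>a = exp t\<close> with
  \<open>t < - ln b\<close>.\<close>

lemma moment_op_bound:
  assumes b: "1 < b" and "(INF l\<in>{0..1}. Lambda borel (K_ln K) l) < ereal (- ln b)"
  obtains l a n0 where "0 < l" "l \<le> 1" "0 \<le> a" "a * b < 1"
    "\<And>n y. n \<ge> n0 \<Longrightarrow> y \<in> space Sigma' \<Longrightarrow> (moment_op K l ^^ n) (\<lambda>_. 1) y \<le> ennreal (a ^ n)"
proof -
  obtain l where l: "0 \<le> l" "l \<le> 1" and less: "Lambda borel (K_ln K) l < ereal (- ln b)"
    using assms(2) unfolding INF_less_iff by auto
  obtain t where t: "Lambda borel (K_ln K) l < ereal t" "t < - ln b"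
    using ereal_dense2[OF less] by auto
  have "eventually (\<lambda>n. (SUP y\<in>space borel. ereal (1 / real n) * ln_ennreal
      (\<integral>\<^sup>+ x. ennreal (exp (l * (\<Sum>i=1..n. fst (x i)))) \<partial>chain_law borel (K_ln K) y)) < ereal t)
      sequentially"
    using t(1) unfolding Lambda_def by (rule Limsup_lessD)
  then obtain n1 where n1: "\<And>n. n \<ge> n1
      \<Longrightarrow> (SUP y\<in>space borel. ereal (1 / real n) * ln_ennreal
      (\<integral>\<^sup>+ x. ennreal (exp (l * (\<Sum>i=1..n. fst (x i)))) \<partial>chain_law borel (K_ln K) y)) < ereal t"
    unfolding eventually_sequentially by blast
  define n0 where "n0 = max n1 1"
  have bound: "(moment_op K l ^^ n) (\<lambda>_. 1) y \<le> ennreal (exp t ^ n)" if n: "n \<ge> n0"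
    and y: "y \<in> space Sigma'" for n y
  proof -
    define y' where "y' = (ln (fst y), snd y)"
    have y': "from_ln y' = y" using Sigma'_pos[OF y] by (simp add: y'_def)
    have "ereal (1 / real n) * ln_ennreal ((moment_op K l ^^ n) (\<lambda>_. 1) y)
        \<le> (SUP y\<in>space borel. ereal (1 / real n) * ln_ennreal
        (\<integral>\<^sup>+ x. ennreal (exp (l * (\<Sum>i=1..n. fst (x i)))) \<partial>chain_law borel (K_ln K) y))"
      unfolding nn_integral_chain_law_K_ln by (rule SUP_upper2[of y']) (simp_all add: y')
    also have "\<dots> < ereal t" using n by (intro n1) (simp add: n0_def)
    finally have "\<not> ereal t < ereal (1 / real n) * ln_ennreal ((moment_op K l ^^ n) (\<lambda>_. 1) y)" by simp
    then show ?thesis using n by (subst (asm) less_ln_ennreal_iff) (auto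
        simp: n0_def not_less exp_of_nat_mult)
  qed
  \<comment> \<open>At \<open>l = 0\<close> all moments equal 1, so the rate would be 0, which is
    not below \<open>- ln b\<close> since \<open>b > 1\<close>.\<close>
  have "l \<noteq> 0"
  proof
    assume "l = 0"
    have "(moment_op K 0 ^^ n) (\<lambda>_. 1) y = 1" if "y \<in> space Sigma'" for n y
      using that
    proof (induction n arbitrary: y)
      case (Suc n)
      have "(moment_op K 0 ^^ Suc n) (\<lambda>_. 1) y = (\<integral>\<^sup>+ z. 1 \<partial>K y)"
        unfolding funpow.simps comp_def moment_op_def[of K 0 "(moment_op K 0 ^^ n) (\<lambda>_. 1)"]
        by (intro nn_integral_cong) (simp add: K_space[OF Suc.prems] Suc.IH Sigma'_pos
            less_imp_neq[symmetric])
      then show ?case using prob_space.emeasure_space_1[OF K_space(1)[OF Suc.prems]] by simp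
    qed simp
    then have "1 \<le> ennreal (exp t ^ n0)" using bound[of n0 "from_ln (0, undefined)"]
        from_ln_space[of "(0, undefined)"] \<open>l = 0\<close> by simp
    then have "1 \<le> exp t ^ n0" by (simp add: ennreal_ge_1)
    moreover have "exp t < 1" using t(2) b by (simp add: ln_gt_zero order.strict_trans)
    then have "exp t ^ n0 < 1" by (intro power_less_one_iff[THEN iffD2]) (auto simp: n0_def)
    ultimately show False by simp
  qed
  moreover have "exp t * b < 1"
  proof -
    have "exp (t + ln b) < 1" using t(2) by simp
    then show ?thesis using b by (simp add: exp_add)
  qed
  ultimately show ?thesis using that[of l "exp t" n0] l bound by simp
qed

lemma strip_sets: "{C<..R} \<times> UNIV \<in> sets (borel :: (real \<times> 's) measure)"
  by (simp add: borel_prod[symmetric])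

lemma emeasure_K_ln_strip: "emeasure (K_ln K y) ({C<..R} \<times> UNIV)
    = emeasure (K (from_ln y)) ({exp C<..exp R} \<times> UNIV)"
proof -
  have "emeasure (K_ln K y) ({C<..R} \<times> UNIV)
      = emeasure (K (from_ln y)) ((\<lambda>(a, w). (ln a, w)) -` ({C<..R} \<times> UNIV) \<inter> space (K (from_ln y)))"
    unfolding K_ln_def by (rule emeasure_distr[OF to_ln_measurable_K strip_sets])
  also have "(\<lambda>(a, w). (ln a, w)) -` ({C<..R} \<times> UNIV) \<inter> space (K (from_ln y)) = {exp C<..exp R} \<times> UNIV"
  proof -
    have "C < ln a \<and> ln a \<le> R \<longleftrightarrow> exp C < a \<and> a \<le> exp R" if "0 < a" for a
      using that by (metis exp_le_cancel_iff exp_less_cancel_iff exp_ln)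
    moreover have "0 < a" if "exp C < a" for a using that exp_gt_zero[of C] by linarith
    ultimately show ?thesis
      unfolding K_space(3)[OF from_ln_space] by (auto simp: Sigma'_def space_restrict_space)
  qed
  finally show ?thesis .
qed

section \<open>The conditioned kernel\<close>

context
  fixes C R q :: real
  assumes q: "0 < q" and qK: "\<And>y. y \<in> space Sigma' \<Longrightarrow> ennreal q
      \<le> emeasure (K y) ({exp C<..exp R} \<times> UNIV)"
begin

lemma K_ln_prob: "prob_space (K_ln K y)" and K_ln_sets: "sets (K_ln K y) = sets borel"
  using measurable_space[OF K_ln_measurable, of y] by (auto simp: space_prob_algebra)

lemma K_ln_strip_ge: "ennreal q \<le> emeasure (K_ln K y) ({C<..R} \<times> UNIV)"
  unfolding emeasure_K_ln_strip by (rule qK[OF from_ln_space])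

lemma K_ln_strip_neq: "emeasure (K_ln K y) ({C<..R} \<times> UNIV) \<noteq> 0"
    "emeasure (K_ln K y) ({C<..R} \<times> UNIV) \<noteq> \<infinity>"
proof -
  show "emeasure (K_ln K y) ({C<..R} \<times> UNIV) \<noteq> 0"
  proof
    assume "emeasure (K_ln K y) ({C<..R} \<times> UNIV) = 0"
    then show False using K_ln_strip_ge[of y] q by simp
  qed
  show "emeasure (K_ln K y) ({C<..R} \<times> UNIV) \<noteq> \<infinity>"
    using prob_space.emeasure_le_1[OF K_ln_prob, of y "{C<..R} \<times> UNIV"] by (auto simp: top_unique)
qed

lemma Q_sets: "sets (Q K C R y) = sets (strip C R)"
  unfolding Q_def strip_def by (rule sets_restrict_space_cong) (simp add: K_ln_sets)

lemma nn_integral_Q: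
  assumes f: "f \<in> borel_measurable (strip C R)"
  shows "(\<integral>\<^sup>+ z. f z \<partial>Q K C R y) = (\<integral>\<^sup>+ z. f z * indicator ({C<..R} \<times> UNIV) z \<partial>K_ln K y) / emeasure
      (K_ln K y) ({C<..R} \<times> UNIV)"
proof -
  let ?D = "{C<..R} \<times> (UNIV :: 's set)"
  have fm: "(\<lambda>z. f z * indicator ?D z) \<in> borel_measurable borel"
    using f unfolding strip_def by (subst (asm) borel_measurable_restrict_space_iff_ennreal) (auto
        simp: strip_sets)
  have fm': "(\<lambda>z. f z * indicator ?D z) \<in> borel_measurable (K_ln K y)"
    unfolding measurable_cong_sets[OF K_ln_sets refl] by (rule fm)
  have D: "?D \<in> sets (K_ln K y)" unfolding K_ln_sets by (rule strip_sets)
  have "(\<integral>\<^sup>+ z. f z \<partial>Q K C R y) = (\<integral>\<^sup>+ z. f z * indicator ?D z \<partial>uniform_measure (K_ln K y) ?D)"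
    unfolding Q_def by (rule nn_integral_restrict_space) (use D in simp)
  also have "\<dots> = (\<integral>\<^sup>+ z. f z * indicator ?D z * indicator ?D z \<partial>K_ln K y) / emeasure (K_ln K y) ?D"
    by (rule nn_integral_uniform_measure[OF fm' D])
  also have "(\<lambda>z. f z * indicator ?D z * indicator ?D z) = (\<lambda>z. f z * indicator ?D z)"
    by (auto simp: fun_eq_iff split: split_indicator)
  finally show ?thesis .
qed

lemma Q_measurable: "Q K C R \<in> strip C R \<rightarrow>\<^sub>M prob_algebra (strip C R)"
proof (rule measurable_prob_algebraI)
  let ?D = "{C<..R} \<times> (UNIV :: 's set)"
  have em: "emeasure (Q K C R y) A = emeasure (K_ln K y) A / emeasure (K_ln K y) ?D"
    if A: "A \<in> sets (strip C R)" for y A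
  proof -
    have A': "A \<in> sets borel" "A \<subseteq> ?D" using A unfolding strip_def
      by (auto simp: sets_restrict_space_iff strip_sets)
    have "emeasure (Q K C R y) A = (\<integral>\<^sup>+ z. indicator A z \<partial>Q K C R y)" using A by (simp add: Q_sets)
    also have "\<dots> = (\<integral>\<^sup>+ z. indicator A z * indicator ?D z \<partial>K_ln K y) / emeasure (K_ln K y) ?D"
      by (rule nn_integral_Q) (use A in simp)
    also have "(\<lambda>z. indicator A z * indicator ?D z :: ennreal) = indicator A"
      using A' by (auto simp: fun_eq_iff split: split_indicator)
    finally show ?thesis using A' by (simp add: K_ln_sets)
  qed
  show pr: "prob_space (Q K C R y)" if "y \<in> space (strip C R)" for y
  proof
    have "space (Q K C R y) = ?D" using sets_eq_imp_space_eq[OF Q_sets[of y]]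
      by (simp add: strip_def space_restrict_space)
    moreover have "?D \<in> sets (strip C R)" unfolding strip_def
      by (simp add: sets_restrict_space_iff strip_sets)
    ultimately show "emeasure (Q K C R y) (space (Q K C R y)) = 1"
      using em[of ?D y] K_ln_strip_neq[of y] by (simp add: ennreal_divide_self top.not_eq_extremum)
  qed
  show "Q K C R \<in> strip C R \<rightarrow>\<^sub>M subprob_algebra (strip C R)"
  proof (rule measurable_subprob_algebra)
    show "subprob_space (Q K C R y)" if "y \<in> space (strip C R)" for y
      by (rule prob_space_imp_subprob_space[OF pr[OF that]])
    show "sets (Q K C R y) = sets (strip C R)" for y by (rule Q_sets)
    fix A :: "(real \<times> 's) set" assume A: "A \<in> sets (strip C R)"
    then have A': "A \<in> sets borel" unfolding strip_def
      by (auto simp: sets_restrict_space_iff strip_sets)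
    have m: "(\<lambda>y. emeasure (K_ln K y) B) \<in> borel_measurable (strip C R)" if "B \<in> sets borel" for B
      unfolding strip_def
      by (intro measurable_restrict_space1 measurable_compose[OF measurable_prob_algebraD[OF
          K_ln_measurable] measurable_emeasure_subprob_algebra] that)
    show "(\<lambda>y. emeasure (Q K C R y) A) \<in> borel_measurable (strip C R)"
      unfolding em[OF A] by (intro borel_measurable_divide_ennreal m A' strip_sets)
  qed
qed

text \<open>Each step of the conditioned chain is a step of the killed chain divided by the mass of
  the strip, which is at least \<open>q\<close>.\<close>

lemma chain_law_Q_le_tilt:
  assumes "y \<in> space (strip C R)"
  shows "(\<integral>\<^sup>+ x. ennreal (exp (l * (\<Sum>i=1..n. fst (x i)))) \<partial>chain_law (strip C R) (Q K C R) y)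
    \<le> ennreal ((1 / q) ^ n) * (tilt l (exp C) (exp R) ^^ n) (\<lambda>_. 1) (from_ln y)"
proof -
  let ?T = "\<lambda>f y. \<integral>\<^sup>+ z. ennreal (exp (l * fst z)) * f z \<partial>Q K C R y"
  let ?t = "tilt l (exp C) (exp R)"
  let ?D = "{C<..R} \<times> (UNIV :: 's set)"
  have fst_m[measurable]: "fst \<in> borel_measurable (strip C R :: (real \<times> 's) measure)"
    unfolding strip_def by (rule measurable_restrict_space1) (simp add: borel_prod[symmetric])
  have Tm: "(?T ^^ n) (\<lambda>_. 1) \<in> borel_measurable (strip C R)" for n
  proof (induction n)
    case (Suc n)
    note Suc[measurable]
    have "(\<lambda>z. ennreal (exp (l * fst z)) * (?T ^^ n) (\<lambda>_. 1) z) \<in> borel_measurable (strip C R)"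
      by measurable
    from measurable_compose[OF measurable_prob_algebraD[OF Q_measurable]
        nn_integral_measurable_subprob_algebra[OF this]]
    show ?case by simp
  qed simp
  have "(?T ^^ n) (\<lambda>_. 1) y \<le> ennreal ((1 / q) ^ n) * (?t ^^ n) (\<lambda>_. 1) (from_ln y)"
    using assms
  proof (induction n arbitrary: y)
    case (Suc n)
    let ?A = "(?T ^^ n) (\<lambda>_. 1)" and ?B = "(?t ^^ n) (\<lambda>_. 1)"
    have Bm: "?B \<in> borel_measurable Sigma'" by (rule tilt_pow_measurable)
    note Tm[of n, measurable]
    have "(?T ^^ Suc n) (\<lambda>_. 1) y = (\<integral>\<^sup>+ z. ennreal (exp (l * fst z)) * ?A z * indicator ?D z \<partial>K_ln K y)
        / emeasure (K_ln K y) ?D"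
      unfolding funpow.simps comp_def by (rule nn_integral_Q) measurable
    also have "\<dots> \<le> (\<integral>\<^sup>+ z. ennreal (exp (l * fst z)) * (ennreal ((1 / q) ^ n) * ?B (from_ln z))
        * indicator ?D z \<partial>K_ln K y) / ennreal q"
      unfolding divide_ennreal_def
    proof (rule mult_mono)
      show "(\<integral>\<^sup>+ z. ennreal (exp (l * fst z)) * ?A z * indicator ?D z \<partial>K_ln K y)
        \<le> (\<integral>\<^sup>+ z. ennreal (exp (l * fst z)) * (ennreal ((1 / q) ^ n) * ?B (from_ln z)) * indicator ?D z
            \<partial>K_ln K y)"
      proof (intro nn_integral_mono)
        fix z :: "real \<times> 's"
        have "?A z \<le> ennreal ((1 / q) ^ n) * ?B (from_ln z)" if "z \<in> ?D"
          using that by (intro Suc.IH) (auto simp: strip_def space_restrict_space)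
        then show "ennreal (exp (l * fst z)) * ?A z * indicator ?D z
            \<le> ennreal (exp (l * fst z)) * (ennreal ((1 / q) ^ n) * ?B (from_ln z)) * indicator ?D z"
          by (auto intro: mult_left_mono split: split_indicator)
      qed
      show "inverse (emeasure (K_ln K y) ?D) \<le> inverse (ennreal q)"
        using K_ln_strip_ge[of y] q
        by (cases "emeasure (K_ln K y) ?D") (auto simp: inverse_ennreal intro: le_imp_inverse_le)
    qed simp_all
    also have "(\<integral>\<^sup>+ z. ennreal (exp (l * fst z)) * (ennreal ((1 / q) ^ n) * ?B (from_ln z)) * indicator
        ?D z \<partial>K_ln K y)
      = (\<integral>\<^sup>+ z. ennreal ((1 / q) ^ n) * (indicator {exp C<..exp R} (fst z) * (ennreal (fst z powr l) *
          ?B z)) \<partial>K (from_ln y))"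
    proof -
      have [measurable]: "(\<lambda>y. ?B (from_ln y)) \<in> borel_measurable borel"
          "(fst :: real \<times> 's \<Rightarrow> real) \<in> borel_measurable borel" "?D \<in> sets borel"
        using measurable_compose[OF from_ln_measurable Bm] strip_sets
        by (auto simp: borel_prod[symmetric])
      have "(\<lambda>z. ennreal (exp (l * fst z)) * (ennreal ((1 / q) ^ n) * ?B (from_ln z)) * indicator ?D z)
          \<in> borel_measurable borel"
        by measurable
      from nn_integral_K_ln[OF this, of y] show ?thesis
      proof (rule trans)
        show "(\<integral>\<^sup>+ z. ennreal (exp (l * fst (ln (fst z), snd z))) * (ennreal ((1 / q) ^ n)
            * ?B (from_ln (ln (fst z), snd z))) * indicator ?D (ln (fst z), snd z) \<partial>K (from_ln y))
          = (\<integral>\<^sup>+ z. ennreal ((1 / q) ^ n) * (indicator {exp C<..exp R} (fst z) * (ennreal (fst z powr l)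
              * ?B z)) \<partial>K (from_ln y))"
        proof (intro nn_integral_cong)
          fix z assume "z \<in> space (K (from_ln y))"
          then have z: "0 < fst z" by (simp add: K_space[OF from_ln_space] Sigma'_pos)
          have "C < ln (fst z) \<and> ln (fst z) \<le> R \<longleftrightarrow> exp C < fst z \<and> fst z \<le> exp R"
            using z by (metis exp_le_cancel_iff exp_less_cancel_iff exp_ln)
          then have ind: "indicator ?D (ln (fst z), snd z)
              = (indicator {exp C<..exp R} (fst z) :: ennreal)"
            by (auto split: split_indicator)
          have p: "exp (l * ln (fst z)) = fst z powr l" using z by (simp add: powr_def)
          show "ennreal (exp (l * fst (ln (fst z), snd z))) * (ennreal ((1 / q) ^ n)
              * ?B (from_ln (ln (fst z), snd z))) * indicator ?D (ln (fst z), snd z)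
            = ennreal ((1 / q) ^ n) * (indicator {exp C<..exp R} (fst z) * (ennreal (fst z powr l) * ?B
                z))"
            unfolding ind using z by (simp add: p mult_ac)
        qed
      qed
    qed
    also have "\<dots> = ennreal ((1 / q) ^ n) * ?t ?B (from_ln y)"
      unfolding tilt_def[of l _ _ ?B] strip_op_def
    proof (rule nn_integral_cmult, rule measurable_K[OF from_ln_space])
      note Bm[measurable]
      show "(\<lambda>z. indicator {exp C<..exp R} (fst z) * (ennreal (fst z powr l) * ?B z)) \<in> borel_measurable
          Sigma'" by measurable
    qed
    also have "ennreal ((1 / q) ^ n) * ?t ?B (from_ln y) / ennreal q
        = ennreal ((1 / q) ^ Suc n) * (?t ^^ Suc n) (\<lambda>_. 1) (from_ln y)"
    proof -
      have "x / ennreal q = x * ennreal (1 / q)" for x :: ennreal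
        using q by (simp add: divide_ennreal_def inverse_ennreal inverse_eq_divide)
      moreover have "ennreal ((1 / q) ^ Suc n) = ennreal ((1 / q) ^ n) * ennreal (1 / q)"
        using q by (simp add: ennreal_mult[symmetric])
      ultimately show ?thesis by (simp add: mult_ac del: power_Suc)
    qed
    finally show ?case .
  qed simp
  then show ?thesis by (subst nn_integral_chain_law_exp[OF Q_measurable assms fst_m])
qed

end


section \<open>The second assumption and the growth of the killed moments\<close>

lemma eta_nonneg: "0 \<le> eta K"
  unfolding eta_def
proof (rule Liminf_bounded, rule always_eventually, clarify)
  fix e r :: real
  have bdd: "bdd_below ((\<lambda>y. measure (K y) ({e<..r} \<times> UNIV)) ` space Sigma')"
    by (rule bdd_belowI[of _ 0]) auto
  have "(INF y\<in>space Sigma'. measure (K y) ({e<..r} \<times> UNIV)) \<le> measure (K (from_ln (0, undefined)))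
      ({e<..r} \<times> UNIV)"
    by (rule cINF_lower[OF bdd from_ln_space])
  also have "\<dots> \<le> 1" by (rule prob_space.prob_le_1[OF K_space(1)[OF from_ln_space]])
  finally show "0 \<le> ereal (eta_at K e r)" by (simp add: eta_at_def)
qed

lemma eta_less_witness:
  assumes "eta K < ereal c"
  obtains e r where "0 < e" "\<And>y. y \<in> space Sigma' \<Longrightarrow> ennreal (1 - c) \<le> emeasure (K y) ({e<..r} \<times> UNIV)"
proof -
  have "\<exists>e r. 0 < e \<and> eta_at K e r < c"
  proof (rule ccontr)
    assume neg: "\<not> (\<exists>e r. 0 < e \<and> eta_at K e r < c)"
    have "eventually (\<lambda>x. 0 < fst x) (at_right (0::real) \<times>\<^sub>F (at_top :: real filter))"
      by (rule eventually_compose_filterlim[OF eventually_at_right_less filterlim_fst])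
    then have "eventually (\<lambda>x. ereal c \<le> (case x of (e, r) \<Rightarrow> ereal (eta_at K e r)))
        (at_right 0 \<times>\<^sub>F at_top)"
      by eventually_elim (use neg in \<open>auto simp: not_less linorder_not_le[symmetric]\<close>)
    then have "ereal c \<le> eta K" unfolding eta_def by (rule Liminf_bounded)
    with assms show False by simp
  qed
  then obtain e r where e: "0 < e" and "eta_at K e r < c" by blast
  then have c: "1 - c < (INF y\<in>space Sigma'. measure (K y) ({e<..r} \<times> UNIV))" by (simp add: eta_at_def)
  have bdd: "bdd_below ((\<lambda>y. measure (K y) ({e<..r} \<times> UNIV)) ` space Sigma')"
    by (rule bdd_belowI[of _ 0]) auto
  have "ennreal (1 - c) \<le> emeasure (K y) ({e<..r} \<times> UNIV)" if y: "y \<in> space Sigma'" for y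
  proof -
    interpret prob_space "K y" by (rule K_space(1)[OF y])
    have "1 - c \<le> measure (K y) ({e<..r} \<times> UNIV)" using c cINF_lower[OF bdd y] by linarith
    then show ?thesis unfolding emeasure_eq_measure by (rule ennreal_leI)
  qed
  with e show ?thesis by (rule that)
qed

text \<open>A limsup above \<open>t\<close> is exceeded at arbitrarily large \<open>n\<close>.
  Undoing the conditioning costs \<open>q ^ n\<close>, that is \<open>ln q\<close> in the
  rate.\<close>

lemma tilt_growth:
  assumes q: "0 < q" and qK: "\<And>y. y \<in> space Sigma' \<Longrightarrow> ennreal q
      \<le> emeasure (K y) ({exp C<..exp R} \<times> UNIV)"
    and less: "ereal t < Lambda (strip C R) (Q K C R) l"
  shows "\<exists>n\<ge>n0. \<exists>y\<in>space Sigma'. ennreal (exp (real n * (t + ln q)))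
      \<le> (tilt l (exp C) (exp R) ^^ n) (\<lambda>_. 1) y"
proof -
  obtain n where n: "n \<ge> max n0 1" and "ereal t < (SUP y\<in>space (strip C R). ereal (1 / real n) *
      ln_ennreal (\<integral>\<^sup>+ x. ennreal (exp (l * (\<Sum>i=1..n. fst (x i)))) \<partial>chain_law (strip C R) (Q K C R) y))"
    using frequently_of_less_limsup[OF less[unfolded Lambda_def], of "max n0 1"] by blast
  then obtain y where y: "y \<in> space (strip C R)" and "ereal t < ereal (1 / real n) *
      ln_ennreal (\<integral>\<^sup>+ x. ennreal (exp (l * (\<Sum>i=1..n. fst (x i)))) \<partial>chain_law (strip C R) (Q K C R) y)"
    unfolding less_SUP_iff by blast
  then have "ennreal (exp (real n * t)) < (\<integral>\<^sup>+ x. ennreal (exp (l * (\<Sum>i=1..n. fst (x i)))) \<partial>chain_law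
      (strip C R) (Q K C R) y)"
    using n by (subst (asm) less_ln_ennreal_iff) auto
  also have "\<dots> \<le> ennreal ((1 / q) ^ n) * (tilt l (exp C) (exp R) ^^ n) (\<lambda>_. 1) (from_ln y)"
    by (rule chain_law_Q_le_tilt[OF q qK y])
  finally have "ennreal (q ^ n) * ennreal (exp (real n * t))
      \<le> ennreal (q ^ n) * (ennreal ((1 / q) ^ n) * (tilt l (exp C) (exp R) ^^ n) (\<lambda>_. 1) (from_ln y))"
    by (intro mult_left_mono) auto
  also have "\<dots> = (tilt l (exp C) (exp R) ^^ n) (\<lambda>_. 1) (from_ln y)"
    using q by (simp add: mult.assoc[symmetric] ennreal_mult[symmetric] power_mult_distrib[symmetric])
  also have "ennreal (q ^ n) * ennreal (exp (real n * t)) = ennreal (exp (real n * (t + ln q)))"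
    using q by (simp add: ennreal_mult[symmetric] exp_add distrib_left exp_of_nat_mult mult.commute)
  finally show ?thesis using n from_ln_space[of y] by auto
qed

end

text \<open>Truncated means are the partial sums of the tail series of \<open>b\<close>, so a strict
  inequality survives a sufficiently late truncation.\<close>

lemma truncated_mean_power:
  fixes p :: "nat pmf" and c b :: real
  assumes b: "(\<integral>\<^sup>+ k. of_nat k \<partial>measure_pmf p) = ennreal b" "0 \<le> b" and c: "1 < c * b ^ n"
  obtains L where "1 < c * (\<Sum>i<L. measure_pmf.prob p {k. i < min k L}) ^ n"
proof -
  have "(\<lambda>i. ennreal (measure_pmf.prob p {k. i < k})) sums ennreal b"
    using nn_integral_tail_pmf[of p "\<lambda>k. k"] b by (simp add: nn_integral_count_space_nat sums_iff)
  then have "(\<lambda>i. measure_pmf.prob p {k. i < k}) sums b" by (subst (asm) sums_ennreal) (use b in auto)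
  then have "(\<lambda>L. c * (\<Sum>i<L. measure_pmf.prob p {k. i < k}) ^ n) \<longlonglongrightarrow> c * b ^ n"
    unfolding sums_def by (intro tendsto_intros)
  from order_tendstoD(1)[OF this c] obtain L where "1 < c * (\<Sum>i<L. measure_pmf.prob p {k. i < k}) ^ n"
    by (auto simp: eventually_sequentially)
  moreover have "(\<Sum>i<L. measure_pmf.prob p {k. i < min k L}) = (\<Sum>i<L. measure_pmf.prob p {k. i < k})"
    by (intro sum.cong refl arg_cong[where f = "measure_pmf.prob p"]) auto
  ultimately show ?thesis using that by simp
qed

lemma (in markov_tree) transientI:
  assumes b: "(\<integral>\<^sup>+ k. of_nat k \<partial>measure_pmf p) = ennreal b" "1 < b"
    and A: "assumption1 K" "assumption2 K"
    and less: "ereal (- ln b - ln (1 - real_of_ereal (eta K))) <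
      Limsup (filtercomap (\<lambda>(C, R). min (- C) R) at_top) (\<lambda>(C, R). INF l\<in>{0..1}. Lambda (strip C R)
          (Q K C R) l)"
  shows "transient M off \<Gamma>"
proof -
  interpret k: markov_kernel K by unfold_locales (rule kernel)
  define \<eta> where "\<eta> = real_of_ereal (eta K)"
  have \<eta>: "eta K = ereal \<eta>" "0 \<le> \<eta>" "\<eta> < 1"
    using k.eta_nonneg A(2) unfolding assumption2_def \<eta>_def by (cases "eta K"; auto)+
  obtain t where t: "- ln b - ln (1 - \<eta>) < t" and tL: "ereal t <
      Limsup (filtercomap (\<lambda>(C, R). min (- C) R) at_top) (\<lambda>(C, R). INF l\<in>{0..1}. Lambda (strip C R)
          (Q K C R) l)"
    using ereal_dense2[OF less] unfolding \<eta>_def by auto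
  \<comment> \<open>The slack in the hypothesis is \<open>2 * d\<close>. Half of it is spent on
    taking \<open>q\<close> strictly below \<open>1 - \<eta>\<close>, which some strip then realises
    as a uniform lower bound; the other half remains as the growth
    \<open>t + ln q + ln b = d\<close>.\<close>
  define d where "d = (t + ln b + ln (1 - \<eta>)) / 2"
  define q where "q = (1 - \<eta>) * exp (- d)"
  have d: "0 < d" using t by (simp add: d_def)
  have q: "0 < q" "q < 1 - \<eta>" using \<eta> d by (simp_all add: q_def)
  have "ln q = ln (1 - \<eta>) - d" using \<eta> by (simp add: q_def ln_mult)
  then have tq: "t + ln q + ln b = d" by (simp add: d_def field_simps)
  have "eta K < ereal (1 - q)" using \<eta> q by simp
  then obtain e0 r0 where e0: "0 < e0"
    and mass: "\<And>y. y \<in> space Sigma' \<Longrightarrow> ennreal q \<le> emeasure (K y) ({e0<..r0} \<times> UNIV)"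
    using k.eta_less_witness[of "1 - q"] by auto
  \<comment> \<open>A strip beyond \<open>B\<close> contains the one with mass at least
    \<open>q\<close> and satisfies \<open>exp C \<le> 1 \<le> exp R\<close>. The limsup supplies
    such a strip with rates above \<open>t\<close> for every \<open>l\<close> at once.\<close>
  define B where "B = max (max 0 (- ln e0)) (ln (max r0 1))"
  have "\<exists>C R. B \<le> min (- C) R \<and> ereal t < (INF l\<in>{0..1}. Lambda (strip C R) (Q K C R) l)"
  proof (rule ccontr)
    assume neg: "\<not> ?thesis"
    have "eventually (\<lambda>(C, R). B \<le> min (- C) R) (filtercomap (\<lambda>(C, R). min (- C) R) at_top)"
      using eventually_filtercomapI[OF eventually_ge_at_top[of B], of "\<lambda>(C, R). min (- C) R"]
      by (simp add: case_prod_unfold)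
    then have "eventually (\<lambda>x. (case x of (C, R) \<Rightarrow> INF l\<in>{0..1}. Lambda (strip C R) (Q K C R) l)
        \<le> ereal t)
        (filtercomap (\<lambda>(C, R). min (- C) R) at_top)"
      by eventually_elim (use neg in \<open>auto simp: not_less\<close>)
    from Limsup_bounded[OF this] tL show False by simp
  qed
  then obtain C R where CR: "B \<le> min (- C) R"
    and tI: "ereal t < (INF l\<in>{0..1}. Lambda (strip C R) (Q K C R) l)" by blast
  have "C \<le> ln e0" "C \<le> 0" "0 \<le> R" "ln (max r0 1) \<le> R" using CR by (auto simp: B_def)
  then have eC: "exp C \<le> e0" "exp C \<le> 1" "1 \<le> exp R" "r0 \<le> exp R"
    using e0 ln_le_cancel_iff[of "max r0 1" "exp R"] by (auto simp: ln_ge_iff[symmetric])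
  have qK: "ennreal q \<le> emeasure (K y) ({exp C<..exp R} \<times> UNIV)" if y: "y \<in> space Sigma'" for y
  proof (rule order_trans[OF mass[OF y] emeasure_mono])
    show "{e0<..r0} \<times> UNIV \<subseteq> {exp C<..exp R} \<times> (UNIV :: 's set)" using eC by auto
    have "{exp C<..exp R} \<times> (UNIV :: 's set) \<subseteq> {0<..} \<times> UNIV"
      by (auto intro: less_trans[OF exp_gt_zero])
    then show "{exp C<..exp R} \<times> UNIV \<in> sets (K y)"
      unfolding k.K_space(2)[OF y] Sigma'_def
      by (subst sets_restrict_space_iff) (simp_all add: borel_prod[symmetric])
  qed
  have grow: "\<exists>n\<ge>n0. \<exists>y\<in>space Sigma'. ennreal (exp (real n * (t + ln q)))
      \<le> (k.tilt l (exp C) (exp R) ^^ n) (\<lambda>_. 1) y"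
    if "0 \<le> l" "l \<le> 1" for l n0
  proof (rule k.tilt_growth[OF q(1) qK])
    show "ereal t < Lambda (strip C R) (Q K C R) l"
      using that by (intro less_le_trans[OF tI] INF_lower) simp
  qed
  have growth: "0 < t + ln q + ln b" using tq d by simp
  show ?thesis
  proof (rule k.uniform_block[OF A(1) exp_gt_zero eC(2,3) q(1) qK less_imp_le[OF b(2)] growth grow])
    fix e r s \<rho> :: real and n :: nat
    assume er: "0 < e" "e \<le> 1" "0 < n" "s \<le> 0" "0 < \<rho>" "\<rho> \<le> 1"
        "\<And>y. y \<in> space Sigma' \<Longrightarrow> ennreal \<rho> \<le> hit K e r n s y"
      and super: "1 < \<rho> * exp s * b ^ n"
    have "0 \<le> b" using b(2) by simp
    \<comment> \<open>The block is found with the full mean \<open>b\<close>, and the truncation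
      level is chosen only afterwards, depending on the block.\<close>
    from truncated_mean_power[OF b(1) this super]
    obtain L where L: "1 < \<rho> * exp s * (\<Sum>i<L. measure_pmf.prob p {k. i < min k L}) ^ n" .
    interpret block_weight M p K x0 off \<Gamma> e r s \<rho> "\<Sum>i<L. measure_pmf.prob p {k. i < min k L}" n L
      by unfold_locales (fact er refl L)+
    show ?thesis by (rule transient)
  qed
qed

theorem theorem3p6:
  fixes M :: "'w measure"
    and p :: "nat pmf"
    and b :: real
    and K :: "real \<times> 's::polish_space \<Rightarrow> (real \<times> 's) measure"
    and x0 :: "real \<times> 's"
    and off :: "nat list \<Rightarrow> 'w \<Rightarrow> nat"
    and \<Gamma> :: "nat list \<Rightarrow> 'w \<Rightarrow> real \<times> 's"
  assumes "K \<in> Sigma' \<rightarrow>\<^sub>M prob_algebra Sigma'"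
    and "integrable (measure_pmf p) real"
    and "b = measure_pmf.expectation p real"
    and "b > 1"
    and "x0 \<in> space Sigma'"
    and "markovian_environment M p K x0 off \<Gamma>"
    and "assumption1 K"
  shows "(assumption2 K \<longrightarrow>
            Limsup (filtercomap (\<lambda>(C, R). min (- C) R) at_top)
                (\<lambda>(C, R). INF l\<in>{0..1}. Lambda (strip C R) (Q K C R) l)
              > ereal (- ln b - ln (1 - real_of_ereal (eta K))) \<longrightarrow>
            transient M off \<Gamma>) \<and>
         ((INF l\<in>{0..1}. Lambda borel (K_ln K) l) < ereal (- ln b) \<longrightarrow>
            positive_recurrent M off \<Gamma>)"
proof -
  interpret markovian_environment M p K x0 off \<Gamma> by fact
  interpret markov_tree M p K x0 off \<Gamma> by unfold_locales fact
  interpret k: markov_kernel K by unfold_locales fact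
  have mean: "(\<integral>\<^sup>+ k. of_nat k \<partial>measure_pmf p) = ennreal b"
    using nn_integral_eq_integral[OF assms(2)] assms(3) by (simp add: ennreal_of_nat_eq_real_of_nat)
  show ?thesis
  proof (intro conjI impI)
    assume "assumption2 K" "Limsup (filtercomap (\<lambda>(C, R). min (- C) R) at_top)
        (\<lambda>(C, R). INF l\<in>{0..1}. Lambda (strip C R) (Q K C R) l)
          > ereal (- ln b - ln (1 - real_of_ereal (eta K)))"
    then show "transient M off \<Gamma>" by (rule transientI[OF mean assms(4,7)])
  next
    assume less: "(INF l\<in>{0..1}. Lambda borel (K_ln K) l) < ereal (- ln b)"
    obtain l a n0 where "0 < l" "l \<le> 1" "0 \<le> a" "a * b < 1"
      "\<And>n y. n \<ge> n0 \<Longrightarrow> y \<in> space Sigma' \<Longrightarrow> (moment_op K l ^^ n) (\<lambda>_. 1) y \<le> ennreal (a ^ n)"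
      using k.moment_op_bound[OF assms(4) less] by blast
    then show "positive_recurrent M off \<Gamma>"
      using assms(4) by (intro positive_recurrentI[OF _ _ mean, of l a n0]) auto
  qed
qed

end
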